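(* Let $R$ be a (commutative) Noetherian local ring, $I$ an ideal of $R$, $S=R/I$, and suppose that $I/I^2$ is a free $S$-module. Then the natural map of graded $S$-algebras $\bigwedge_S (I/I^2)\to \operatorname{Tor}^R_*(S,S)$ splits as a map of algebras; that is, there is a homomorphism of graded $S$-algebras $\operatorname{Tor}^R_*(S,S)\to\bigwedge_S (I/I^2)$ whose composition with the natural map, $\bigwedge_S (I/I^2)\to\operatorname{Tor}^R_*(S,S)\to\bigwedge_S (I/I^2)$, is the identity.
   Context: $\operatorname{Tor}^R_*(S,S)=\bigoplus_{i\ge 0}\operatorname{Tor}^R_i(S,S)$ carries its usual structure of a (strictly) graded-commutative $S$-algebra, e.g. computed as the homology of $P\otimes_R S$, where $P\to S$ is a resolution of $S$ by a graded-commutative differential graded $R$-algebra that is free as a graded $R$-module. There is a canonical isomorphism $\operatorname{Tor}^R_1(S,S)\cong I/I^2$ (if $x\in P_1$ has $\partial(x)=a\in I$, then the class of $x\otimes 1$ corresponds to the class of $a$ in $I/I^2$). The natural map $\bigwedge_S (I/I^2)\to\operatorname{Tor}^R_*(S,S)$ is the unique homomorphism of graded $S$-algebras which in degree $1$ is the isomorphism $I/I^2\cong\operatorname{Tor}^R_1(S,S)$. *)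

theory Defs
  imports "HOL-Algebra.Algebra"
begin

section \<open>Local rings and free modules\<close>

definition local_ring :: "('a, 'c) ring_scheme \<Rightarrow> bool" where
  "local_ring R \<longleftrightarrow> cring R \<and> (\<exists>!\<mm>. maximalideal \<mm> R)"

definition finsupp :: "('a, 'c) ring_scheme \<Rightarrow> 'x set \<Rightarrow> ('x \<Rightarrow> 'a) set" where
  "finsupp R U = {f. (\<forall>x\<in>U. f x \<in> carrier R) \<and> (\<forall>x. x \<notin> U \<longrightarrow> f x = \<zero>\<^bsub>R\<^esub>) \<and>
     finite {x. f x \<noteq> \<zero>\<^bsub>R\<^esub>}}"

definition module_basis ::
  "('a, 'c) ring_scheme \<Rightarrow> ('a, 'b, 'd) module_scheme \<Rightarrow> 'b set \<Rightarrow> bool" where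
  "module_basis R M B \<longleftrightarrow> B \<subseteq> carrier M \<and>
     (\<forall>x\<in>carrier M. \<exists>!c. c \<in> finsupp R B \<and>
        x = (\<Oplus>\<^bsub>M\<^esub>b\<in>{b. c b \<noteq> \<zero>\<^bsub>R\<^esub>}. c b \<odot>\<^bsub>M\<^esub> b))"

definition free_module :: "('a, 'c) ring_scheme \<Rightarrow> ('a, 'b, 'd) module_scheme \<Rightarrow> bool" where
  "free_module R M \<longleftrightarrow> module R M \<and> (\<exists>B. module_basis R M B)"

text \<open>The \<open>R/I\<close>-module \<open>I/I\<^sup>2\<close>. The fields \<open>mult\<close> and \<open>one\<close> of the record play no role; the
  scalar multiplication sends \<open>(r + I, a + I\<^sup>2)\<close> to \<open>ra + I\<^sup>2\<close>.\<close>

definition conormal_module :: "('a, 'c) ring_scheme \<Rightarrow> 'a set \<Rightarrow> ('a set, 'a set) module" where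
  "conormal_module R I =
     \<lparr>carrier = (\<lambda>a. (I \<cdot>\<^bsub>R\<^esub> I) +>\<^bsub>R\<^esub> a) ` I,
      monoid.mult = undefined, one = undefined,
      ring.zero = I \<cdot>\<^bsub>R\<^esub> I, ring.add = set_add R,
      smult = rcoset_mult R (I \<cdot>\<^bsub>R\<^esub> I)\<rparr>"


section \<open>Graded and differential graded algebras\<close>

record ('a, 'b) graded_algebra = "('a, 'b) module" +
  component :: "nat \<Rightarrow> 'b set"

record ('a, 'b) dg_algebra = "('a, 'b) graded_algebra" +
  differential :: "'b \<Rightarrow> 'b"

text \<open>Associative unital algebras; the locale \<open>algebra\<close> of the library requires commutativity,
  which fails for graded-commutative algebras.\<close>

locale assoc_algebra = module R A + A?: ring A for R and A (structure) +
  assumes smult_mult_left: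
      "\<lbrakk>r \<in> carrier R; x \<in> carrier A; y \<in> carrier A\<rbrakk>
        \<Longrightarrow> (r \<odot>\<^bsub>A\<^esub> x) \<otimes>\<^bsub>A\<^esub> y = r \<odot>\<^bsub>A\<^esub> (x \<otimes>\<^bsub>A\<^esub> y)"
    and smult_mult_right:
      "\<lbrakk>r \<in> carrier R; x \<in> carrier A; y \<in> carrier A\<rbrakk>
        \<Longrightarrow> x \<otimes>\<^bsub>A\<^esub> (r \<odot>\<^bsub>A\<^esub> y) = r \<odot>\<^bsub>A\<^esub> (x \<otimes>\<^bsub>A\<^esub> y)"

locale graded_algebra = assoc_algebra R A
  for R and A :: "('a, 'b, 'c) graded_algebra_scheme" (structure) +
  assumes component_submodule: "submodule (component A n) R A"
    and one_component: "\<one>\<^bsub>A\<^esub> \<in> component A 0"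
    and mult_component:
      "\<lbrakk>x \<in> component A m; y \<in> component A n\<rbrakk> \<Longrightarrow> x \<otimes>\<^bsub>A\<^esub> y \<in> component A (m + n)"
    and decomposition:
      "x \<in> carrier A \<Longrightarrow> \<exists>!f. (\<forall>n. f n \<in> component A n) \<and> finite {n. f n \<noteq> \<zero>\<^bsub>A\<^esub>} \<and>
         x = (\<Oplus>\<^bsub>A\<^esub>n\<in>{n. f n \<noteq> \<zero>\<^bsub>A\<^esub>}. f n)"

text \<open>Graded-commutativity is meant in the strict sense: elements of odd degree square to zero.\<close>

locale graded_commutative_algebra = graded_algebra R A
  for R and A :: "('a, 'b, 'c) graded_algebra_scheme" (structure) +
  assumes graded_commute:
      "\<lbrakk>x \<in> component A m; y \<in> component A n\<rbrakk>
        \<Longrightarrow> x \<otimes>\<^bsub>A\<^esub> y = (if even (m * n) then y \<otimes>\<^bsub>A\<^esub> x else \<ominus>\<^bsub>A\<^esub> (y \<otimes>\<^bsub>A\<^esub> x))"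
    and odd_square: "\<lbrakk>odd n; x \<in> component A n\<rbrakk> \<Longrightarrow> x \<otimes>\<^bsub>A\<^esub> x = \<zero>\<^bsub>A\<^esub>"

locale graded_commutative_dg_algebra = graded_commutative_algebra R A
  for R and A :: "('a, 'b, 'c) dg_algebra_scheme" (structure) +
  assumes differential_add:
      "\<lbrakk>x \<in> carrier A; y \<in> carrier A\<rbrakk>
        \<Longrightarrow> differential A (x \<oplus>\<^bsub>A\<^esub> y) = differential A x \<oplus>\<^bsub>A\<^esub> differential A y"
    and differential_smult:
      "\<lbrakk>r \<in> carrier R; x \<in> carrier A\<rbrakk>
        \<Longrightarrow> differential A (r \<odot>\<^bsub>A\<^esub> x) = r \<odot>\<^bsub>A\<^esub> differential A x"
    and differential_0: "x \<in> component A 0 \<Longrightarrow> differential A x = \<zero>\<^bsub>A\<^esub>"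
    and differential_Suc: "x \<in> component A (Suc n) \<Longrightarrow> differential A x \<in> component A n"
    and differential_differential:
      "x \<in> carrier A \<Longrightarrow> differential A (differential A x) = \<zero>\<^bsub>A\<^esub>"
    and Leibniz:
      "\<lbrakk>x \<in> component A m; y \<in> carrier A\<rbrakk> \<Longrightarrow> differential A (x \<otimes>\<^bsub>A\<^esub> y) =
         differential A x \<otimes>\<^bsub>A\<^esub> y \<oplus>\<^bsub>A\<^esub>
         (if even m then x \<otimes>\<^bsub>A\<^esub> differential A y else \<ominus>\<^bsub>A\<^esub> (x \<otimes>\<^bsub>A\<^esub> differential A y))"

definition graded_algebra_hom ::
  "('s, 'c) ring_scheme \<Rightarrow> ('s, 'x, 'd) graded_algebra_scheme \<Rightarrow>
   ('s, 'y, 'e) graded_algebra_scheme \<Rightarrow> ('x \<Rightarrow> 'y) set" where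
  "graded_algebra_hom S A B = {h. h \<in> ring_hom A B \<and>
     (\<forall>s\<in>carrier S. \<forall>x\<in>carrier A. h (s \<odot>\<^bsub>A\<^esub> x) = s \<odot>\<^bsub>B\<^esub> h x) \<and>
     (\<forall>n. h ` component A n \<subseteq> component B n)}"

text \<open>A resolution of \<open>S = R/I\<close> by a DG \<open>R\<close>-algebra \<open>P\<close> that is free as a graded \<open>R\<close>-module:
  the augmentation \<open>\<epsilon>\<close> is a morphism of DG \<open>R\<close>-algebras to \<open>S\<close> (in degree 0), and
  \<open>\<dots> \<rightarrow> P\<^sub>1 \<rightarrow> P\<^sub>0 \<rightarrow> S \<rightarrow> 0\<close> is exact. It is not required that \<open>P\<^sub>0 = R\<close>.\<close>

locale dg_algebra_resolution = graded_commutative_dg_algebra R P + ideal I R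
  for R (structure) and I and P :: "('a, 'p, 'c) dg_algebra_scheme" (structure) and \<epsilon> :: "'p \<Rightarrow> 'a set" +
  assumes component_free: "free_module R (P\<lparr>carrier := component P n\<rparr>)"
    and augmentation_hom: "\<epsilon> \<in> ring_hom P (R Quot I)"
    and augmentation_smult:
      "\<lbrakk>r \<in> carrier R; x \<in> carrier P\<rbrakk>
        \<Longrightarrow> \<epsilon> (r \<odot>\<^bsub>P\<^esub> x) = (I +>\<^bsub>R\<^esub> r) \<otimes>\<^bsub>R Quot I\<^esub> \<epsilon> x"
    and augmentation_Suc: "x \<in> component P (Suc n) \<Longrightarrow> \<epsilon> x = \<zero>\<^bsub>R Quot I\<^esub>"
    and augmentation_surj: "\<epsilon> ` component P 0 = carrier (R Quot I)"
    and exact_0: "{x \<in> component P 0. \<epsilon> x = \<zero>\<^bsub>R Quot I\<^esub>} = differential P ` component P 1"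
    and exact_Suc: "{x \<in> component P (Suc n). differential P x = \<zero>\<^bsub>P\<^esub>} =
      differential P ` component P (Suc (Suc n))"


section \<open>Monoid algebras and their quotients\<close>

text \<open>The algebra \<open>R[M]\<close> of a monoid \<open>M\<close>: finitely supported functions with convolution.\<close>

definition monoid_algebra ::
  "('a, 'c) ring_scheme \<Rightarrow> ('m, 'd) monoid_scheme \<Rightarrow> ('a, 'm \<Rightarrow> 'a) module" where
  "monoid_algebra R M =
     \<lparr>carrier = finsupp R (carrier M),
      monoid.mult = (\<lambda>f g w.
        \<Oplus>\<^bsub>R\<^esub>z\<in>{(u, v). f u \<noteq> \<zero>\<^bsub>R\<^esub> \<and> g v \<noteq> \<zero>\<^bsub>R\<^esub> \<and> u \<otimes>\<^bsub>M\<^esub> v = w}. f (fst z) \<otimes>\<^bsub>R\<^esub> g (snd z)),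
      one = (\<lambda>w. if w = \<one>\<^bsub>M\<^esub> then \<one>\<^bsub>R\<^esub> else \<zero>\<^bsub>R\<^esub>),
      ring.zero = (\<lambda>w. \<zero>\<^bsub>R\<^esub>),
      ring.add = (\<lambda>f g w. f w \<oplus>\<^bsub>R\<^esub> g w),
      smult = (\<lambda>r f w. r \<otimes>\<^bsub>R\<^esub> f w)\<rparr>"

definition single :: "('a, 'c) ring_scheme \<Rightarrow> 'm \<Rightarrow> 'm \<Rightarrow> 'a" where
  "single R m = (\<lambda>w. if w = m then \<one>\<^bsub>R\<^esub> else \<zero>\<^bsub>R\<^esub>)"

text \<open>The linear extension of a map \<open>\<phi>\<close> of basis elements, \<open>\<Sum> r\<^sub>m [m] \<mapsto> \<Sum> r\<^sub>m [\<phi> m]\<close>.\<close>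

definition push_forward ::
  "('a, 'c) ring_scheme \<Rightarrow> ('m \<Rightarrow> 'k) \<Rightarrow> ('m \<Rightarrow> 'a) \<Rightarrow> 'k \<Rightarrow> 'a" where
  "push_forward R \<phi> f = (\<lambda>y. \<Oplus>\<^bsub>R\<^esub>x\<in>{x. f x \<noteq> \<zero>\<^bsub>R\<^esub> \<and> \<phi> x = y}. f x)"


section \<open>The exterior algebra\<close>

definition free_monoid :: "'x set \<Rightarrow> 'x list monoid" where
  "free_monoid U = \<lparr>carrier = lists U, monoid.mult = (@), one = []\<rparr>"

text \<open>The exterior algebra is the tensor algebra modulo the squares of elements of \<open>M\<close>, and the
  tensor algebra is the free algebra on the set \<open>M\<close> modulo the linear relations of \<open>M\<close>.\<close>

definition exterior_ideal ::
  "('s, 'c) ring_scheme \<Rightarrow> ('s, 'm, 'd) module_scheme \<Rightarrow> ('m list \<Rightarrow> 's) set" where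
  "exterior_ideal S M = (let F = monoid_algebra S (free_monoid (carrier M)) in
     Idl\<^bsub>F\<^esub>
      ({single S [x \<oplus>\<^bsub>M\<^esub> y] \<ominus>\<^bsub>F\<^esub> (single S [x] \<oplus>\<^bsub>F\<^esub> single S [y]) | x y.
          x \<in> carrier M \<and> y \<in> carrier M} \<union>
       {single S [s \<odot>\<^bsub>M\<^esub> x] \<ominus>\<^bsub>F\<^esub> s \<odot>\<^bsub>F\<^esub> single S [x] | s x.
          s \<in> carrier S \<and> x \<in> carrier M} \<union>
       {single S [x, x] | x. x \<in> carrier M}))"

definition exterior_algebra ::
  "('s, 'c) ring_scheme \<Rightarrow> ('s, 'm, 'd) module_scheme \<Rightarrow> ('s, ('m list \<Rightarrow> 's) set) graded_algebra"
  where
  "exterior_algebra S M =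
     (let F = monoid_algebra S (free_monoid (carrier M)); J = exterior_ideal S M in
      \<lparr>carrier = carrier (F Quot J), monoid.mult = monoid.mult (F Quot J), one = one (F Quot J),
       ring.zero = ring.zero (F Quot J), ring.add = ring.add (F Quot J),
       smult = (\<lambda>s U. \<Union>f\<in>U. J +>\<^bsub>F\<^esub> (s \<odot>\<^bsub>F\<^esub> f)),
       component = (\<lambda>n. (\<lambda>f. J +>\<^bsub>F\<^esub> f) `
         {f \<in> carrier F. \<forall>w. f w \<noteq> \<zero>\<^bsub>S\<^esub> \<longrightarrow> length w = n})\<rparr>)"

definition exterior_incl ::
  "('s, 'c) ring_scheme \<Rightarrow> ('s, 'm, 'd) module_scheme \<Rightarrow> 'm \<Rightarrow> ('m list \<Rightarrow> 's) set" where
  "exterior_incl S M x =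
     exterior_ideal S M +>\<^bsub>monoid_algebra S (free_monoid (carrier M))\<^esub> single S [x]"


section \<open>Base change\<close>

text \<open>For an \<open>R\<close>-algebra \<open>P\<close> and a ring homomorphism \<open>\<phi> : R \<rightarrow> S\<close> of commutative rings, the
  algebra \<open>P \<otimes>\<^sub>R S\<close> is the free \<open>R\<close>-module on the set \<open>P \<times> S\<close> modulo the bilinearity relations,
  multiplied by \<open>(p \<otimes> s)(q \<otimes> t) = pq \<otimes> st\<close>. The span of the relations below is already a two-sided
  ideal of the algebra of the multiplicative monoid \<open>P \<times> S\<close>, so taking the ideal they generate
  imposes nothing further.\<close>

definition base_change_ideal ::
  "('a, 'c) ring_scheme \<Rightarrow> ('s, 'd) ring_scheme \<Rightarrow> ('a \<Rightarrow> 's) \<Rightarrow> ('a, 'p, 'e) module_scheme \<Rightarrow>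
   ('p \<times> 's \<Rightarrow> 'a) set" where
  "base_change_ideal R S \<phi> P = (let F = monoid_algebra R (P \<times>\<times> S) in
     Idl\<^bsub>F\<^esub>
      ({single R (p \<oplus>\<^bsub>P\<^esub> q, s) \<ominus>\<^bsub>F\<^esub> (single R (p, s) \<oplus>\<^bsub>F\<^esub> single R (q, s)) | p q s.
          p \<in> carrier P \<and> q \<in> carrier P \<and> s \<in> carrier S} \<union>
       {single R (p, s \<oplus>\<^bsub>S\<^esub> t) \<ominus>\<^bsub>F\<^esub> (single R (p, s) \<oplus>\<^bsub>F\<^esub> single R (p, t)) | p s t.
          p \<in> carrier P \<and> s \<in> carrier S \<and> t \<in> carrier S} \<union>
       {single R (r \<odot>\<^bsub>P\<^esub> p, s) \<ominus>\<^bsub>F\<^esub> r \<odot>\<^bsub>F\<^esub> single R (p, s) | r p s.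
          r \<in> carrier R \<and> p \<in> carrier P \<and> s \<in> carrier S} \<union>
       {single R (p, \<phi> r \<otimes>\<^bsub>S\<^esub> s) \<ominus>\<^bsub>F\<^esub> r \<odot>\<^bsub>F\<^esub> single R (p, s) | r p s.
          r \<in> carrier R \<and> p \<in> carrier P \<and> s \<in> carrier S}))"

definition pure_tensor ::
  "('a, 'c) ring_scheme \<Rightarrow> ('s, 'd) ring_scheme \<Rightarrow> ('a \<Rightarrow> 's) \<Rightarrow> ('a, 'p, 'e) module_scheme \<Rightarrow>
   'p \<Rightarrow> 's \<Rightarrow> ('p \<times> 's \<Rightarrow> 'a) set" where
  "pure_tensor R S \<phi> P p s =
     base_change_ideal R S \<phi> P +>\<^bsub>monoid_algebra R (P \<times>\<times> S)\<^esub> single R (p, s)"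

text \<open>The DG \<open>S\<close>-algebra \<open>P \<otimes>\<^sub>R S\<close>, with \<open>S\<close> acting through \<open>s \<mapsto> 1 \<otimes> s\<close>, with
  \<open>(P \<otimes>\<^sub>R S)\<^sub>n\<close> the image of \<open>P\<^sub>n \<otimes>\<^sub>R S\<close>, and with differential \<open>\<partial> \<otimes> S\<close>.\<close>

definition base_change ::
  "('a, 'c) ring_scheme \<Rightarrow> ('s, 'd) ring_scheme \<Rightarrow> ('a \<Rightarrow> 's) \<Rightarrow> ('a, 'p, 'e) dg_algebra_scheme \<Rightarrow>
   ('s, ('p \<times> 's \<Rightarrow> 'a) set) dg_algebra" where
  "base_change R S \<phi> P =
     (let F = monoid_algebra R (P \<times>\<times> S); J = base_change_ideal R S \<phi> P in
      \<lparr>carrier = carrier (F Quot J), monoid.mult = monoid.mult (F Quot J), one = one (F Quot J),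
       ring.zero = ring.zero (F Quot J), ring.add = ring.add (F Quot J),
       smult = (\<lambda>s U. pure_tensor R S \<phi> P \<one>\<^bsub>P\<^esub> s \<otimes>\<^bsub>F Quot J\<^esub> U),
       component = (\<lambda>n. (\<lambda>f. J +>\<^bsub>F\<^esub> f) `
         {f \<in> carrier F. \<forall>p s. f (p, s) \<noteq> \<zero>\<^bsub>R\<^esub> \<longrightarrow> p \<in> component P n}),
       differential = (\<lambda>U. \<Union>f\<in>U. J +>\<^bsub>F\<^esub> push_forward R (\<lambda>(p, s). (differential P p, s)) f)\<rparr>)"


section \<open>Homology and the Tor algebra\<close>

definition cycles :: "('s, 'x, 'd) dg_algebra_scheme \<Rightarrow> 'x set" where
  "cycles A = {x \<in> carrier A. differential A x = \<zero>\<^bsub>A\<^esub>}"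

definition boundaries :: "('s, 'x, 'd) dg_algebra_scheme \<Rightarrow> 'x set" where
  "boundaries A = differential A ` carrier A"

definition homology_algebra ::
  "('s, 'x, 'd) dg_algebra_scheme \<Rightarrow> ('s, 'x set) graded_algebra" where
  "homology_algebra A =
     (let H = A\<lparr>carrier := cycles A\<rparr> Quot boundaries A in
      \<lparr>carrier = carrier H, monoid.mult = monoid.mult H, one = one H, ring.zero = ring.zero H, ring.add = ring.add H,
       smult = (\<lambda>s U. \<Union>z\<in>U. boundaries A +>\<^bsub>A\<^esub> (s \<odot>\<^bsub>A\<^esub> z)),
       component = (\<lambda>n. (\<lambda>z. boundaries A +>\<^bsub>A\<^esub> z) ` (cycles A \<inter> component A n))\<rparr>)"

text \<open>\<open>P \<otimes>\<^sub>R R/I\<close> and its homology. If \<open>P\<close> is a DG algebra resolution of \<open>R/I\<close> over \<open>R\<close>, the latter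
  is \<open>Tor\<^sup>R\<^sub>*(R/I, R/I)\<close>.\<close>

definition Tor_complex ::
  "('a, 'c) ring_scheme \<Rightarrow> 'a set \<Rightarrow> ('a, 'p, 'e) dg_algebra_scheme \<Rightarrow>
   ('a set, ('p \<times> 'a set \<Rightarrow> 'a) set) dg_algebra" where
  "Tor_complex R I P = base_change R (R Quot I) (\<lambda>r. I +>\<^bsub>R\<^esub> r) P"

definition Tor_algebra ::
  "('a, 'c) ring_scheme \<Rightarrow> 'a set \<Rightarrow> ('a, 'p, 'e) dg_algebra_scheme \<Rightarrow>
   ('a set, ('p \<times> 'a set \<Rightarrow> 'a) set set) graded_algebra" where
  "Tor_algebra R I P = homology_algebra (Tor_complex R I P)"

text \<open>The class of \<open>x \<otimes> 1\<close>, when that is a cycle.\<close>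

definition Tor_class ::
  "('a, 'c) ring_scheme \<Rightarrow> 'a set \<Rightarrow> ('a, 'p, 'e) dg_algebra_scheme \<Rightarrow> 'p \<Rightarrow>
   ('p \<times> 'a set \<Rightarrow> 'a) set set" where
  "Tor_class R I P x = boundaries (Tor_complex R I P) +>\<^bsub>Tor_complex R I P\<^esub>
     pure_tensor R (R Quot I) (\<lambda>r. I +>\<^bsub>R\<^esub> r) P x \<one>\<^bsub>R Quot I\<^esub>"

text \<open>The unique homomorphism of graded \<open>R/I\<close>-algebras \<open>\<Lambda>(I/I\<^sup>2) \<rightarrow> Tor\<close> which in degree 1 is the
  canonical isomorphism: the class of \<open>a \<in> I\<close> goes to that of \<open>x \<otimes> 1\<close> whenever \<open>x \<in> P\<^sub>1\<close> and
  \<open>\<partial> x = a\<close> in \<open>P\<^sub>0\<close>. Extensionality makes it unique as a function of the ambient type.\<close>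

definition natural_map ::
  "('a, 'c) ring_scheme \<Rightarrow> 'a set \<Rightarrow> ('a, 'p, 'e) dg_algebra_scheme \<Rightarrow>
   ('a set list \<Rightarrow> 'a set) set \<Rightarrow> ('p \<times> 'a set \<Rightarrow> 'a) set set" where
  "natural_map R I P =
     (let S = R Quot I; M = conormal_module R I; E = exterior_algebra S M in
      THE \<nu>. \<nu> \<in> graded_algebra_hom S E (Tor_algebra R I P) \<and> \<nu> \<in> extensional (carrier E) \<and>
        (\<forall>a\<in>I. \<forall>x\<in>component P 1. differential P x = a \<odot>\<^bsub>P\<^esub> \<one>\<^bsub>P\<^esub> \<longrightarrow>
           \<nu> (exterior_incl S M ((I \<cdot>\<^bsub>R\<^esub> I) +>\<^bsub>R\<^esub> a)) = Tor_class R I P x))"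

end

theory Submission
  imports Defs
begin

text \<open>Write \<open>S = R/I\<close>. For an \<open>S\<close>-linear functional \<open>\<theta>\<close> on \<open>I/I\<^sup>2\<close>, consider the Bockstein of
  \<open>P \<otimes> -\<close> for the pushout of \<open>0 \<rightarrow> I/I\<^sup>2 \<rightarrow> R/I\<^sup>2 \<rightarrow> S \<rightarrow> 0\<close> along \<open>\<theta>\<close>: if \<open>x \<in> P\<close> satisfies
  \<open>\<partial>x = \<Sum> a\<^sub>k p\<^sub>k \<in> IP\<close>, then \<open>D\<^sub>\<theta>[x] = [\<Sum> \<theta>(a\<^sub>k) p\<^sub>k]\<close>. As \<open>P\<close> is free, this is well defined, and the
  Leibniz rule of \<open>P\<close> makes \<open>D\<^sub>\<theta>\<close> an \<open>S\<close>-linear derivation of degree \<open>-1\<close> of the Tor algebra, which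
  sends the class of \<open>a \<in> I\<close> in \<open>Tor\<^sub>1\<close> to \<open>\<theta>(a)\<close>. Let \<open>\<theta>\<^sub>1, \<dots>, \<theta>\<^sub>n\<close> be dual to a basis \<open>e\<^sub>1, \<dots>, e\<^sub>n\<close>
  of \<open>I/I\<^sup>2\<close>. Each \<open>1 + e\<^sub>i D\<^sub>i\<close> is multiplicative with values in \<open>\<Lambda>(I/I\<^sup>2) \<otimes> Tor\<close>, because \<open>e\<^sub>i\<close> is odd of
  square zero; the product of these maps followed by the augmentation \<open>Tor \<rightarrow> S\<close> is an algebra map
  \<open>Tor \<rightarrow> \<Lambda>(I/I\<^sup>2)\<close>. It sends the class of \<open>a\<close> to \<open>\<Sum> \<theta>\<^sub>i(a) e\<^sub>i\<close>, so it splits the natural map in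
  degree 1, hence everywhere.\<close>

section \<open>Finitely supported functions and linear combinations\<close>

text \<open>Nothing is known about generators of Tor, so a homomorphism out of Tor is obtained by
  modifying the one evident homomorphism Tor -> S -> E, where E is the exterior algebra. Each factor
  replaces a homomorphism \<open>K\<close> by \<open>K + e K(D _)\<close>: the derivation acts
  inside Tor and \<open>e\<close> multiplies inside E, so that the tensor product of E and Tor never
  has to be formed, and multiplicativity is a matter of one factor at a time. The Noetherian
  hypothesis bounds the number of factors: a coordinate functional that vanishes on finitely many
  generators of I is zero.

  Elements of Tor are cosets of cosets in a monoid algebra. All computations are therefore pulled
  back to P: the tensor product of P and S is P/IP, a cycle is an x with \<partial>x in IP, and
  \<theta> acts on IP through coordinates with respect to bases of the \<open>P\<^sub>n\<close>.
  Direct sum decompositions are used in P alone; in Tor the homogeneous classes are only shown to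
  span, because the Leibniz rule needs a homogeneous left factor.\<close>

lemma finsupp_support: "f \<in> finsupp R U \<Longrightarrow> {x. f x \<noteq> \<zero>\<^bsub>R\<^esub>} \<subseteq> U"
  by (auto simp: finsupp_def)

lemma finsupp_finite: "f \<in> finsupp R U \<Longrightarrow> finite {x. f x \<noteq> \<zero>\<^bsub>R\<^esub>}"
  by (auto simp: finsupp_def)

lemma (in cring) finsupp_closed: "f \<in> finsupp R U \<Longrightarrow> f x \<in> carrier R"
  by (cases "x \<in> U") (auto simp: finsupp_def)

lemma (in cring) finsupp_zero: "(\<lambda>x. \<zero>) \<in> finsupp R U"
  by (auto simp: finsupp_def)

lemma (in cring) finsupp_add:
  assumes "f \<in> finsupp R U" "g \<in> finsupp R U"
  shows "(\<lambda>x. f x \<oplus> g x) \<in> finsupp R U"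
proof -
  have "{x. f x \<oplus> g x \<noteq> \<zero>} \<subseteq> {x. f x \<noteq> \<zero>} \<union> {x. g x \<noteq> \<zero>}" by auto
  then have "finite {x. f x \<oplus> g x \<noteq> \<zero>}"
    using assms by (auto dest!: finsupp_finite intro: finite_subset)
  then show ?thesis using assms by (auto simp: finsupp_def)
qed

lemma (in cring) finsupp_smult:
  assumes "r \<in> carrier R" "f \<in> finsupp R U"
  shows "(\<lambda>x. r \<otimes> f x) \<in> finsupp R U"
proof -
  have "{x. r \<otimes> f x \<noteq> \<zero>} \<subseteq> {x. f x \<noteq> \<zero>}" using assms by auto
  then have "finite {x. r \<otimes> f x \<noteq> \<zero>}"
    using assms by (auto dest!: finsupp_finite intro: finite_subset)
  then show ?thesis using assms by (auto simp: finsupp_def)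
qed

lemma (in cring) finsupp_uminus:
  assumes "f \<in> finsupp R U"
  shows "(\<lambda>x. \<ominus> f x) \<in> finsupp R U"
proof -
  have "(\<lambda>x. \<ominus> f x) = (\<lambda>x. (\<ominus> \<one>) \<otimes> f x)"
    using finsupp_closed[OF assms] by (simp add: l_minus)
  then show ?thesis using finsupp_smult[OF _ assms, of "\<ominus> \<one>"] by simp
qed

lemma (in cring) single_finsupp: "x \<in> U \<Longrightarrow> single R x \<in> finsupp R U"
  by (auto simp: finsupp_def single_def)

text \<open>Induction on the finite support, removing one point at a time. Linear and bilinear
  identities for formal sums are reduced to basis elements by this rule.\<close>

lemma (in cring) finsupp_induct [consumes 1, case_names zero add]:
  assumes "f \<in> finsupp R U"
    and zero: "Q (\<lambda>x. \<zero>)"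
    and add: "\<And>r x g. \<lbrakk>r \<in> carrier R; x \<in> U; g \<in> finsupp R U; Q g\<rbrakk>
      \<Longrightarrow> Q (\<lambda>y. r \<otimes> single R x y \<oplus> g y)"
  shows "Q f"
proof -
  have "\<forall>f \<in> finsupp R U. {x. f x \<noteq> \<zero>} = A \<longrightarrow> Q f" if "finite A" for A
    using that
  proof (induction A rule: finite_induct)
    case empty
    show ?case
    proof (intro ballI impI)
      fix f assume "f \<in> finsupp R U" "{x. f x \<noteq> \<zero>} = {}"
      then have "f = (\<lambda>x. \<zero>)" by auto
      with zero show "Q f" by (rule back_subst[OF _ sym])
    qed
  next
    case (insert a A)
    show ?case
    proof (intro ballI impI)
      fix f assume f: "f \<in> finsupp R U" and A: "{x. f x \<noteq> \<zero>} = insert a A"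
      have aU: "a \<in> U" using finsupp_support[OF f] A by blast
      define g where "g = f(a := \<zero>)"
      have g: "{x. g x \<noteq> \<zero>} = A" using A insert.hyps by (auto simp: g_def)
      have gU: "g \<in> finsupp R U"
        using f insert.hyps g by (auto simp: finsupp_def g_def)
      have eq: "f = (\<lambda>y. f a \<otimes> single R a y \<oplus> g y)"
        using finsupp_closed[OF f] by (auto simp: single_def g_def)
      have "Q g" using insert.IH[rule_format, OF gU g] .
      then show "Q f" by (subst eq) (rule add[OF finsupp_closed[OF f, of a] aU gU])
    qed
  qed
  from this[rule_format, OF finsupp_finite[OF assms(1)] assms(1) refl] show ?thesis .
qed

text \<open>The form in which \<open>module_basis\<close> writes linear combinations.\<close>

definition lincomb ::
  "('a, 'c) ring_scheme \<Rightarrow> ('a, 'b, 'd) module_scheme \<Rightarrow> ('x \<Rightarrow> 'b) \<Rightarrow> ('x \<Rightarrow> 'a) \<Rightarrow> 'b" where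
  "lincomb R M v f = (\<Oplus>\<^bsub>M\<^esub>x\<in>{x. f x \<noteq> \<zero>\<^bsub>R\<^esub>}. f x \<odot>\<^bsub>M\<^esub> v x)"

context module
begin

text \<open>Supports shrink when terms cancel, so sums belonging to different functions can be
  compared only over a common finite set \<open>A\<close> that contains all their supports.\<close>

lemma lincomb_superset:
  assumes f: "f \<in> finsupp R U" and v: "\<And>x. x \<in> U \<Longrightarrow> v x \<in> carrier M"
    and A: "finite A" "{x. f x \<noteq> \<zero>} \<subseteq> A" "A \<subseteq> U"
  shows "lincomb R M v f = (\<Oplus>\<^bsub>M\<^esub>x\<in>A. f x \<odot>\<^bsub>M\<^esub> v x)"
  unfolding lincomb_def
  by (rule M.add.finprod_mono_neutral_cong_left)
    (use A v R.finsupp_closed[OF f] in auto)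

lemma lincomb_closed:
  assumes f: "f \<in> finsupp R U" and v: "\<And>x. x \<in> U \<Longrightarrow> v x \<in> carrier M"
  shows "lincomb R M v f \<in> carrier M"
  unfolding lincomb_def
  by (rule M.finsum_closed)
    (use finsupp_support[OF f] v R.finsupp_closed[OF f] in blast)

lemma lincomb_zero [simp]: "lincomb R M v (\<lambda>x. \<zero>) = \<zero>\<^bsub>M\<^esub>"
  by (simp add: lincomb_def)

lemma lincomb_add:
  assumes f: "f \<in> finsupp R U" and g: "g \<in> finsupp R U"
    and v: "\<And>x. x \<in> U \<Longrightarrow> v x \<in> carrier M"
  shows "lincomb R M v (\<lambda>x. f x \<oplus> g x) = lincomb R M v f \<oplus>\<^bsub>M\<^esub> lincomb R M v g"
proof -
  let ?A = "{x. f x \<noteq> \<zero>} \<union> {x. g x \<noteq> \<zero>}"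
  have A: "finite ?A" "?A \<subseteq> U"
    using finsupp_finite[OF f] finsupp_finite[OF g] finsupp_support[OF f] finsupp_support[OF g]
    by auto
  have "lincomb R M v (\<lambda>x. f x \<oplus> g x) = (\<Oplus>\<^bsub>M\<^esub>x\<in>?A. (f x \<oplus> g x) \<odot>\<^bsub>M\<^esub> v x)"
    by (rule lincomb_superset[OF R.finsupp_add[OF f g] v]) (use A in auto)
  also have "\<dots> = (\<Oplus>\<^bsub>M\<^esub>x\<in>?A. f x \<odot>\<^bsub>M\<^esub> v x \<oplus>\<^bsub>M\<^esub> g x \<odot>\<^bsub>M\<^esub> v x)"
    by (rule M.finsum_cong')
      (use A(2) v R.finsupp_closed[OF f] R.finsupp_closed[OF g] in \<open>auto intro!: smult_l_distr\<close>)
  also have "\<dots> = (\<Oplus>\<^bsub>M\<^esub>x\<in>?A. f x \<odot>\<^bsub>M\<^esub> v x) \<oplus>\<^bsub>M\<^esub> (\<Oplus>\<^bsub>M\<^esub>x\<in>?A. g x \<odot>\<^bsub>M\<^esub> v x)"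
    by (rule M.finsum_addf)
      (use A(2) v R.finsupp_closed[OF f] R.finsupp_closed[OF g] in auto)
  also have "\<dots> = lincomb R M v f \<oplus>\<^bsub>M\<^esub> lincomb R M v g"
    using lincomb_superset[OF f v A(1) _ A(2)] lincomb_superset[OF g v A(1) _ A(2)] by simp
  finally show ?thesis .
qed

lemma lincomb_smult:
  assumes r: "r \<in> carrier R" and f: "f \<in> finsupp R U"
    and v: "\<And>x. x \<in> U \<Longrightarrow> v x \<in> carrier M"
  shows "lincomb R M v (\<lambda>x. r \<otimes> f x) = r \<odot>\<^bsub>M\<^esub> lincomb R M v f"
proof -
  let ?A = "{x. f x \<noteq> \<zero>}"
  have A: "finite ?A" "?A \<subseteq> U"
    using finsupp_finite[OF f] finsupp_support[OF f] by auto
  have "lincomb R M v (\<lambda>x. r \<otimes> f x) = (\<Oplus>\<^bsub>M\<^esub>x\<in>?A. (r \<otimes> f x) \<odot>\<^bsub>M\<^esub> v x)"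
    by (rule lincomb_superset[OF R.finsupp_smult[OF r f] v]) (use A r in auto)
  also have "\<dots> = (\<Oplus>\<^bsub>M\<^esub>x\<in>?A. r \<odot>\<^bsub>M\<^esub> (f x \<odot>\<^bsub>M\<^esub> v x))"
    by (rule M.finsum_cong')
      (use A(2) v r R.finsupp_closed[OF f] in \<open>auto intro!: smult_assoc1\<close>)
  also have "\<dots> = r \<odot>\<^bsub>M\<^esub> (\<Oplus>\<^bsub>M\<^esub>x\<in>?A. f x \<odot>\<^bsub>M\<^esub> v x)"
    by (rule finsum_smult_ldistr[symmetric])
      (use A v r R.finsupp_closed[OF f] in auto)
  finally show ?thesis by (simp add: lincomb_def)
qed

lemma lincomb_single:
  assumes x: "v x \<in> carrier M"
  shows "lincomb R M v (single R x) = v x"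
proof -
  have "lincomb R M v (single R x) = (\<Oplus>\<^bsub>M\<^esub>y\<in>{x}. single R x y \<odot>\<^bsub>M\<^esub> v y)"
    by (rule lincomb_superset[OF R.single_finsupp[of x "{x}"]])
      (use x in \<open>auto simp: single_def\<close>)
  then show ?thesis using x by (simp add: single_def)
qed

text \<open>The condition on \<open>v\<close> concerns the support of \<open>f\<close> only. In
  \<open>C_component\<close> the index set contains elements of every degree, and just those in the
  support are homogeneous.\<close>

lemma lincomb_in_submodule:
  assumes N: "submodule N R M" and f: "f \<in> finsupp R U"
    and v: "\<And>x. f x \<noteq> \<zero> \<Longrightarrow> v x \<in> N"
  shows "lincomb R M v f \<in> N"
proof -
  note NE = submoduleE[OF N]
  have zN: "\<zero>\<^bsub>M\<^esub> \<in> N" using NE(1,2,4) 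
    by (metis R.zero_closed ex_in_conv smult_l_null subsetD)
  have "(\<Oplus>\<^bsub>M\<^esub>x\<in>A. f x \<odot>\<^bsub>M\<^esub> v x) \<in> N" if "finite A" "\<And>x. x \<in> A \<Longrightarrow> v x \<in> N" for A
    using that
  proof (induction A rule: finite_induct)
    case empty
    then show ?case using zN by simp
  next
    case (insert a A)
    have *: "f x \<odot>\<^bsub>M\<^esub> v x \<in> N" if "x \<in> insert a A" for x
      using NE(4) insert.prems that R.finsupp_closed[OF f] by auto
    have "(\<Oplus>\<^bsub>M\<^esub>x\<in>insert a A. f x \<odot>\<^bsub>M\<^esub> v x)
      = f a \<odot>\<^bsub>M\<^esub> v a \<oplus>\<^bsub>M\<^esub> (\<Oplus>\<^bsub>M\<^esub>x\<in>A. f x \<odot>\<^bsub>M\<^esub> v x)"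
      by (rule M.finsum_insert) (use insert.hyps * NE(1) in auto)
    then show ?case using NE(5) * insert by auto
  qed
  then show ?thesis using finsupp_finite[OF f] v unfolding lincomb_def by blast
qed

end


section \<open>The algebra of a monoid\<close>

lemma monoid_algebra_simps:
  "carrier (monoid_algebra R M) = finsupp R (carrier M)"
  "\<one>\<^bsub>monoid_algebra R M\<^esub> = single R \<one>\<^bsub>M\<^esub>"
  "\<zero>\<^bsub>monoid_algebra R M\<^esub> = (\<lambda>w. \<zero>\<^bsub>R\<^esub>)"
  "f \<oplus>\<^bsub>monoid_algebra R M\<^esub> g = (\<lambda>w. f w \<oplus>\<^bsub>R\<^esub> g w)"
  "r \<odot>\<^bsub>monoid_algebra R M\<^esub> f = (\<lambda>w. r \<otimes>\<^bsub>R\<^esub> f w)"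
  by (simp_all add: monoid_algebra_def single_def)

text \<open>There are two instances: the free monoid on the elements of a module, which leads to the
  exterior algebra, and the multiplicative monoid \<open>P \<times>\<times> S\<close>, which leads
  to the tensor product.\<close>

locale cring_monoid = R: cring R + M: monoid M
  for R :: "('a, 'c) ring_scheme" (structure) and M :: "('m, 'd) monoid_scheme" (structure)
begin

abbreviation F where "F \<equiv> monoid_algebra R M"

lemma module_F: "module R F"
proof (rule moduleI)
  show "abelian_group F"
  proof (rule abelian_groupI)
    fix f assume f: "f \<in> carrier F"
    show "\<exists>g\<in>carrier F. g \<oplus>\<^bsub>F\<^esub> f = \<zero>\<^bsub>F\<^esub>"
      using R.finsupp_uminus[of f "carrier M"] f R.finsupp_closed[of f "carrier M"]
      by (intro bexI[of _ "\<lambda>w. \<ominus>\<^bsub>R\<^esub> f w"]) (auto simp: monoid_algebra_simps R.l_neg)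
  qed (auto simp: monoid_algebra_simps R.finsupp_add R.finsupp_zero R.finsupp_closed
      R.a_ac fun_eq_iff)
qed (auto simp: monoid_algebra_simps R.finsupp_smult R.finsupp_closed R.l_distr R.r_distr
    R.m_assoc R.cring_axioms fun_eq_iff)

sublocale FM: module R F by (rule module_F)

text \<open>The index set in the definition depends on both supports and on \<open>w\<close>. Over a
  fixed rectangle, with the condition moved into the summand, bilinearity of convolution becomes
  additivity of finite sums.\<close>

lemma F_mult_eq:
  assumes f: "f \<in> carrier F" and g: "g \<in> carrier F"
    and A: "finite A" "{x. f x \<noteq> \<zero>\<^bsub>R\<^esub>} \<subseteq> A" and B: "finite B" "{x. g x \<noteq> \<zero>\<^bsub>R\<^esub>} \<subseteq> B"
  shows "(f \<otimes>\<^bsub>F\<^esub> g) w =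
    (\<Oplus>\<^bsub>R\<^esub>z\<in>A \<times> B. if fst z \<otimes>\<^bsub>M\<^esub> snd z = w then f (fst z) \<otimes>\<^bsub>R\<^esub> g (snd z) else \<zero>\<^bsub>R\<^esub>)"
proof -
  have cl: "f x \<in> carrier R" "g x \<in> carrier R" for x
    using f g R.finsupp_closed by (auto simp: monoid_algebra_simps)
  have "(f \<otimes>\<^bsub>F\<^esub> g) w =
    (\<Oplus>\<^bsub>R\<^esub>z\<in>{(u, v). f u \<noteq> \<zero>\<^bsub>R\<^esub> \<and> g v \<noteq> \<zero>\<^bsub>R\<^esub> \<and> u \<otimes>\<^bsub>M\<^esub> v = w}. f (fst z) \<otimes>\<^bsub>R\<^esub> g (snd z))"
    by (simp add: monoid_algebra_def)
  also have "\<dots> = (\<Oplus>\<^bsub>R\<^esub>z\<in>A \<times> B. if fst z \<otimes>\<^bsub>M\<^esub> snd z = w then f (fst z) \<otimes>\<^bsub>R\<^esub> g (snd z) else \<zero>\<^bsub>R\<^esub>)"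
    by (rule R.add.finprod_mono_neutral_cong_left) (use A B cl in auto)
  finally show ?thesis .
qed

lemma F_mult_l_distr:
  assumes f: "f \<in> carrier F" and g: "g \<in> carrier F" and h: "h \<in> carrier F"
  shows "(f \<oplus>\<^bsub>F\<^esub> g) \<otimes>\<^bsub>F\<^esub> h = f \<otimes>\<^bsub>F\<^esub> h \<oplus>\<^bsub>F\<^esub> g \<otimes>\<^bsub>F\<^esub> h"
proof
  fix w
  let ?A = "{x. f x \<noteq> \<zero>\<^bsub>R\<^esub>} \<union> {x. g x \<noteq> \<zero>\<^bsub>R\<^esub>}" and ?B = "{x. h x \<noteq> \<zero>\<^bsub>R\<^esub>}"
  have cl: "f x \<in> carrier R" "g x \<in> carrier R" "h x \<in> carrier R" for x
    using f g h R.finsupp_closed by (auto simp: monoid_algebra_simps)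
  have fin: "finite ?A" "finite ?B"
    using f g h by (auto simp: monoid_algebra_simps dest: finsupp_finite)
  have fg: "f \<oplus>\<^bsub>F\<^esub> g \<in> carrier F" "{x. (f \<oplus>\<^bsub>F\<^esub> g) x \<noteq> \<zero>\<^bsub>R\<^esub>} \<subseteq> ?A"
    using FM.M.a_closed[OF f g] by (auto simp: monoid_algebra_simps)
  have "((f \<oplus>\<^bsub>F\<^esub> g) \<otimes>\<^bsub>F\<^esub> h) w = (\<Oplus>\<^bsub>R\<^esub>z\<in>?A \<times> ?B.
     (if fst z \<otimes>\<^bsub>M\<^esub> snd z = w then f (fst z) \<otimes>\<^bsub>R\<^esub> h (snd z) else \<zero>\<^bsub>R\<^esub>) \<oplus>\<^bsub>R\<^esub>
     (if fst z \<otimes>\<^bsub>M\<^esub> snd z = w then g (fst z) \<otimes>\<^bsub>R\<^esub> h (snd z) else \<zero>\<^bsub>R\<^esub>))"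
    unfolding F_mult_eq[OF fg(1) h fin(1) fg(2) fin(2) order_refl]
    by (rule R.finsum_cong') (use cl in \<open>auto simp: monoid_algebra_simps R.l_distr\<close>)
  also have "\<dots> = (f \<otimes>\<^bsub>F\<^esub> h \<oplus>\<^bsub>F\<^esub> g \<otimes>\<^bsub>F\<^esub> h) w"
    using F_mult_eq[OF f h fin(1) _ fin(2) order_refl] F_mult_eq[OF g h fin(1) _ fin(2) order_refl]
    by (subst R.finsum_addf) (use cl in \<open>auto simp: monoid_algebra_simps(4)\<close>)
  finally show "((f \<oplus>\<^bsub>F\<^esub> g) \<otimes>\<^bsub>F\<^esub> h) w = (f \<otimes>\<^bsub>F\<^esub> h \<oplus>\<^bsub>F\<^esub> g \<otimes>\<^bsub>F\<^esub> h) w" .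
qed

lemma F_mult_r_distr:
  assumes f: "f \<in> carrier F" and g: "g \<in> carrier F" and h: "h \<in> carrier F"
  shows "h \<otimes>\<^bsub>F\<^esub> (f \<oplus>\<^bsub>F\<^esub> g) = h \<otimes>\<^bsub>F\<^esub> f \<oplus>\<^bsub>F\<^esub> h \<otimes>\<^bsub>F\<^esub> g"
proof
  fix w
  let ?A = "{x. f x \<noteq> \<zero>\<^bsub>R\<^esub>} \<union> {x. g x \<noteq> \<zero>\<^bsub>R\<^esub>}" and ?B = "{x. h x \<noteq> \<zero>\<^bsub>R\<^esub>}"
  have cl: "f x \<in> carrier R" "g x \<in> carrier R" "h x \<in> carrier R" for x
    using f g h R.finsupp_closed by (auto simp: monoid_algebra_simps)
  have fin: "finite ?A" "finite ?B"
    using f g h by (auto simp: monoid_algebra_simps dest: finsupp_finite)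
  have fg: "f \<oplus>\<^bsub>F\<^esub> g \<in> carrier F" "{x. (f \<oplus>\<^bsub>F\<^esub> g) x \<noteq> \<zero>\<^bsub>R\<^esub>} \<subseteq> ?A"
    using FM.M.a_closed[OF f g] by (auto simp: monoid_algebra_simps)
  have "(h \<otimes>\<^bsub>F\<^esub> (f \<oplus>\<^bsub>F\<^esub> g)) w = (\<Oplus>\<^bsub>R\<^esub>z\<in>?B \<times> ?A.
     (if fst z \<otimes>\<^bsub>M\<^esub> snd z = w then h (fst z) \<otimes>\<^bsub>R\<^esub> f (snd z) else \<zero>\<^bsub>R\<^esub>) \<oplus>\<^bsub>R\<^esub>
     (if fst z \<otimes>\<^bsub>M\<^esub> snd z = w then h (fst z) \<otimes>\<^bsub>R\<^esub> g (snd z) else \<zero>\<^bsub>R\<^esub>))"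
    unfolding F_mult_eq[OF h fg(1) fin(2) order_refl fin(1) fg(2)]
    by (rule R.finsum_cong') (use cl in \<open>auto simp: monoid_algebra_simps R.r_distr\<close>)
  also have "\<dots> = (h \<otimes>\<^bsub>F\<^esub> f \<oplus>\<^bsub>F\<^esub> h \<otimes>\<^bsub>F\<^esub> g) w"
    using F_mult_eq[OF h f fin(2) order_refl fin(1)] F_mult_eq[OF h g fin(2) order_refl fin(1)]
    by (subst R.finsum_addf) (use cl in \<open>auto simp: monoid_algebra_simps(4)\<close>)
  finally show "(h \<otimes>\<^bsub>F\<^esub> (f \<oplus>\<^bsub>F\<^esub> g)) w = (h \<otimes>\<^bsub>F\<^esub> f \<oplus>\<^bsub>F\<^esub> h \<otimes>\<^bsub>F\<^esub> g) w" .
qed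

lemma F_smult_mult_left:
  assumes r: "r \<in> carrier R" and f: "f \<in> carrier F" and h: "h \<in> carrier F"
  shows "(r \<odot>\<^bsub>F\<^esub> f) \<otimes>\<^bsub>F\<^esub> h = r \<odot>\<^bsub>F\<^esub> (f \<otimes>\<^bsub>F\<^esub> h)"
proof
  fix w
  let ?A = "{x. f x \<noteq> \<zero>\<^bsub>R\<^esub>}" and ?B = "{x. h x \<noteq> \<zero>\<^bsub>R\<^esub>}"
  have cl: "f x \<in> carrier R" "h x \<in> carrier R" for x
    using f h R.finsupp_closed by (auto simp: monoid_algebra_simps)
  have fin: "finite ?A" "finite ?B"
    using f h by (auto simp: monoid_algebra_simps dest: finsupp_finite)
  have rf: "r \<odot>\<^bsub>F\<^esub> f \<in> carrier F" "{x. (r \<odot>\<^bsub>F\<^esub> f) x \<noteq> \<zero>\<^bsub>R\<^esub>} \<subseteq> ?A"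
    using FM.smult_closed[OF r f] r by (auto simp: monoid_algebra_simps)
  have "((r \<odot>\<^bsub>F\<^esub> f) \<otimes>\<^bsub>F\<^esub> h) w = (\<Oplus>\<^bsub>R\<^esub>z\<in>?A \<times> ?B.
     r \<otimes>\<^bsub>R\<^esub> (if fst z \<otimes>\<^bsub>M\<^esub> snd z = w then f (fst z) \<otimes>\<^bsub>R\<^esub> h (snd z) else \<zero>\<^bsub>R\<^esub>))"
    unfolding F_mult_eq[OF rf(1) h fin(1) rf(2) fin(2) order_refl]
    by (rule R.finsum_cong') (use cl r in \<open>auto simp: monoid_algebra_simps R.m_assoc\<close>)
  also have "\<dots> = (r \<odot>\<^bsub>F\<^esub> (f \<otimes>\<^bsub>F\<^esub> h)) w"
    by (subst R.finsum_rdistr[symmetric])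
      (use cl r fin F_mult_eq[OF f h fin(1) order_refl fin(2) order_refl] in
        \<open>auto simp: monoid_algebra_simps(5)\<close>)
  finally show "((r \<odot>\<^bsub>F\<^esub> f) \<otimes>\<^bsub>F\<^esub> h) w = (r \<odot>\<^bsub>F\<^esub> (f \<otimes>\<^bsub>F\<^esub> h)) w" .
qed

lemma F_smult_mult_right:
  assumes r: "r \<in> carrier R" and f: "f \<in> carrier F" and h: "h \<in> carrier F"
  shows "h \<otimes>\<^bsub>F\<^esub> (r \<odot>\<^bsub>F\<^esub> f) = r \<odot>\<^bsub>F\<^esub> (h \<otimes>\<^bsub>F\<^esub> f)"
proof
  fix w
  let ?A = "{x. f x \<noteq> \<zero>\<^bsub>R\<^esub>}" and ?B = "{x. h x \<noteq> \<zero>\<^bsub>R\<^esub>}"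
  have cl: "f x \<in> carrier R" "h x \<in> carrier R" for x
    using f h R.finsupp_closed by (auto simp: monoid_algebra_simps)
  have fin: "finite ?A" "finite ?B"
    using f h by (auto simp: monoid_algebra_simps dest: finsupp_finite)
  have rf: "r \<odot>\<^bsub>F\<^esub> f \<in> carrier F" "{x. (r \<odot>\<^bsub>F\<^esub> f) x \<noteq> \<zero>\<^bsub>R\<^esub>} \<subseteq> ?A"
    using FM.smult_closed[OF r f] r by (auto simp: monoid_algebra_simps)
  have "(h \<otimes>\<^bsub>F\<^esub> (r \<odot>\<^bsub>F\<^esub> f)) w = (\<Oplus>\<^bsub>R\<^esub>z\<in>?B \<times> ?A.
     r \<otimes>\<^bsub>R\<^esub> (if fst z \<otimes>\<^bsub>M\<^esub> snd z = w then h (fst z) \<otimes>\<^bsub>R\<^esub> f (snd z) else \<zero>\<^bsub>R\<^esub>))"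
    unfolding F_mult_eq[OF h rf(1) fin(2) order_refl fin(1) rf(2)]
    by (rule R.finsum_cong') (use cl r in \<open>auto simp: monoid_algebra_simps R.m_lcomm\<close>)
  also have "\<dots> = (r \<odot>\<^bsub>F\<^esub> (h \<otimes>\<^bsub>F\<^esub> f)) w"
    by (subst R.finsum_rdistr[symmetric])
      (use cl r fin F_mult_eq[OF h f fin(2) order_refl fin(1) order_refl] in
        \<open>auto simp: monoid_algebra_simps(5)\<close>)
  finally show "(h \<otimes>\<^bsub>F\<^esub> (r \<odot>\<^bsub>F\<^esub> f)) w = (r \<odot>\<^bsub>F\<^esub> (h \<otimes>\<^bsub>F\<^esub> f)) w" .
qed

lemma single_closed: "m \<in> carrier M \<Longrightarrow> single R m \<in> carrier F"
  by (simp add: monoid_algebra_simps R.single_finsupp)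

lemma single_mult:
  assumes "u \<in> carrier M" "v \<in> carrier M"
  shows "single R u \<otimes>\<^bsub>F\<^esub> single R v = single R (u \<otimes>\<^bsub>M\<^esub> v)"
proof
  fix w
  have "(single R u \<otimes>\<^bsub>F\<^esub> single R v) w = (\<Oplus>\<^bsub>R\<^esub>z\<in>{u} \<times> {v}. if fst z \<otimes>\<^bsub>M\<^esub> snd z = w
      then single R u (fst z) \<otimes>\<^bsub>R\<^esub> single R v (snd z) else \<zero>\<^bsub>R\<^esub>)"
    by (rule F_mult_eq) (use single_closed assms in \<open>auto simp: single_def\<close>)
  also have "\<dots> = single R (u \<otimes>\<^bsub>M\<^esub> v) w" by (auto simp: single_def)
  finally show "(single R u \<otimes>\<^bsub>F\<^esub> single R v) w = single R (u \<otimes>\<^bsub>M\<^esub> v) w" .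
qed

lemma F_induct [consumes 1, case_names zero add]:
  assumes "f \<in> carrier F"
    and "Q \<zero>\<^bsub>F\<^esub>"
    and "\<And>r m g. \<lbrakk>r \<in> carrier R; m \<in> carrier M; g \<in> carrier F; Q g\<rbrakk>
      \<Longrightarrow> Q (r \<odot>\<^bsub>F\<^esub> single R m \<oplus>\<^bsub>F\<^esub> g)"
  shows "Q f"
proof (rule R.finsupp_induct[of f "carrier M" Q])
  show "f \<in> finsupp R (carrier M)" "Q (\<lambda>x. \<zero>\<^bsub>R\<^esub>)"
    using assms(1,2) by (simp_all only: monoid_algebra_simps)
  show "Q (\<lambda>y. r \<otimes>\<^bsub>R\<^esub> single R m y \<oplus>\<^bsub>R\<^esub> g y)"
    if "r \<in> carrier R" "m \<in> carrier M" "g \<in> finsupp R (carrier M)" "Q g" for r m g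
    using assms(3)[OF that(1,2) _ that(4)] that(3) unfolding monoid_algebra_simps by iprover
qed

lemma F_zero_mult: "g \<in> carrier F \<Longrightarrow> \<zero>\<^bsub>F\<^esub> \<otimes>\<^bsub>F\<^esub> g = \<zero>\<^bsub>F\<^esub>"
  and F_mult_zero: "g \<in> carrier F \<Longrightarrow> g \<otimes>\<^bsub>F\<^esub> \<zero>\<^bsub>F\<^esub> = \<zero>\<^bsub>F\<^esub>"
proof -
  assume g: "g \<in> carrier F"
  then have fin: "finite {x. g x \<noteq> \<zero>\<^bsub>R\<^esub>}"
    by (auto simp: monoid_algebra_simps dest: finsupp_finite)
  show "\<zero>\<^bsub>F\<^esub> \<otimes>\<^bsub>F\<^esub> g = \<zero>\<^bsub>F\<^esub>"
    by (rule ext, subst F_mult_eq[OF FM.M.zero_closed g finite.emptyI _ fin order_refl])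
      (simp_all add: monoid_algebra_simps(3))
  show "g \<otimes>\<^bsub>F\<^esub> \<zero>\<^bsub>F\<^esub> = \<zero>\<^bsub>F\<^esub>"
    by (rule ext, subst F_mult_eq[OF g FM.M.zero_closed fin order_refl finite.emptyI])
      (simp_all add: monoid_algebra_simps(3))
qed

text \<open>Finiteness of the support of a convolution comes from bilinearity and
  \<open>single_mult\<close>, without any estimate of supports.\<close>

lemma F_mult_closed:
  assumes "f \<in> carrier F" "g \<in> carrier F"
  shows "f \<otimes>\<^bsub>F\<^esub> g \<in> carrier F"
proof -
  have *: "single R m \<otimes>\<^bsub>F\<^esub> g \<in> carrier F" if m: "m \<in> carrier M" for m
    using assms(2)
    by (induction g rule: F_induct)
      (simp_all add: F_mult_zero F_mult_r_distr F_smult_mult_right single_mult single_closed m)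
  show ?thesis using assms(1)
    by (induction f rule: F_induct)
      (simp_all add: F_zero_mult F_mult_l_distr F_smult_mult_left single_closed assms(2) *)
qed

text \<open>Both sides are linear in each argument; one induction per argument, with
  \<open>h\<close> innermost, leaves associativity in the monoid.\<close>

lemma F_mult_assoc:
  assumes f: "f \<in> carrier F" and g: "g \<in> carrier F" and h: "h \<in> carrier F"
  shows "(f \<otimes>\<^bsub>F\<^esub> g) \<otimes>\<^bsub>F\<^esub> h = f \<otimes>\<^bsub>F\<^esub> (g \<otimes>\<^bsub>F\<^esub> h)"
proof -
  note simps = F_zero_mult F_mult_zero F_mult_l_distr F_mult_r_distr F_smult_mult_left
    F_smult_mult_right single_mult single_closed F_mult_closed M.m_assoc
  have 1: "(single R u \<otimes>\<^bsub>F\<^esub> single R v) \<otimes>\<^bsub>F\<^esub> h = single R u \<otimes>\<^bsub>F\<^esub> (single R v \<otimes>\<^bsub>F\<^esub> h)"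
    if "u \<in> carrier M" "v \<in> carrier M" for u v
    using h by (induction h rule: F_induct) (simp_all add: simps that)
  have 2: "(single R u \<otimes>\<^bsub>F\<^esub> g) \<otimes>\<^bsub>F\<^esub> h = single R u \<otimes>\<^bsub>F\<^esub> (g \<otimes>\<^bsub>F\<^esub> h)"
    if "u \<in> carrier M" for u
    using g
  proof (induction g rule: F_induct)
    case (add r m g)
    then show ?case using 1[OF that add(2)] by (simp add: simps that h)
  qed (simp add: simps that h)
  show ?thesis using f
  proof (induction f rule: F_induct)
    case (add r m g)
    then show ?case using 2[OF add(2)] assms by (simp add: simps)
  qed (simp add: simps assms)
qed

lemma F_one_mult: "f \<in> carrier F \<Longrightarrow> \<one>\<^bsub>F\<^esub> \<otimes>\<^bsub>F\<^esub> f = f"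
  and F_mult_one: "f \<in> carrier F \<Longrightarrow> f \<otimes>\<^bsub>F\<^esub> \<one>\<^bsub>F\<^esub> = f"
  unfolding monoid_algebra_simps(2)
  by (induction f rule: F_induct; simp add: F_zero_mult F_mult_zero F_mult_l_distr F_mult_r_distr
      F_smult_mult_left F_smult_mult_right single_mult single_closed)+

lemma assoc_algebra_F: "assoc_algebra R F"
proof (intro assoc_algebra.intro module_F assoc_algebra_axioms.intro ringI)
  show "abelian_group F" by (rule FM.M.abelian_group_axioms)
  show "monoid F"
    by (rule monoidI)
      (simp_all add: F_mult_closed F_mult_assoc F_one_mult F_mult_one,
        simp add: monoid_algebra_simps(2) single_closed)
qed (simp_all add: F_mult_l_distr F_mult_r_distr F_smult_mult_left F_smult_mult_right)

sublocale FA: assoc_algebra R F by (rule assoc_algebra_F)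

end


section \<open>Images and quotients of algebras\<close>

text \<open>The axiom \<open>decomposition\<close> is dropped because it does not pass to homomorphic images.\<close>

locale pregraded_algebra = assoc_algebra R A
  for R and A :: "('a, 'b, 'c) graded_algebra_scheme" (structure) +
  assumes component_submodule: "submodule (component A n) R A"
    and one_component: "\<one>\<^bsub>A\<^esub> \<in> component A 0"
    and mult_component:
      "\<lbrakk>x \<in> component A m; y \<in> component A n\<rbrakk> \<Longrightarrow> x \<otimes>\<^bsub>A\<^esub> y \<in> component A (m + n)"
begin

lemma component_closed: "x \<in> component A n \<Longrightarrow> x \<in> carrier A"
  using submoduleE(1)[OF component_submodule] by blast

lemma component_add: "x \<in> component A n \<Longrightarrow> y \<in> component A n \<Longrightarrow> x \<oplus>\<^bsub>A\<^esub> y \<in> component A n"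
  and component_smult: "r \<in> carrier R \<Longrightarrow> x \<in> component A n \<Longrightarrow> r \<odot>\<^bsub>A\<^esub> x \<in> component A n"
  and component_uminus: "x \<in> component A n \<Longrightarrow> \<ominus>\<^bsub>A\<^esub> x \<in> component A n"
  using submoduleE(3-5)[OF component_submodule] by blast+

lemma component_zero: "\<zero>\<^bsub>A\<^esub> \<in> component A n"
  using submoduleE(1,2)[OF component_submodule] component_smult[OF R.zero_closed]
    component_closed by (metis ex_in_conv smult_l_null)

end

sublocale graded_algebra \<subseteq> pregraded_algebra
  using component_submodule one_component mult_component
  by (intro pregraded_algebra.intro pregraded_algebra_axioms.intro assoc_algebra_axioms) auto

lemma abelian_group_image:
  assumes A: "abelian_group A" and Z: "subgroup Z (add_monoid A)"
    and carrier: "carrier B = h ` Z"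
    and add: "\<And>x y. x \<in> Z \<Longrightarrow> y \<in> Z \<Longrightarrow> h x \<oplus>\<^bsub>B\<^esub> h y = h (x \<oplus>\<^bsub>A\<^esub> y)"
    and zero: "\<zero>\<^bsub>B\<^esub> = h \<zero>\<^bsub>A\<^esub>"
  shows "abelian_group B"
proof -
  interpret A: abelian_group A by (rule A)
  interpret Z: additive_subgroup Z A by (rule additive_subgroupI) (rule Z)
  show ?thesis
  proof (rule abelian_groupI)
    fix x assume "x \<in> carrier B"
    then obtain x' where x: "x' \<in> Z" "x = h x'" using carrier by auto
    show "\<exists>y\<in>carrier B. y \<oplus>\<^bsub>B\<^esub> x = \<zero>\<^bsub>B\<^esub>"
      using x carrier add zero Z.a_inv_closed[of x'] by (intro bexI[of _ "h (\<ominus>\<^bsub>A\<^esub> x')"]) (auto simp: A.l_neg)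
  qed (auto simp: carrier add zero A.a_ac Z.a_closed Z.zero_closed)
qed

lemma assoc_algebra_image:
  assumes A: "assoc_algebra R A" and S: "cring S"
    and \<phi>: "\<phi> \<in> ring_hom R S" and \<phi>_surj: "carrier S = \<phi> ` carrier R"
    and Z: "submodule Z R A" and Z_one: "\<one>\<^bsub>A\<^esub> \<in> Z"
    and Z_mult: "\<And>x y. x \<in> Z \<Longrightarrow> y \<in> Z \<Longrightarrow> x \<otimes>\<^bsub>A\<^esub> y \<in> Z"
    and carrier: "carrier B = h ` Z"
    and add: "\<And>x y. x \<in> Z \<Longrightarrow> y \<in> Z \<Longrightarrow> h x \<oplus>\<^bsub>B\<^esub> h y = h (x \<oplus>\<^bsub>A\<^esub> y)"
    and zero: "\<zero>\<^bsub>B\<^esub> = h \<zero>\<^bsub>A\<^esub>"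
    and mult: "\<And>x y. x \<in> Z \<Longrightarrow> y \<in> Z \<Longrightarrow> h x \<otimes>\<^bsub>B\<^esub> h y = h (x \<otimes>\<^bsub>A\<^esub> y)"
    and one: "\<one>\<^bsub>B\<^esub> = h \<one>\<^bsub>A\<^esub>"
    and smult: "\<And>r x. r \<in> carrier R \<Longrightarrow> x \<in> Z \<Longrightarrow> \<phi> r \<odot>\<^bsub>B\<^esub> h x = h (r \<odot>\<^bsub>A\<^esub> x)"
  shows "assoc_algebra S B"
proof -
  interpret A: assoc_algebra R A by (rule A)
  note ZE = A.submoduleE[OF Z]
  have ZA: "x \<in> Z \<Longrightarrow> x \<in> carrier A" for x using ZE(1) by auto
  note cl = ZE(4,5) Z_mult ZA Z_one
  interpret BG: abelian_group B
    by (rule abelian_group_image[OF A.M.abelian_group_axioms submodule.axioms(1)[OF Z] carrier add zero])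
  note \<phi>s = ring_hom_mult[OF \<phi>] ring_hom_add[OF \<phi>] ring_hom_one[OF \<phi>]
  have modB: "module S B"
  proof (rule moduleI)
    fix a x assume "a \<in> carrier S" "x \<in> carrier B"
    then show "a \<odot>\<^bsub>B\<^esub> x \<in> carrier B"
      unfolding carrier \<phi>_surj by (auto simp: smult cl)
  next
    fix a b x assume "a \<in> carrier S" "b \<in> carrier S" "x \<in> carrier B"
    then obtain a' b' x' where *: "a' \<in> carrier R" "b' \<in> carrier R" "x' \<in> Z" "a = \<phi> a'" "b = \<phi> b'" "x = h x'"
      unfolding carrier \<phi>_surj by blast
    show "(a \<oplus>\<^bsub>S\<^esub> b) \<odot>\<^bsub>B\<^esub> x = a \<odot>\<^bsub>B\<^esub> x \<oplus>\<^bsub>B\<^esub> b \<odot>\<^bsub>B\<^esub> x"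
      "a \<otimes>\<^bsub>S\<^esub> b \<odot>\<^bsub>B\<^esub> x = a \<odot>\<^bsub>B\<^esub> (b \<odot>\<^bsub>B\<^esub> x)"
      using * by (simp_all add: \<phi>s[symmetric] smult add cl A.smult_l_distr A.smult_assoc1)
  next
    fix a x y assume "a \<in> carrier S" "x \<in> carrier B" "y \<in> carrier B"
    then obtain a' x' y' where *: "a' \<in> carrier R" "x' \<in> Z" "y' \<in> Z" "a = \<phi> a'" "x = h x'" "y = h y'"
      unfolding carrier \<phi>_surj by blast
    show "a \<odot>\<^bsub>B\<^esub> (x \<oplus>\<^bsub>B\<^esub> y) = a \<odot>\<^bsub>B\<^esub> x \<oplus>\<^bsub>B\<^esub> a \<odot>\<^bsub>B\<^esub> y"
      using * by (simp add: smult add cl A.smult_r_distr)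
  next
    fix x assume "x \<in> carrier B"
    then show "\<one>\<^bsub>S\<^esub> \<odot>\<^bsub>B\<^esub> x = x"
      unfolding carrier by (auto simp: \<phi>s(3)[symmetric] smult cl)
  qed (use S BG.abelian_group_axioms in auto)
  have ringB: "ring B"
  proof (rule ringI)
    show "monoid B"
      by (rule monoidI) (auto simp: carrier one mult cl A.m_assoc)
    fix x y z assume "x \<in> carrier B" "y \<in> carrier B" "z \<in> carrier B"
    then obtain x' y' z' where *: "x' \<in> Z" "y' \<in> Z" "z' \<in> Z" "x = h x'" "y = h y'" "z = h z'"
      unfolding carrier by blast
    show "(x \<oplus>\<^bsub>B\<^esub> y) \<otimes>\<^bsub>B\<^esub> z = x \<otimes>\<^bsub>B\<^esub> z \<oplus>\<^bsub>B\<^esub> y \<otimes>\<^bsub>B\<^esub> z"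
      "z \<otimes>\<^bsub>B\<^esub> (x \<oplus>\<^bsub>B\<^esub> y) = z \<otimes>\<^bsub>B\<^esub> x \<oplus>\<^bsub>B\<^esub> z \<otimes>\<^bsub>B\<^esub> y"
      using * by (simp_all add: mult add cl A.l_distr A.r_distr)
  qed (rule BG.abelian_group_axioms)
  show ?thesis
  proof (intro assoc_algebra.intro modB ringB assoc_algebra_axioms.intro)
    fix a x y assume "a \<in> carrier S" "x \<in> carrier B" "y \<in> carrier B"
    then obtain a' x' y' where *: "a' \<in> carrier R" "x' \<in> Z" "y' \<in> Z" "a = \<phi> a'" "x = h x'" "y = h y'"
      unfolding carrier \<phi>_surj by blast
    show "(a \<odot>\<^bsub>B\<^esub> x) \<otimes>\<^bsub>B\<^esub> y = a \<odot>\<^bsub>B\<^esub> (x \<otimes>\<^bsub>B\<^esub> y)" "x \<otimes>\<^bsub>B\<^esub> (a \<odot>\<^bsub>B\<^esub> y) = a \<odot>\<^bsub>B\<^esub> (x \<otimes>\<^bsub>B\<^esub> y)"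
      using * by (simp_all add: smult mult cl A.smult_mult_left A.smult_mult_right)
  qed
qed

lemma pregraded_algebra_image:
  assumes A: "assoc_algebra R A" and S: "cring S"
    and \<phi>: "\<phi> \<in> ring_hom R S" and \<phi>_surj: "carrier S = \<phi> ` carrier R"
    and Z: "submodule Z R A" and Z_one: "\<one>\<^bsub>A\<^esub> \<in> Z"
    and Z_mult: "\<And>x y. x \<in> Z \<Longrightarrow> y \<in> Z \<Longrightarrow> x \<otimes>\<^bsub>A\<^esub> y \<in> Z"
    and N: "\<And>n. submodule (N n) R A" and NZ: "\<And>n. N n \<subseteq> Z" and N_one: "\<one>\<^bsub>A\<^esub> \<in> N 0"
    and N_mult: "\<And>m n x y. x \<in> N m \<Longrightarrow> y \<in> N n \<Longrightarrow> x \<otimes>\<^bsub>A\<^esub> y \<in> N (m + n)"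
    and carrier: "carrier B = h ` Z"
    and add: "\<And>x y. x \<in> Z \<Longrightarrow> y \<in> Z \<Longrightarrow> h x \<oplus>\<^bsub>B\<^esub> h y = h (x \<oplus>\<^bsub>A\<^esub> y)"
    and zero: "\<zero>\<^bsub>B\<^esub> = h \<zero>\<^bsub>A\<^esub>"
    and mult: "\<And>x y. x \<in> Z \<Longrightarrow> y \<in> Z \<Longrightarrow> h x \<otimes>\<^bsub>B\<^esub> h y = h (x \<otimes>\<^bsub>A\<^esub> y)"
    and one: "\<one>\<^bsub>B\<^esub> = h \<one>\<^bsub>A\<^esub>"
    and smult: "\<And>r x. r \<in> carrier R \<Longrightarrow> x \<in> Z \<Longrightarrow> \<phi> r \<odot>\<^bsub>B\<^esub> h x = h (r \<odot>\<^bsub>A\<^esub> x)"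
    and comp: "\<And>n. component B n = h ` N n"
  shows "pregraded_algebra S B"
proof -
  interpret A: assoc_algebra R A by (rule A)
  note ZE = A.submoduleE[OF Z]
  have ZA: "x \<in> Z \<Longrightarrow> x \<in> carrier A" for x using ZE(1) by auto
  interpret B: assoc_algebra S B
    by (rule assoc_algebra_image[OF A S \<phi> \<phi>_surj Z Z_one Z_mult carrier add zero mult one smult])
  have NZ': "x \<in> N n \<Longrightarrow> x \<in> Z" for x n using NZ by blast
  show ?thesis
  proof (intro pregraded_algebra.intro B.assoc_algebra_axioms pregraded_algebra_axioms.intro)
    fix n
    note NE = A.submoduleE[OF N[of n]]
    have z: "\<zero>\<^bsub>A\<^esub> \<in> N n" using NE(1,2,4) by (metis A.R.zero_closed ex_in_conv A.smult_l_null subsetD)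
    have inv: "\<ominus>\<^bsub>B\<^esub> h x = h (\<ominus>\<^bsub>A\<^esub> x)" if x: "x \<in> N n" for x
    proof (rule B.M.minus_equality)
      have xZ: "x \<in> Z" "\<ominus>\<^bsub>A\<^esub> x \<in> Z" using NZ'[OF x] NZ'[OF NE(3)[OF x]] .
      then show "h x \<in> carrier B" "h (\<ominus>\<^bsub>A\<^esub> x) \<in> carrier B" unfolding carrier by blast+
      show "h (\<ominus>\<^bsub>A\<^esub> x) \<oplus>\<^bsub>B\<^esub> h x = \<zero>\<^bsub>B\<^esub>"
        by (simp only: add[OF xZ(2,1)] zero A.M.l_neg[OF ZA[OF xZ(1)]])
    qed
    show "submodule (component B n) S B"
      unfolding comp
      by (rule B.submoduleI)
        (use NE NZ' z in \<open>auto simp: carrier zero inv add smult \<phi>_surj image_iff\<close>)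
  next
    fix x y m n assume "x \<in> component B m" "y \<in> component B n"
    then show "x \<otimes>\<^bsub>B\<^esub> y \<in> component B (m + n)"
      unfolding comp using NZ' N_mult by (auto simp: mult)
  qed (simp add: comp one N_one)
qed

text \<open>Maps out of a quotient, by choice of a preimage. Extensionality pins down the values
  outside \<open>C\<close>, as the definition of \<open>natural_map\<close> requires.\<close>

lemma factor_through_image:
  assumes "C = h ` Z" and "\<And>x y. x \<in> Z \<Longrightarrow> y \<in> Z \<Longrightarrow> h x = h y \<Longrightarrow> L x = L y"
  obtains g where "g \<in> extensional C" "\<And>x. x \<in> Z \<Longrightarrow> g (h x) = L x"
proof
  let ?g = "\<lambda>u\<in>C. L (SOME x. x \<in> Z \<and> h x = u)"
  show "?g \<in> extensional C" by simp
  fix x assume x: "x \<in> Z"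
  define x' where "x' = (SOME x'. x' \<in> Z \<and> h x' = h x)"
  have "x' \<in> Z \<and> h x' = h x"
    unfolding x'_def by (rule someI[of "\<lambda>x'. x' \<in> Z \<and> h x' = h x" x]) (simp add: x)
  then have "L x' = L x" using assms(2)[OF _ x] by blast
  then show "?g (h x) = L x" using x by (simp add: assms(1) x'_def)
qed

section \<open>Computing with cosets of an ideal\<close>

context ideal
begin

lemma quot_carrier: "carrier (R Quot I) = (\<lambda>x. I +> x) ` carrier R"
  by (auto simp: FactRing_def A_RCOSETS_def')

lemma quot_ops:
  "\<lbrakk>x \<in> carrier R; y \<in> carrier R\<rbrakk> \<Longrightarrow> (I +> x) \<oplus>\<^bsub>R Quot I\<^esub> (I +> y) = I +> (x \<oplus> y)"
  "\<lbrakk>x \<in> carrier R; y \<in> carrier R\<rbrakk> \<Longrightarrow> (I +> x) \<otimes>\<^bsub>R Quot I\<^esub> (I +> y) = I +> (x \<otimes> y)"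
  "\<one>\<^bsub>R Quot I\<^esub> = I +> \<one>"
  "\<zero>\<^bsub>R Quot I\<^esub> = I +> \<zero>"
  "\<zero>\<^bsub>R Quot I\<^esub> = I"
  by (simp_all add: FactRing_def a_rcos_sum rcoset_mult_add a_coset_add_zero[OF a_subset])

lemma quot_eq: "\<lbrakk>x \<in> carrier R; y \<in> carrier R\<rbrakk> \<Longrightarrow> I +> x = I +> y \<longleftrightarrow> x \<ominus> y \<in> I"
  using quotient_eq_iff_same_a_r_cos[OF is_ideal] by blast

lemma quot_eq_I: "x \<in> carrier R \<Longrightarrow> I +> x = I \<longleftrightarrow> x \<in> I"
  using a_rcos_zero[OF is_ideal] rcos_const_imp_mem by blast

text \<open>Operations on quotients such as scalar multiplication and the differential are defined
  as unions over all members of a coset. Such a union collapses as soon as all members contribute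
  the same set.\<close>

lemma UN_coset:
  assumes x: "x \<in> carrier R" and g: "\<And>y. y \<in> carrier R \<Longrightarrow> y \<ominus> x \<in> I \<Longrightarrow> g y = g x"
  shows "(\<Union>y\<in>I +> x. g y) = g x"
proof -
  have "g y = g x" if "y \<in> I +> x" for y
  proof -
    have y: "y \<in> carrier R" using that x a_r_coset_subset_G[OF a_subset] by blast
    have "I +> y = I +> x"
      using a_repr_independence[OF that x a_subgroup] by simp
    then show ?thesis using g[OF y] quot_eq[OF y x] by simp
  qed
  moreover have "x \<in> I +> x" using x a_rcos_self by blast
  ultimately show ?thesis by blast
qed

end

text \<open>Since r x = (r 1) x, a ring ideal of an algebra is closed under scalars.\<close>

lemma (in assoc_algebra) ideal_smult:
  assumes J: "ideal J A" and r: "r \<in> carrier R" and x: "x \<in> J"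
  shows "r \<odot>\<^bsub>A\<^esub> x \<in> J"
proof -
  have "x \<in> carrier A" using ideal.Icarr[OF J x] .
  then have "r \<odot>\<^bsub>A\<^esub> x = (r \<odot>\<^bsub>A\<^esub> \<one>\<^bsub>A\<^esub>) \<otimes>\<^bsub>A\<^esub> x" using r by (simp add: smult_mult_left)
  then show ?thesis using ideal.I_l_closed[OF J x] r by simp
qed

lemma (in assoc_algebra) smult_minus:
  assumes "r \<in> carrier R" "x \<in> carrier A" "y \<in> carrier A"
  shows "r \<odot>\<^bsub>A\<^esub> (x \<ominus>\<^bsub>A\<^esub> y) = (r \<odot>\<^bsub>A\<^esub> x) \<ominus>\<^bsub>A\<^esub> (r \<odot>\<^bsub>A\<^esub> y)"
  using assms by (simp add: a_minus_def smult_r_distr smult_r_minus)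


section \<open>Maps out of a monoid algebra\<close>

text \<open>The universal property of the monoid algebra: multiplicativity is a bilinear condition,
  hence inherited from \<phi> on basis elements.\<close>

lemma (in cring_monoid) lincomb_ring_hom:
  assumes A: "assoc_algebra R A" and \<phi>: "\<And>m. m \<in> carrier M \<Longrightarrow> \<phi> m \<in> carrier A"
    and \<phi>_one: "\<phi> \<one>\<^bsub>M\<^esub> = \<one>\<^bsub>A\<^esub>"
    and \<phi>_mult: "\<And>u v. \<lbrakk>u \<in> carrier M; v \<in> carrier M\<rbrakk> \<Longrightarrow> \<phi> (u \<otimes>\<^bsub>M\<^esub> v) = \<phi> u \<otimes>\<^bsub>A\<^esub> \<phi> v"
  shows "lincomb R A \<phi> \<in> ring_hom F A"
proof -
  interpret A: assoc_algebra R A by (rule A)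
  let ?L = "lincomb R A \<phi>"
  have cl: "?L f \<in> carrier A" if "f \<in> carrier F" for f
    using that by (auto simp: monoid_algebra_simps intro: A.lincomb_closed \<phi>)
  have add: "?L (f \<oplus>\<^bsub>F\<^esub> g) = ?L f \<oplus>\<^bsub>A\<^esub> ?L g" if "f \<in> carrier F" "g \<in> carrier F" for f g
    using that by (auto simp: monoid_algebra_simps intro: A.lincomb_add \<phi>)
  have smult: "?L (r \<odot>\<^bsub>F\<^esub> f) = r \<odot>\<^bsub>A\<^esub> ?L f" if "r \<in> carrier R" "f \<in> carrier F" for r f
    using that by (auto simp: monoid_algebra_simps intro: A.lincomb_smult \<phi>)
  have zero: "?L \<zero>\<^bsub>F\<^esub> = \<zero>\<^bsub>A\<^esub>" by (simp add: monoid_algebra_simps)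
  have sing: "?L (single R m) = \<phi> m" if "m \<in> carrier M" for m
    using that by (intro A.lincomb_single \<phi>)
  have 1: "?L (single R u \<otimes>\<^bsub>F\<^esub> g) = \<phi> u \<otimes>\<^bsub>A\<^esub> ?L g" if "u \<in> carrier M" "g \<in> carrier F" for u g
    using that(2)
    by (induction g rule: F_induct) (simp_all add: that(1) zero cl \<phi> F_mult_zero F_mult_r_distr
        F_smult_mult_right single_mult single_closed add smult sing \<phi>_mult A.r_distr A.smult_mult_right)
  have 2: "?L (f \<otimes>\<^bsub>F\<^esub> g) = ?L f \<otimes>\<^bsub>A\<^esub> ?L g" if "f \<in> carrier F" "g \<in> carrier F" for f g
    using that(1)
    by (induction f rule: F_induct) (simp_all add: that(2) zero cl \<phi> F_zero_mult F_mult_l_distr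
        F_smult_mult_left single_closed add smult sing 1 A.l_distr A.smult_mult_left)
  show ?thesis
    by (rule ring_hom_memI) (simp_all add: cl add 2, simp add: monoid_algebra_simps(2) sing \<phi>_one)
qed


section \<open>The exterior algebra\<close>

lemma monoid_free_monoid: "monoid (free_monoid U)"
  by (rule monoidI) (auto simp: free_monoid_def)

lemma free_monoid_simps [simp]:
  "carrier (free_monoid U) = lists U" "u \<otimes>\<^bsub>free_monoid U\<^esub> v = u @ v" "\<one>\<^bsub>free_monoid U\<^esub> = []"
  by (simp_all add: free_monoid_def)

locale exterior = module S M for S (structure) and M (structure)
begin

abbreviation "T \<equiv> monoid_algebra S (free_monoid (carrier M))"
abbreviation "J \<equiv> exterior_ideal S M"
abbreviation "E \<equiv> exterior_algebra S M"
abbreviation "q f \<equiv> J +>\<^bsub>T\<^esub> f"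
abbreviation "\<iota> \<equiv> exterior_incl S M"

sublocale T: cring_monoid S "free_monoid (carrier M)"
  by (intro cring_monoid.intro R.cring_axioms monoid_free_monoid)

definition relators where
  "relators =
      {single S [x \<oplus>\<^bsub>M\<^esub> y] \<ominus>\<^bsub>T\<^esub> (single S [x] \<oplus>\<^bsub>T\<^esub> single S [y]) | x y.
          x \<in> carrier M \<and> y \<in> carrier M} \<union>
       {single S [s \<odot>\<^bsub>M\<^esub> x] \<ominus>\<^bsub>T\<^esub> s \<odot>\<^bsub>T\<^esub> single S [x] | s x.
          s \<in> carrier S \<and> x \<in> carrier M} \<union>
       {single S [x, x] | x. x \<in> carrier M}"

lemma J_eq: "J = Idl\<^bsub>T\<^esub> relators"
  by (simp add: exterior_ideal_def relators_def Let_def)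

lemma word_closed: "w \<in> lists (carrier M) \<Longrightarrow> single S w \<in> carrier T"
  by (simp add: T.single_closed)

lemma relators_closed: "relators \<subseteq> carrier T"
  by (auto simp: relators_def a_minus_def intro!: word_closed T.FM.M.a_closed T.FM.M.a_inv_closed
      T.FM.smult_closed)

lemma ideal_J: "ideal J T"
  unfolding J_eq by (rule T.FA.A.genideal_ideal[OF relators_closed])

sublocale J: ideal J T by (rule ideal_J)

lemma relators_J: "relators \<subseteq> J"
  unfolding J_eq by (rule T.FA.A.genideal_self[OF relators_closed])

lemma E_simps:
  "carrier E = q ` carrier T"
  "\<zero>\<^bsub>E\<^esub> = q \<zero>\<^bsub>T\<^esub>" "\<one>\<^bsub>E\<^esub> = q (single S [])"
  by (simp_all add: exterior_algebra_def Let_def J.quot_carrier J.quot_ops(3,4) monoid_algebra_simps(2))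

lemma E_ops:
  assumes "f \<in> carrier T" "g \<in> carrier T"
  shows "q f \<oplus>\<^bsub>E\<^esub> q g = q (f \<oplus>\<^bsub>T\<^esub> g)" "q f \<otimes>\<^bsub>E\<^esub> q g = q (f \<otimes>\<^bsub>T\<^esub> g)"
  using J.quot_ops(1,2)[OF assms] by (simp_all add: exterior_algebra_def Let_def)

lemma E_smult:
  assumes s: "s \<in> carrier S" and f: "f \<in> carrier T"
  shows "s \<odot>\<^bsub>E\<^esub> q f = q (s \<odot>\<^bsub>T\<^esub> f)"
proof -
  have "s \<odot>\<^bsub>E\<^esub> q f = (\<Union>g\<in>q f. q (s \<odot>\<^bsub>T\<^esub> g))"
    by (simp add: exterior_algebra_def Let_def)
  also have "\<dots> = q (s \<odot>\<^bsub>T\<^esub> f)"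
  proof (rule J.UN_coset[OF f])
    fix g assume g: "g \<in> carrier T" "g \<ominus>\<^bsub>T\<^esub> f \<in> J"
    then have "(s \<odot>\<^bsub>T\<^esub> g) \<ominus>\<^bsub>T\<^esub> (s \<odot>\<^bsub>T\<^esub> f) \<in> J"
      using T.FA.ideal_smult[OF ideal_J s g(2)] T.FA.smult_minus[OF s g(1) f] by simp
    then show "q (s \<odot>\<^bsub>T\<^esub> g) = q (s \<odot>\<^bsub>T\<^esub> f)"
      using J.quot_eq g f s by (simp add: T.FM.smult_closed)
  qed
  finally show ?thesis .
qed

definition words where "words n = {w \<in> lists (carrier M). length w = n}"

text \<open>Elements of degree n are again finitely supported functions, on the words of length n,
  so that induction on the support can stay within one degree.\<close>

lemma finsupp_words_iff:
  "f \<in> finsupp S (words n) \<longleftrightarrow> f \<in> carrier T \<and> (\<forall>w. f w \<noteq> \<zero>\<^bsub>S\<^esub> \<longrightarrow> length w = n)"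
  using R.finsupp_closed[of f "words n"]
  by (auto simp: monoid_algebra_simps finsupp_def words_def)

lemma finsupp_words: "f \<in> finsupp S (words n) \<Longrightarrow> f \<in> carrier T"
  by (simp add: finsupp_words_iff)

lemma E_component: "component E n = q ` finsupp S (words n)"
proof -
  have "finsupp S (words n) = {f \<in> carrier T. \<forall>w. f w \<noteq> \<zero>\<^bsub>S\<^esub> \<longrightarrow> length w = n}"
    using finsupp_words_iff by blast
  then show ?thesis by (simp add: exterior_algebra_def Let_def)
qed

lemma words_induct [consumes 1, case_names zero add]:
  assumes "f \<in> finsupp S (words n)"
    and "Q \<zero>\<^bsub>T\<^esub>"
    and "\<And>s w g. \<lbrakk>s \<in> carrier S; w \<in> words n; g \<in> finsupp S (words n); Q g\<rbrakk>
      \<Longrightarrow> Q (s \<odot>\<^bsub>T\<^esub> single S w \<oplus>\<^bsub>T\<^esub> g)"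
  shows "Q f"
proof (rule R.finsupp_induct[OF assms(1)])
  show "Q (\<lambda>x. \<zero>\<^bsub>S\<^esub>)"
    using assms(2) by (simp only: monoid_algebra_simps)
  show "Q (\<lambda>y. s \<otimes>\<^bsub>S\<^esub> single S w y \<oplus>\<^bsub>S\<^esub> g y)"
    if "s \<in> carrier S" "w \<in> words n" "g \<in> finsupp S (words n)" "Q g" for s w g
    using assms(3)[OF that] unfolding monoid_algebra_simps .
qed

lemma words_finsupp_add:
  "\<lbrakk>f \<in> finsupp S (words n); g \<in> finsupp S (words n)\<rbrakk> \<Longrightarrow> f \<oplus>\<^bsub>T\<^esub> g \<in> finsupp S (words n)"
  and words_finsupp_smult:
  "\<lbrakk>s \<in> carrier S; f \<in> finsupp S (words n)\<rbrakk> \<Longrightarrow> s \<odot>\<^bsub>T\<^esub> f \<in> finsupp S (words n)"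
  and words_finsupp_zero: "\<zero>\<^bsub>T\<^esub> \<in> finsupp S (words n)"
  by (simp_all add: monoid_algebra_simps R.finsupp_add R.finsupp_smult R.finsupp_zero)

lemma words_mult:
  assumes f: "f \<in> finsupp S (words m)" and g: "g \<in> finsupp S (words n)"
  shows "f \<otimes>\<^bsub>T\<^esub> g \<in> finsupp S (words (m + n))"
proof -
  have wl: "w \<in> words k \<Longrightarrow> w \<in> lists (carrier M)" for w k by (simp add: words_def)
  have 1: "single S u \<otimes>\<^bsub>T\<^esub> g \<in> finsupp S (words (m + n))" if u: "u \<in> words m" for u
    using g
  proof (induction g rule: words_induct)
    case zero
    then show ?case using words_finsupp_zero by (simp add: T.F_mult_zero word_closed wl[OF u])
  next
    case (add s w g)
    have "single S (u @ w) \<in> finsupp S (words (m + n))"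
      using u add(2) by (intro R.single_finsupp) (auto simp: words_def)
    then show ?case
      using add wl[OF u] wl[OF add(2)] finsupp_words[OF add(3)]
      by (simp add: T.F_mult_r_distr T.F_smult_mult_right T.single_mult word_closed
          words_finsupp_add words_finsupp_smult)
  qed
  show ?thesis using f
  proof (induction f rule: words_induct)
    case zero
    then show ?case using words_finsupp_zero by (simp add: T.F_zero_mult finsupp_words[OF g])
  next
    case (add s w f)
    then show ?case using wl[OF add(2)] finsupp_words[OF add(3)] 1[OF add(2)] finsupp_words[OF g]
      by (simp add: T.F_mult_l_distr T.F_smult_mult_left word_closed
          words_finsupp_add words_finsupp_smult)
  qed
qed

lemma pregraded_E: "pregraded_algebra S E"
proof (rule pregraded_algebra_image[OF T.assoc_algebra_F R.cring_axioms, where h = q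
      and \<phi> = "\<lambda>s. s" and Z = "carrier T" and N = "\<lambda>n. finsupp S (words n)"])
  show "(\<lambda>s. s) \<in> ring_hom S S" by (rule ring_hom_memI) auto
  show "submodule (carrier T) S T" by (rule T.FM.carrier_is_submodule)
  show "submodule (finsupp S (words n)) S T" for n
  proof (rule T.FM.submoduleI)
    show "finsupp S (words n) \<subseteq> carrier T" using finsupp_words by blast
    fix f assume f: "f \<in> finsupp S (words n)"
    have "\<ominus>\<^bsub>T\<^esub> f = (\<ominus>\<^bsub>S\<^esub> \<one>\<^bsub>S\<^esub>) \<odot>\<^bsub>T\<^esub> f"
      using T.FM.smult_l_minus[of "\<one>\<^bsub>S\<^esub>" f] finsupp_words[OF f] by simp
    then show "\<ominus>\<^bsub>T\<^esub> f \<in> finsupp S (words n)"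
      using words_finsupp_smult[OF _ f, of "\<ominus>\<^bsub>S\<^esub> \<one>\<^bsub>S\<^esub>"] by simp
  qed (rule words_finsupp_add words_finsupp_smult words_finsupp_zero; assumption)+
  show "finsupp S (words n) \<subseteq> carrier T" for n using finsupp_words by blast
  show "\<one>\<^bsub>T\<^esub> \<in> finsupp S (words 0)"
    by (simp add: monoid_algebra_simps(2) R.single_finsupp words_def)
qed (simp_all add: E_simps E_ops E_smult E_component T.F_mult_closed words_mult
    monoid_algebra_simps(2) word_closed)

sublocale E: pregraded_algebra S E by (rule pregraded_E)

lemma incl_eq: "\<iota> x = q (single S [x])"
  by (simp add: exterior_incl_def)

lemma incl_component: "x \<in> carrier M \<Longrightarrow> \<iota> x \<in> component E 1"
  unfolding incl_eq E_component by (intro imageI R.single_finsupp) (simp add: words_def)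

lemma incl_closed: "x \<in> carrier M \<Longrightarrow> \<iota> x \<in> carrier E"
  by (rule E.component_closed[OF incl_component])

lemma incl_add:
  assumes x: "x \<in> carrier M" and y: "y \<in> carrier M"
  shows "\<iota> (x \<oplus>\<^bsub>M\<^esub> y) = \<iota> x \<oplus>\<^bsub>E\<^esub> \<iota> y"
proof -
  have c: "single S [x] \<in> carrier T" "single S [y] \<in> carrier T" "single S [x \<oplus>\<^bsub>M\<^esub> y] \<in> carrier T"
    using x y by (simp_all add: word_closed)
  have "single S [x \<oplus>\<^bsub>M\<^esub> y] \<ominus>\<^bsub>T\<^esub> (single S [x] \<oplus>\<^bsub>T\<^esub> single S [y]) \<in> J"
    using relators_J x y unfolding relators_def by blast
  then show ?thesis unfolding incl_eq using c by (simp add: E_ops J.quot_eq)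
qed

lemma incl_smult:
  assumes s: "s \<in> carrier S" and x: "x \<in> carrier M"
  shows "\<iota> (s \<odot>\<^bsub>M\<^esub> x) = s \<odot>\<^bsub>E\<^esub> \<iota> x"
proof -
  have c: "single S [x] \<in> carrier T" "single S [s \<odot>\<^bsub>M\<^esub> x] \<in> carrier T"
    using s x by (simp_all add: word_closed)
  have "single S [s \<odot>\<^bsub>M\<^esub> x] \<ominus>\<^bsub>T\<^esub> s \<odot>\<^bsub>T\<^esub> single S [x] \<in> J"
    using relators_J s x unfolding relators_def by blast
  then show ?thesis unfolding incl_eq using c s by (simp add: E_smult J.quot_eq T.FM.smult_closed)
qed

lemma incl_square:
  assumes x: "x \<in> carrier M"
  shows "\<iota> x \<otimes>\<^bsub>E\<^esub> \<iota> x = \<zero>\<^bsub>E\<^esub>"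
proof -
  have c: "single S [x] \<in> carrier T" "single S [x, x] \<in> carrier T"
    using x by (simp_all add: word_closed)
  have "single S [x, x] \<in> J" using relators_J x unfolding relators_def by blast
  then have "q (single S [x, x]) = q \<zero>\<^bsub>T\<^esub>"
    using J.quot_eq_I[OF c(2)] J.quot_ops(4,5) by simp
  then show ?thesis unfolding incl_eq using c x by (simp add: E_ops E_simps T.single_mult)
qed

text \<open>Polarization: expand the square of the image of x + y.\<close>

lemma incl_anticommute:
  assumes x: "x \<in> carrier M" and y: "y \<in> carrier M"
  shows "\<iota> y \<otimes>\<^bsub>E\<^esub> \<iota> x = \<ominus>\<^bsub>E\<^esub> (\<iota> x \<otimes>\<^bsub>E\<^esub> \<iota> y)"
proof -
  note c = incl_closed[OF x] incl_closed[OF y]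
  have "\<zero>\<^bsub>E\<^esub> = (\<iota> x \<oplus>\<^bsub>E\<^esub> \<iota> y) \<otimes>\<^bsub>E\<^esub> (\<iota> x \<oplus>\<^bsub>E\<^esub> \<iota> y)"
    using incl_square[of "x \<oplus>\<^bsub>M\<^esub> y"] x y by (simp add: incl_add)
  also have "\<dots> = \<iota> y \<otimes>\<^bsub>E\<^esub> \<iota> x \<oplus>\<^bsub>E\<^esub> \<iota> x \<otimes>\<^bsub>E\<^esub> \<iota> y"
    using c by (simp add: E.A.l_distr E.A.r_distr incl_square x y)
  finally show ?thesis using c E.M.minus_equality by simp
qed

text \<open>Passing one generator across a word costs one sign per letter, and linearity extends
  this from words to all of degree m. It is the commutation rule that the twist by derivations
  demands of the elements \<open>e b\<close>.\<close>

lemma incl_commute_component: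
  assumes x: "x \<in> carrier M" and u: "u \<in> component E m"
  shows "u \<otimes>\<^bsub>E\<^esub> \<iota> x = (if even m then \<iota> x \<otimes>\<^bsub>E\<^esub> u else \<ominus>\<^bsub>E\<^esub> (\<iota> x \<otimes>\<^bsub>E\<^esub> u))"
proof -
  note ix = incl_closed[OF x]
  let ?P = "\<lambda>m u. u \<otimes>\<^bsub>E\<^esub> \<iota> x = (if even m then \<iota> x \<otimes>\<^bsub>E\<^esub> u else \<ominus>\<^bsub>E\<^esub> (\<iota> x \<otimes>\<^bsub>E\<^esub> u))"
  have qE: "f \<in> carrier T \<Longrightarrow> q f \<in> carrier E" for f by (simp add: E_simps)
  have word: "?P (length w) (q (single S w))" if "w \<in> lists (carrier M)" for w
    using that
  proof (induction w)
    case Nil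
    show ?case unfolding E_simps(3)[symmetric] using ix by simp
  next
    case (Cons y w)
    then have y: "y \<in> carrier M" and w: "w \<in> lists (carrier M)" by auto
    have iy: "\<iota> y \<in> carrier E" and W: "q (single S w) \<in> carrier E"
      using incl_closed[OF y] qE word_closed[OF w] by auto
    have eq: "q (single S (y # w)) = \<iota> y \<otimes>\<^bsub>E\<^esub> q (single S w)"
      unfolding incl_eq using y w by (simp add: E_ops T.single_mult word_closed)
    have IH: "?P (length w) (q (single S w))" using Cons.IH .
    have yx: "\<iota> y \<otimes>\<^bsub>E\<^esub> (\<iota> x \<otimes>\<^bsub>E\<^esub> q (single S w)) = \<ominus>\<^bsub>E\<^esub> (\<iota> x \<otimes>\<^bsub>E\<^esub> (\<iota> y \<otimes>\<^bsub>E\<^esub> q (single S w)))"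
      using E.A.m_assoc[OF iy ix W] E.A.m_assoc[OF ix iy W] incl_anticommute[OF x y] ix iy W
      by (simp add: E.A.l_minus)
    have "q (single S (y # w)) \<otimes>\<^bsub>E\<^esub> \<iota> x = \<iota> y \<otimes>\<^bsub>E\<^esub> (q (single S w) \<otimes>\<^bsub>E\<^esub> \<iota> x)"
      unfolding eq using E.A.m_assoc[OF iy W ix] .
    then show ?case unfolding eq IH using ix iy W by (simp add: E.A.r_minus yx)
  qed
  obtain f where f: "f \<in> finsupp S (words m)" "u = q f"
    using u E_component by auto
  have "?P m (q f)" using f(1)
  proof (induction f rule: words_induct)
    case zero
    show ?case using ix E_simps(2)[symmetric] by simp
  next
    case (add s w g)
    have w: "w \<in> lists (carrier M)" "length w = m" using add(2) by (auto simp: words_def)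
    have c: "q (single S w) \<in> carrier E" "q g \<in> carrier E"
      using qE word_closed[OF w(1)] finsupp_words[OF add(3)] by auto
    have "q (s \<odot>\<^bsub>T\<^esub> single S w \<oplus>\<^bsub>T\<^esub> g) = s \<odot>\<^bsub>E\<^esub> q (single S w) \<oplus>\<^bsub>E\<^esub> q g"
      using add(1) w finsupp_words[OF add(3)]
      by (simp add: E_ops E_smult word_closed T.FM.smult_closed)
    then show ?case
      using word[OF w(1)] add(4) c ix add(1) w(2)
      by (simp add: E.A.l_distr E.A.r_distr E.smult_mult_left E.smult_mult_right
          E.smult_r_minus E.M.minus_add)
  qed
  then show ?thesis using f(2) by simp
qed

text \<open>Words are products of letters, so the algebra is generated in degree 1. This serves both
  for the uniqueness of the natural map and for recognizing the final composition as the
  identity.\<close>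

lemma exterior_hom_eqI:
  assumes B: "assoc_algebra S B"
    and h: "h \<in> graded_algebra_hom S E B" and k: "k \<in> graded_algebra_hom S E B"
    and eq: "\<And>x. x \<in> carrier M \<Longrightarrow> h (\<iota> x) = k (\<iota> x)" and u: "u \<in> carrier E"
  shows "h u = k u"
proof -
  have hr: "h \<in> ring_hom E B" "k \<in> ring_hom E B"
    and hs: "\<And>s x. \<lbrakk>s \<in> carrier S; x \<in> carrier E\<rbrakk> \<Longrightarrow> h (s \<odot>\<^bsub>E\<^esub> x) = s \<odot>\<^bsub>B\<^esub> h x"
      "\<And>s x. \<lbrakk>s \<in> carrier S; x \<in> carrier E\<rbrakk> \<Longrightarrow> k (s \<odot>\<^bsub>E\<^esub> x) = s \<odot>\<^bsub>B\<^esub> k x"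
    using h k unfolding graded_algebra_hom_def by auto
  have qE: "f \<in> carrier T \<Longrightarrow> q f \<in> carrier E" for f by (simp add: E_simps)
  have word: "h (q (single S w)) = k (q (single S w))" if "w \<in> lists (carrier M)" for w
    using that
  proof (induction w)
    case Nil
    then show ?case using ring_hom_one[OF hr(1)] ring_hom_one[OF hr(2)] by (simp add: E_simps(3))
  next
    case (Cons y w)
    then have y: "y \<in> carrier M" and w: "w \<in> lists (carrier M)" by auto
    have "q (single S (y # w)) = \<iota> y \<otimes>\<^bsub>E\<^esub> q (single S w)"
      unfolding incl_eq using y w by (simp add: E_ops T.single_mult word_closed)
    then show ?case
      using Cons.IH eq[OF y] incl_closed[OF y] qE[OF word_closed[OF w]]
      by (simp add: ring_hom_mult[OF hr(1)] ring_hom_mult[OF hr(2)])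
  qed
  obtain f where f: "f \<in> carrier T" "u = q f" using u E_simps(1) by auto
  have zero: "h \<zero>\<^bsub>E\<^esub> = k \<zero>\<^bsub>E\<^esub>"
    using ring_hom_zero[OF hr(1) E.A.ring_axioms] ring_hom_zero[OF hr(2) E.A.ring_axioms] B
    by (simp add: assoc_algebra_def)
  have "h (q f) = k (q f)" using f(1)
  proof (induction f rule: T.F_induct)
    case zero
    then show ?case using \<open>h \<zero>\<^bsub>E\<^esub> = k \<zero>\<^bsub>E\<^esub>\<close> by (simp add: E_simps(2))
  next
    case (add s w g)
    then have w: "w \<in> lists (carrier M)" by simp
    have "q (s \<odot>\<^bsub>T\<^esub> single S w \<oplus>\<^bsub>T\<^esub> g) = s \<odot>\<^bsub>E\<^esub> q (single S w) \<oplus>\<^bsub>E\<^esub> q g"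
      using add(1,3) w by (simp add: E_ops E_smult word_closed T.FM.smult_closed)
    then show ?case using add(1,3,4) word[OF w] qE[OF word_closed[OF w]] qE[OF add(3)]
      by (simp add: ring_hom_add[OF hr(1)] ring_hom_add[OF hr(2)] hs E.smult_closed)
  qed
  then show ?thesis using f(2) by simp
qed

text \<open>The product of the values of \<open>g\<close> along a word is multiplicative, so its
  linear extension \<open>L\<close> is a ring homomorphism. It kills the relators, and its kernel,
  being an ideal, contains \<open>J\<close>.\<close>

lemma exterior_universal:
  assumes B: "pregraded_algebra S B"
    and g: "\<And>x. x \<in> carrier M \<Longrightarrow> g x \<in> component B 1"
    and g_add: "\<And>x y. \<lbrakk>x \<in> carrier M; y \<in> carrier M\<rbrakk> \<Longrightarrow> g (x \<oplus>\<^bsub>M\<^esub> y) = g x \<oplus>\<^bsub>B\<^esub> g y"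
    and g_smult: "\<And>s x. \<lbrakk>s \<in> carrier S; x \<in> carrier M\<rbrakk> \<Longrightarrow> g (s \<odot>\<^bsub>M\<^esub> x) = s \<odot>\<^bsub>B\<^esub> g x"
    and g_square: "\<And>x. x \<in> carrier M \<Longrightarrow> g x \<otimes>\<^bsub>B\<^esub> g x = \<zero>\<^bsub>B\<^esub>"
  obtains \<nu> where "\<nu> \<in> graded_algebra_hom S E B" "\<nu> \<in> extensional (carrier E)"
    "\<And>x. x \<in> carrier M \<Longrightarrow> \<nu> (\<iota> x) = g x"
proof -
  interpret B: pregraded_algebra S B by (rule B)
  define \<phi> where "\<phi> w = foldr (\<lambda>x u. g x \<otimes>\<^bsub>B\<^esub> u) w \<one>\<^bsub>B\<^esub>" for w
  have gB: "x \<in> carrier M \<Longrightarrow> g x \<in> carrier B" for x using B.component_closed[OF g] .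
  have \<phi>_comp: "\<phi> w \<in> component B (length w)" if "w \<in> lists (carrier M)" for w
    using that
  proof (induction w)
    case Nil
    then show ?case by (simp add: \<phi>_def B.one_component)
  next
    case (Cons x w)
    then show ?case using B.mult_component[OF g[of x], of "\<phi> w" "length w"] by (simp add: \<phi>_def)
  qed
  have \<phi>: "w \<in> lists (carrier M) \<Longrightarrow> \<phi> w \<in> carrier B" for w
    using B.component_closed[OF \<phi>_comp] .
  have \<phi>_mult: "\<phi> (u @ v) = \<phi> u \<otimes>\<^bsub>B\<^esub> \<phi> v" if "u \<in> lists (carrier M)" "v \<in> lists (carrier M)" for u v
    using that(1)
  proof (induction u)
    case Nil
    then show ?case using \<phi>[OF that(2)] by (simp add: \<phi>_def)
  next
    case (Cons x u)
    then have x: "x \<in> carrier M" "u \<in> lists (carrier M)" by auto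
    have "\<phi> (y # w) = g y \<otimes>\<^bsub>B\<^esub> \<phi> w" for y w by (simp add: \<phi>_def)
    then show ?case using Cons.IH \<phi>[OF x(2)] \<phi>[OF that(2)] gB[OF x(1)]
      by (simp add: B.A.m_assoc)
  qed
  define L where "L = lincomb S B \<phi>"
  have Lh: "L \<in> ring_hom T B"
    unfolding L_def
    by (rule T.lincomb_ring_hom[OF B.assoc_algebra_axioms]) (auto simp: \<phi> \<phi>_mult, simp add: \<phi>_def)
  have L_smult: "L (s \<odot>\<^bsub>T\<^esub> f) = s \<odot>\<^bsub>B\<^esub> L f" if "s \<in> carrier S" "f \<in> carrier T" for s f
    using that \<phi> unfolding L_def monoid_algebra_simps by (intro B.lincomb_smult) auto
  have L_word: "L (single S w) = \<phi> w" if "w \<in> lists (carrier M)" for w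
    unfolding L_def using B.lincomb_single[of \<phi> w] \<phi>[OF that] .
  have L_x: "L (single S [x]) = g x" if "x \<in> carrier M" for x
    using that by (simp add: L_word) (simp add: \<phi>_def gB)
  interpret L: ring_hom_ring T B L
    by (rule ring_hom_ringI2[OF T.FA.A.ring_axioms B.A.ring_axioms Lh])
  have ker: "ideal (a_kernel T B L) T" by (rule L.kernel_is_ideal)
  have L_minus: "L (f \<ominus>\<^bsub>T\<^esub> f') = L f \<ominus>\<^bsub>B\<^esub> L f'" if "f \<in> carrier T" "f' \<in> carrier T" for f f'
    using that by (simp add: a_minus_def)
  have "L f = \<zero>\<^bsub>B\<^esub>" if "f \<in> relators" for f
    using that unfolding relators_def
  proof (elim UnE CollectE exE conjE)
    fix x y assume xy: "x \<in> carrier M" "y \<in> carrier M"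
      and f: "f = single S [x \<oplus>\<^bsub>M\<^esub> y] \<ominus>\<^bsub>T\<^esub> (single S [x] \<oplus>\<^bsub>T\<^esub> single S [y])"
    then show ?thesis
      using gB[OF xy(1)] gB[OF xy(2)]
      by (simp add: L_minus word_closed L_x g_add B.M.r_neg a_minus_def)
  next
    fix s x assume sx: "s \<in> carrier S" "x \<in> carrier M"
      and f: "f = single S [s \<odot>\<^bsub>M\<^esub> x] \<ominus>\<^bsub>T\<^esub> s \<odot>\<^bsub>T\<^esub> single S [x]"
    then show ?thesis using gB[OF sx(2)]
      by (simp add: L_minus word_closed L_x g_smult L_smult T.FM.smult_closed B.M.r_neg a_minus_def)
  next
    fix x assume "x \<in> carrier M" "f = single S [x, x]"
    then show ?thesis by (simp add: L_word) (simp add: \<phi>_def gB g_square)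
  qed
  then have "relators \<subseteq> a_kernel T B L"
    using relators_closed unfolding a_kernel_def' by blast
  then have "J \<subseteq> a_kernel T B L"
    unfolding J_eq by (rule T.FA.A.genideal_minimal[OF ker])
  then have JL: "f \<in> J \<Longrightarrow> L f = \<zero>\<^bsub>B\<^esub>" for f
    unfolding a_kernel_def' by blast
  have L_eq: "L f = L f'" if "f \<in> carrier T" "f' \<in> carrier T" "q f = q f'" for f f'
  proof -
    have "L f \<ominus>\<^bsub>B\<^esub> L f' = \<zero>\<^bsub>B\<^esub>" using JL J.quot_eq that L_minus by metis
    then show ?thesis using that by (simp)
  qed
  obtain \<nu> where \<nu>: "\<nu> \<in> extensional (carrier E)" "\<And>f. f \<in> carrier T \<Longrightarrow> \<nu> (q f) = L f"
    by (rule factor_through_image[OF E_simps(1), of L, OF L_eq]) auto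
  have "\<nu> \<in> graded_algebra_hom S E B"
    unfolding graded_algebra_hom_def
  proof (intro CollectI conjI ballI allI ring_hom_memI)
    fix n
    show "\<nu> ` component E n \<subseteq> component B n"
    proof
      fix y assume "y \<in> \<nu> ` component E n"
      then obtain f where f: "f \<in> finsupp S (words n)" "y = \<nu> (q f)"
        unfolding E_component by auto
      have "L f \<in> component B n"
        using f(1)
      proof (induction f rule: words_induct)
        case zero
        then show ?case using B.component_zero by simp
      next
        case (add s w g)
        then have w: "w \<in> lists (carrier M)" "length w = n" by (auto simp: words_def)
        show ?case using add(1,4) finsupp_words[OF add(3)] w \<phi>_comp[OF w(1)]
          by (simp add: L_smult L_word word_closed T.FM.smult_closed B.component_add B.component_smult)
      qed
      then show "y \<in> component B n" using f \<nu>(2) finsupp_words by simp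
    qed
  qed (auto simp: E_simps E_ops E_smult \<nu>(2) L_smult word_closed L_word \<phi>_def T.FM.smult_closed T.F_mult_closed)
  moreover have "\<nu> (\<iota> x) = g x" if "x \<in> carrier M" for x
    unfolding incl_eq using that by (simp add: \<nu>(2) word_closed L_x)
  ultimately show thesis using that \<nu>(1) by blast
qed

end


section \<open>Twisting a homomorphism by derivations\<close>

text \<open>\<open>x \<mapsto> G x + e G (D x)\<close> is multiplicative because \<open>e\<close> anticommutes with everything odd and
  has square zero; iterating, \<open>G\<close> is composed with \<open>\<Prod> (1 + e\<^sub>b D\<^sub>b)\<close>.\<close>

fun twist ::
  "('y, 'e) ring_scheme \<Rightarrow> ('k \<Rightarrow> 'y) \<Rightarrow> ('k \<Rightarrow> 'x \<Rightarrow> 'x) \<Rightarrow> ('x \<Rightarrow> 'y) \<Rightarrow> 'k list \<Rightarrow> 'x \<Rightarrow> 'y" where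
  "twist E e D G [] x = G x"
| "twist E e D G (b # bs) x = twist E e D G bs x \<oplus>\<^bsub>E\<^esub> e b \<otimes>\<^bsub>E\<^esub> twist E e D G bs (D b x)"

text \<open>A derivation of degree -1. Degrees are natural numbers, so the behaviour in degree 0 is
  a separate clause; the sign in \<open>D_Leibniz\<close> is the price of moving an odd operator
  past x.\<close>

locale odd_derivation = pregraded_algebra S H
  for S and H :: "('s, 'x, 'c) graded_algebra_scheme" (structure) +
  fixes D :: "'x \<Rightarrow> 'x"
  assumes D_closed: "x \<in> carrier H \<Longrightarrow> D x \<in> carrier H"
    and D_add: "\<lbrakk>x \<in> carrier H; y \<in> carrier H\<rbrakk> \<Longrightarrow> D (x \<oplus>\<^bsub>H\<^esub> y) = D x \<oplus>\<^bsub>H\<^esub> D y"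
    and D_smult: "\<lbrakk>s \<in> carrier S; x \<in> carrier H\<rbrakk> \<Longrightarrow> D (s \<odot>\<^bsub>H\<^esub> x) = s \<odot>\<^bsub>H\<^esub> D x"
    and D_0: "x \<in> component H 0 \<Longrightarrow> D x = \<zero>\<^bsub>H\<^esub>"
    and D_Suc: "x \<in> component H (Suc n) \<Longrightarrow> D x \<in> component H n"
    and D_Leibniz: "\<lbrakk>x \<in> component H m; y \<in> carrier H\<rbrakk> \<Longrightarrow> D (x \<otimes>\<^bsub>H\<^esub> y) =
       D x \<otimes>\<^bsub>H\<^esub> y \<oplus>\<^bsub>H\<^esub> (if even m then x \<otimes>\<^bsub>H\<^esub> D y else \<ominus>\<^bsub>H\<^esub> (x \<otimes>\<^bsub>H\<^esub> D y))"

lemma graded_algebra_homD: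
  assumes "h \<in> graded_algebra_hom S A B"
  shows "h \<in> ring_hom A B"
    and "\<And>s x. \<lbrakk>s \<in> carrier S; x \<in> carrier A\<rbrakk> \<Longrightarrow> h (s \<odot>\<^bsub>A\<^esub> x) = s \<odot>\<^bsub>B\<^esub> h x"
    and "\<And>n x. x \<in> component A n \<Longrightarrow> h x \<in> component B n"
  using assms unfolding graded_algebra_hom_def by (auto, blast)

lemma graded_algebra_hom_comp:
  assumes h: "h \<in> graded_algebra_hom S A B" and k: "k \<in> graded_algebra_hom S B C"
  shows "(\<lambda>x. k (h x)) \<in> graded_algebra_hom S A C"
  using graded_algebra_homD[OF h] graded_algebra_homD[OF k]
    ring_hom_trans[OF graded_algebra_homD(1)[OF h] graded_algebra_homD(1)[OF k]]
  unfolding graded_algebra_hom_def by (auto simp: o_def ring_hom_closed)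

context odd_derivation
begin

text \<open>For x of degree m the Leibniz rule contributes (-1)^m e G(x) G(D y), and moving
  \<open>e\<close> to the right past G(x) turns this into G(x) e G(D y), which is one cross term of
  the product. The term e G(D x) G(y) is the other, and the term that contains \<open>e\<close>
  twice vanishes.\<close>

lemma twist_step:
  assumes E: "pregraded_algebra S E"
    and span: "carrier H \<subseteq> generate (add_monoid H) (\<Union>n. component H n)"
    and e: "e \<in> component E 1" and e_sq: "e \<otimes>\<^bsub>E\<^esub> e = \<zero>\<^bsub>E\<^esub>"
    and e_comm: "\<And>m u. u \<in> component E m \<Longrightarrow>
      u \<otimes>\<^bsub>E\<^esub> e = (if even m then e \<otimes>\<^bsub>E\<^esub> u else \<ominus>\<^bsub>E\<^esub> (e \<otimes>\<^bsub>E\<^esub> u))"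
    and G: "G \<in> graded_algebra_hom S H E"
  shows "(\<lambda>x. G x \<oplus>\<^bsub>E\<^esub> e \<otimes>\<^bsub>E\<^esub> G (D x)) \<in> graded_algebra_hom S H E"
proof -
  interpret E: pregraded_algebra S E by (rule E)
  note Gh = graded_algebra_homD(1)[OF G]
  interpret G: ring_hom_ring H E G
    by (rule ring_hom_ringI2[OF A.ring_axioms E.A.ring_axioms Gh])
  let ?K = "\<lambda>x. G x \<oplus>\<^bsub>E\<^esub> e \<otimes>\<^bsub>E\<^esub> G (D x)"
  have ec: "e \<in> carrier E" by (rule E.component_closed[OF e])
  have add: "?K (x \<oplus>\<^bsub>H\<^esub> y) = ?K x \<oplus>\<^bsub>E\<^esub> ?K y" if "x \<in> carrier H" "y \<in> carrier H" for x y
    using that ec by (simp add: D_add D_closed E.A.r_distr E.M.add.m_ac)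
  have K_closed: "?K x \<in> carrier E" if "x \<in> carrier H" for x
    using that ec by (simp add: D_closed)
  have mult_hom: "?K (x \<otimes>\<^bsub>H\<^esub> y) = ?K x \<otimes>\<^bsub>E\<^esub> ?K y" if x: "x \<in> component H m" and y: "y \<in> carrier H" for x y m
  proof -
    have xc: "x \<in> carrier H" by (rule component_closed[OF x])
    have Gx: "G x \<in> component E m" by (rule graded_algebra_homD(3)[OF G x])
    have cl: "G x \<in> carrier E" "G y \<in> carrier E" "G (D x) \<in> carrier E" "G (D y) \<in> carrier E" "e \<in> carrier E"
      using xc y ec by (simp_all add: D_closed)
    \<comment> \<open>Whichever sign arises when \<open>e\<close> passes G(D x), the two factors
      \<open>e\<close> become adjacent. For m = 0 there is no degree m - 1, but then D x =
      0.\<close>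
    have zero: "(e \<otimes>\<^bsub>E\<^esub> G (D x)) \<otimes>\<^bsub>E\<^esub> (e \<otimes>\<^bsub>E\<^esub> G (D y)) = \<zero>\<^bsub>E\<^esub>"
    proof (cases m)
      case 0
      then have "D x = \<zero>\<^bsub>H\<^esub>" using D_0 x by simp
      then show ?thesis using cl by simp
    next
      case (Suc k)
      then have "G (D x) \<in> component E k" using graded_algebra_homD(3)[OF G D_Suc] x by simp
      from e_comm[OF this]
      have "G (D x) \<otimes>\<^bsub>E\<^esub> e = e \<otimes>\<^bsub>E\<^esub> G (D x) \<or> G (D x) \<otimes>\<^bsub>E\<^esub> e = \<ominus>\<^bsub>E\<^esub> (e \<otimes>\<^bsub>E\<^esub> G (D x))" by presburger
      moreover have "(e \<otimes>\<^bsub>E\<^esub> G (D x)) \<otimes>\<^bsub>E\<^esub> (e \<otimes>\<^bsub>E\<^esub> G (D y)) = e \<otimes>\<^bsub>E\<^esub> (G (D x) \<otimes>\<^bsub>E\<^esub> e) \<otimes>\<^bsub>E\<^esub> G (D y)"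
        using cl by (simp add: E.A.m_assoc)
      moreover have "e \<otimes>\<^bsub>E\<^esub> (e \<otimes>\<^bsub>E\<^esub> G (D x)) = \<zero>\<^bsub>E\<^esub>"
        using E.A.m_assoc[of e e "G (D x)"] e_sq cl by simp
      ultimately show ?thesis using cl by (auto simp: E.A.r_minus)
    qed
    have "?K (x \<otimes>\<^bsub>H\<^esub> y) = G x \<otimes>\<^bsub>E\<^esub> G y \<oplus>\<^bsub>E\<^esub> e \<otimes>\<^bsub>E\<^esub> (G (D x) \<otimes>\<^bsub>E\<^esub> G y) \<oplus>\<^bsub>E\<^esub> (G x \<otimes>\<^bsub>E\<^esub> e) \<otimes>\<^bsub>E\<^esub> G (D y)"
      using xc y cl D_Leibniz[OF x y] e_comm[OF Gx]
      by (simp add: D_closed E.A.r_distr E.A.m_assoc E.M.add.m_assoc E.A.r_minus E.A.l_minus)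
    also have "\<dots> = ?K x \<otimes>\<^bsub>E\<^esub> ?K y"
      using cl zero by (simp add: E.A.r_distr E.A.l_distr E.A.m_assoc E.M.add.m_assoc)
    finally show ?thesis .
  qed
  \<comment> \<open>The rule proved so far has a homogeneous left factor. Both sides are additive in
    x, and homogeneous elements generate the additive group of \<open>H\<close>.\<close>
  have mult: "?K (x \<otimes>\<^bsub>H\<^esub> y) = ?K x \<otimes>\<^bsub>E\<^esub> ?K y" if x: "x \<in> carrier H" and y: "y \<in> carrier H" for x y
  proof -
    have "x \<in> generate (add_monoid H) (\<Union>n. component H n)" using span x by blast
    then have "x \<in> carrier H \<and> ?K (x \<otimes>\<^bsub>H\<^esub> y) = ?K x \<otimes>\<^bsub>E\<^esub> ?K y"
    proof (induction x rule: generate.induct)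
      case one
      have z: "\<zero>\<^bsub>H\<^esub> \<in> component H 0" by (rule component_zero)
      then show ?case using mult_hom[OF z y] by simp
    next
      case (incl h)
      then obtain m where h: "h \<in> component H m" by auto
      then show ?case using mult_hom[OF h y] component_closed by blast
    next
      case (inv h)
      then obtain m where h: "\<ominus>\<^bsub>H\<^esub> h \<in> component H m" using component_uminus by blast
      then show ?case using mult_hom[OF h y] component_closed by (metis a_inv_def)
    next
      case (eng h1 h2)
      then have h: "h1 \<in> carrier H" "h2 \<in> carrier H" by auto
      then have hy: "h1 \<otimes>\<^bsub>H\<^esub> y \<in> carrier H" "h2 \<otimes>\<^bsub>H\<^esub> y \<in> carrier H" using y by auto
      have "?K ((h1 \<oplus>\<^bsub>H\<^esub> h2) \<otimes>\<^bsub>H\<^esub> y) = ?K (h1 \<otimes>\<^bsub>H\<^esub> y) \<oplus>\<^bsub>E\<^esub> ?K (h2 \<otimes>\<^bsub>H\<^esub> y)"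
        unfolding A.l_distr[OF h y] by (rule add[OF hy])
      also have "\<dots> = ?K h1 \<otimes>\<^bsub>E\<^esub> ?K y \<oplus>\<^bsub>E\<^esub> ?K h2 \<otimes>\<^bsub>E\<^esub> ?K y" using eng.IH by argo
      also have "\<dots> = (?K h1 \<oplus>\<^bsub>E\<^esub> ?K h2) \<otimes>\<^bsub>E\<^esub> ?K y"
        by (rule E.A.l_distr[OF K_closed[OF h(1)] K_closed[OF h(2)] K_closed[OF y], symmetric])
      also have "\<dots> = ?K (h1 \<oplus>\<^bsub>H\<^esub> h2) \<otimes>\<^bsub>E\<^esub> ?K y" unfolding add[OF h] ..
      finally show ?case using h by simp
    qed
    then show ?thesis by blast
  qed
  show ?thesis
    unfolding graded_algebra_hom_def
  proof (intro CollectI conjI ballI allI ring_hom_memI)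
    show "?K \<one>\<^bsub>H\<^esub> = \<one>\<^bsub>E\<^esub>" using ec by (simp add: D_0[OF one_component])
    fix s x assume "s \<in> carrier S" "x \<in> carrier H"
    then show "?K (s \<odot>\<^bsub>H\<^esub> x) = s \<odot>\<^bsub>E\<^esub> ?K x"
      using ec by (simp add: graded_algebra_homD(2)[OF G] D_smult D_closed E.smult_r_distr E.smult_mult_right)
  next
    fix n
    show "?K ` component H n \<subseteq> component E n"
    proof
      fix u assume "u \<in> ?K ` component H n"
      then obtain x where x: "x \<in> component H n" "u = ?K x" by blast
      have "e \<otimes>\<^bsub>E\<^esub> G (D x) \<in> component E n"
      proof (cases n)
        case 0
        then show ?thesis using x D_0[of x] ec E.component_zero by simp
      next
        case (Suc k)
        then have "G (D x) \<in> component E k" using graded_algebra_homD(3)[OF G D_Suc] x by simp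
        from E.mult_component[OF e this] show ?thesis using Suc by simp
      qed
      then show "u \<in> component E n" using x graded_algebra_homD(3)[OF G x(1)] E.component_add by simp
    qed
  qed (use add mult K_closed in auto)
qed

end

lemma twist_hom:
  assumes H: "pregraded_algebra S H" and E: "pregraded_algebra S E"
    and span: "carrier H \<subseteq> generate (add_monoid H) (\<Union>n. component H n)"
    and D: "\<And>b. b \<in> set bs \<Longrightarrow> odd_derivation S H (D b)"
    and e: "\<And>b. b \<in> set bs \<Longrightarrow> e b \<in> component E 1" "\<And>b. b \<in> set bs \<Longrightarrow> e b \<otimes>\<^bsub>E\<^esub> e b = \<zero>\<^bsub>E\<^esub>"
    and e_comm: "\<And>b m u. \<lbrakk>b \<in> set bs; u \<in> component E m\<rbrakk> \<Longrightarrow>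
      u \<otimes>\<^bsub>E\<^esub> e b = (if even m then e b \<otimes>\<^bsub>E\<^esub> u else \<ominus>\<^bsub>E\<^esub> (e b \<otimes>\<^bsub>E\<^esub> u))"
    and G: "G \<in> graded_algebra_hom S H E"
  shows "twist E e D G bs \<in> graded_algebra_hom S H E"
  using D e e_comm
proof (induction bs)
  case Nil
  have "twist E e D G [] = G" by (rule ext) simp
  then show ?case using G by simp
next
  case (Cons b bs)
  have IH: "twist E e D G bs \<in> graded_algebra_hom S H E" using Cons by simp
  have eq: "twist E e D G (b # bs) = (\<lambda>x. twist E e D G bs x \<oplus>\<^bsub>E\<^esub> e b \<otimes>\<^bsub>E\<^esub> twist E e D G bs (D b x))"
    by (rule ext) simp
  have "odd_derivation S H (D b)" using Cons.prems(1) by simp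
  then show ?case
    unfolding eq by (rule odd_derivation.twist_step[OF _ E span _ _ _ IH]) (use Cons.prems in auto)
qed

text \<open>D x has degree 0, so any further derivation kills it. In the expanded product only the
  constant term and the terms with a single derivation survive.\<close>

lemma twist_degree_1:
  assumes E: "assoc_algebra S E"
    and H: "pregraded_algebra S H" and D: "\<And>b. b \<in> set bs \<Longrightarrow> odd_derivation S H (D b)"
    and e: "\<And>b. b \<in> set bs \<Longrightarrow> e b \<in> carrier E"
    and G: "G \<in> ring_hom H E"
    and x: "x \<in> component H 1" and "distinct bs"
  shows "twist E e D G bs x = G x \<oplus>\<^bsub>E\<^esub> (\<Oplus>\<^bsub>E\<^esub>b\<in>set bs. e b \<otimes>\<^bsub>E\<^esub> G (D b x))"
proof -
  interpret E: assoc_algebra S E by (rule E)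
  interpret H: pregraded_algebra S H by (rule H)
  note cl = ring_hom_closed[OF G]
  note zero = ring_hom_zero[OF G H.A.ring_axioms E.A.ring_axioms]
  \<comment> \<open>The two enclosing lists carry the hypotheses on \<open>D\<close> and
    \<open>e\<close> unchanged while the induction shortens \<open>bs\<close>.\<close>
  have deg0: "twist E e D G bs y = G y" if "y \<in> component H 0" "set bs \<subseteq> set bs'" "set bs' \<subseteq> set bs''"
      "\<And>b. b \<in> set bs'' \<Longrightarrow> odd_derivation S H (D b)" "\<And>b. b \<in> set bs'' \<Longrightarrow> e b \<in> carrier E"
    for bs bs' bs'' y
    using that
  proof (induction bs arbitrary: y)
    case (Cons b bs)
    have Dy: "D b y = \<zero>\<^bsub>H\<^esub>" using Cons.prems odd_derivation.D_0[of S H "D b" y] by auto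
    have e: "e b \<in> carrier E" using Cons.prems by auto
    have "twist E e D G bs y = G y" "twist E e D G bs \<zero>\<^bsub>H\<^esub> = G \<zero>\<^bsub>H\<^esub>"
      using Cons.IH[of y] Cons.IH[of "\<zero>\<^bsub>H\<^esub>"] Cons.prems H.component_zero by auto
    then show ?case using e cl[OF H.component_closed[OF Cons.prems(1)]] by (simp add: Dy zero)
  qed simp
  show ?thesis
    using D e \<open>distinct bs\<close>
  proof (induction bs)
    case Nil
    then show ?case using cl[OF H.component_closed[OF x]] by simp
  next
    case (Cons b bs)
    have D: "odd_derivation S H (D c)" if "c \<in> set (b # bs)" for c using Cons.prems that by simp
    have Dx: "D c x \<in> component H 0" if "c \<in> set (b # bs)" for c
      using odd_derivation.D_Suc[OF D[OF that], of x 0] x by simp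
    have c: "e c \<otimes>\<^bsub>E\<^esub> G (D c x) \<in> carrier E" if "c \<in> set (b # bs)" for c
      using Cons.prems(2)[OF that] cl[OF H.component_closed[OF Dx[OF that]]] by simp
    have IH: "twist E e D G bs x = G x \<oplus>\<^bsub>E\<^esub> (\<Oplus>\<^bsub>E\<^esub>b\<in>set bs. e b \<otimes>\<^bsub>E\<^esub> G (D b x))"
      using Cons by simp
    have eq: "twist E e D G bs (D b x) = G (D b x)"
      by (rule deg0[of _ bs bs bs]) (use Dx Cons.prems in auto)
    have ins: "(\<Oplus>\<^bsub>E\<^esub>b\<in>set (b # bs). e b \<otimes>\<^bsub>E\<^esub> G (D b x)) =
        e b \<otimes>\<^bsub>E\<^esub> G (D b x) \<oplus>\<^bsub>E\<^esub> (\<Oplus>\<^bsub>E\<^esub>b\<in>set bs. e b \<otimes>\<^bsub>E\<^esub> G (D b x))"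
      unfolding list.set using Cons.prems(3) c by (intro E.M.finsum_insert) auto
    have s: "(\<Oplus>\<^bsub>E\<^esub>b\<in>set bs. e b \<otimes>\<^bsub>E\<^esub> G (D b x)) \<in> carrier E"
      using c by (intro E.M.finsum_closed) auto
    show ?case unfolding twist.simps IH eq ins
      using s c[of b] cl[OF H.component_closed[OF x]] by (simp add: E.M.add.m_ac)
  qed
qed


section \<open>Coordinates\<close>

text \<open>Uniqueness of the expansion makes the coordinates linear: the sum of two expansions is
  an expansion of the sum.\<close>

lemma module_basis_coordinates:
  assumes M: "module R M" and B: "module_basis R M B"
  obtains \<kappa> where
    "\<And>x. x \<in> carrier M \<Longrightarrow> \<kappa> x \<in> finsupp R B"
    "\<And>x. x \<in> carrier M \<Longrightarrow> x = lincomb R M (\<lambda>b. b) (\<kappa> x)"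
    "\<And>x y. x \<in> carrier M \<Longrightarrow> y \<in> carrier M \<Longrightarrow> \<kappa> (x \<oplus>\<^bsub>M\<^esub> y) = (\<lambda>b. \<kappa> x b \<oplus>\<^bsub>R\<^esub> \<kappa> y b)"
    "\<And>r x. r \<in> carrier R \<Longrightarrow> x \<in> carrier M \<Longrightarrow> \<kappa> (r \<odot>\<^bsub>M\<^esub> x) = (\<lambda>b. r \<otimes>\<^bsub>R\<^esub> \<kappa> x b)"
proof -
  interpret module R M by (rule M)
  have BM: "b \<in> B \<Longrightarrow> b \<in> carrier M" for b using B by (auto simp: module_basis_def)
  have ex1: "\<exists>!c. c \<in> finsupp R B \<and> x = lincomb R M (\<lambda>b. b) c" if "x \<in> carrier M" for x
    using B that unfolding module_basis_def lincomb_def by blast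
  define \<kappa> where "\<kappa> x = (THE c. c \<in> finsupp R B \<and> x = lincomb R M (\<lambda>b. b) c)" for x
  have \<kappa>: "\<kappa> x \<in> finsupp R B \<and> x = lincomb R M (\<lambda>b. b) (\<kappa> x)" if "x \<in> carrier M" for x
    unfolding \<kappa>_def by (rule theI'[OF ex1[OF that]])
  have unique: "\<kappa> x = c" if "x \<in> carrier M" "c \<in> finsupp R B" "x = lincomb R M (\<lambda>b. b) c" for x c
    using ex1[OF that(1)] \<kappa>[OF that(1)] that(2,3) by blast
  show thesis
  proof (rule that)
    fix x assume x: "x \<in> carrier M"
    show "\<kappa> x \<in> finsupp R B" "x = lincomb R M (\<lambda>b. b) (\<kappa> x)" using \<kappa>[OF x] by auto
    fix y assume y: "y \<in> carrier M"
    show "\<kappa> (x \<oplus>\<^bsub>M\<^esub> y) = (\<lambda>b. \<kappa> x b \<oplus>\<^bsub>R\<^esub> \<kappa> y b)"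
      by (rule unique) (use x y \<kappa> BM in \<open>auto intro!: R.finsupp_add simp: lincomb_add[of _ B]\<close>)
  next
    fix r x assume r: "r \<in> carrier R" and x: "x \<in> carrier M"
    show "\<kappa> (r \<odot>\<^bsub>M\<^esub> x) = (\<lambda>b. r \<otimes>\<^bsub>R\<^esub> \<kappa> x b)"
      by (rule unique) (use r x \<kappa> BM in \<open>auto intro!: R.finsupp_smult simp: lincomb_smult[of _ _ B]\<close>)
  qed
qed

text \<open>Semilinear along \<phi>, to cover both the passage from \<open>P\<close> over R to the
  complex over S and, with \<phi> the identity, the inclusion of a module into its exterior
  algebra.\<close>

lemma lincomb_hom:
  assumes M: "module R M" and N: "module S N"
    and \<phi>: "\<phi> \<in> ring_hom R S"
    and \<tau>: "\<And>x. x \<in> carrier M \<Longrightarrow> \<tau> x \<in> carrier N"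
    and \<tau>_add: "\<And>x y. x \<in> carrier M \<Longrightarrow> y \<in> carrier M \<Longrightarrow> \<tau> (x \<oplus>\<^bsub>M\<^esub> y) = \<tau> x \<oplus>\<^bsub>N\<^esub> \<tau> y"
    and \<tau>_smult: "\<And>r x. r \<in> carrier R \<Longrightarrow> x \<in> carrier M \<Longrightarrow> \<tau> (r \<odot>\<^bsub>M\<^esub> x) = \<phi> r \<odot>\<^bsub>N\<^esub> \<tau> x"
    and v: "\<And>b. b \<in> B \<Longrightarrow> v b \<in> carrier M" and c: "c \<in> finsupp R B"
  shows "(\<lambda>b. \<phi> (c b)) \<in> finsupp S B"
    and "\<tau> (lincomb R M v c) = lincomb S N (\<lambda>b. \<tau> (v b)) (\<lambda>b. \<phi> (c b))"
proof -
  interpret M: module R M by (rule M)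
  interpret N: module S N by (rule N)
  have \<phi>0: "\<phi> \<zero>\<^bsub>R\<^esub> = \<zero>\<^bsub>S\<^esub>"
    by (rule ring_hom_zero[OF \<phi> M.R.ring_axioms N.R.ring_axioms])
  have fs: "(\<lambda>b. \<phi> (c b)) \<in> finsupp S B" if "c \<in> finsupp R B" for c
  proof -
    have "{b. \<phi> (c b) \<noteq> \<zero>\<^bsub>S\<^esub>} \<subseteq> {b. c b \<noteq> \<zero>\<^bsub>R\<^esub>}" using \<phi>0 by auto
    then have "finite {b. \<phi> (c b) \<noteq> \<zero>\<^bsub>S\<^esub>}" using finsupp_finite[OF that] finite_subset by blast
    then show ?thesis using that \<phi>0 ring_hom_closed[OF \<phi>] by (auto simp: finsupp_def)
  qed
  show "(\<lambda>b. \<phi> (c b)) \<in> finsupp S B" by (rule fs[OF c])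
  have \<tau>0: "\<tau> \<zero>\<^bsub>M\<^esub> = \<zero>\<^bsub>N\<^esub>"
    using \<tau>_smult[of "\<zero>\<^bsub>R\<^esub>" "\<zero>\<^bsub>M\<^esub>"] \<tau>[of "\<zero>\<^bsub>M\<^esub>"] \<phi>0 by simp
  have \<phi>1: "\<phi> \<one>\<^bsub>R\<^esub> = \<one>\<^bsub>S\<^esub>" by (rule ring_hom_one[OF \<phi>])
  show "\<tau> (lincomb R M v c) = lincomb S N (\<lambda>b. \<tau> (v b)) (\<lambda>b. \<phi> (c b))"
    using c
  proof (induction c rule: M.R.finsupp_induct)
    case zero
    then show ?case by (simp add: \<phi>0 \<tau>0)
  next
    case (add r x g)
    have s: "single R x \<in> finsupp R B" "single S x \<in> finsupp S B"
      using add by (simp_all add: M.R.single_finsupp N.R.single_finsupp)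
    have eq: "(\<lambda>b. \<phi> (r \<otimes>\<^bsub>R\<^esub> single R x b \<oplus>\<^bsub>R\<^esub> g b)) = (\<lambda>b. \<phi> r \<otimes>\<^bsub>S\<^esub> single S x b \<oplus>\<^bsub>S\<^esub> \<phi> (g b))"
    proof
      fix b
      have "\<phi> (single R x b) = single S x b" by (simp add: single_def \<phi>0 \<phi>1)
      then show "\<phi> (r \<otimes>\<^bsub>R\<^esub> single R x b \<oplus>\<^bsub>R\<^esub> g b) = \<phi> r \<otimes>\<^bsub>S\<^esub> single S x b \<oplus>\<^bsub>S\<^esub> \<phi> (g b)"
        using add M.R.finsupp_closed[OF s(1)] M.R.finsupp_closed[OF add(3)]
        by (simp add: ring_hom_add[OF \<phi>] ring_hom_mult[OF \<phi>])
    qed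
    have L: "lincomb R M v (\<lambda>b. r \<otimes>\<^bsub>R\<^esub> single R x b \<oplus>\<^bsub>R\<^esub> g b) = r \<odot>\<^bsub>M\<^esub> v x \<oplus>\<^bsub>M\<^esub> lincomb R M v g"
      using M.lincomb_add[OF M.R.finsupp_smult[OF add(1) s(1)] add(3) v]
        M.lincomb_smult[OF add(1) s(1) v] M.lincomb_single[of v x] v[OF add(2)] by simp
    have "\<phi> r \<in> carrier S" using ring_hom_closed[OF \<phi> add(1)] .
    moreover have "b \<in> B \<Longrightarrow> \<tau> (v b) \<in> carrier N" for b using \<tau> v by blast
    ultimately have L': "lincomb S N (\<lambda>b. \<tau> (v b)) (\<lambda>b. \<phi> r \<otimes>\<^bsub>S\<^esub> single S x b \<oplus>\<^bsub>S\<^esub> \<phi> (g b)) =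
        \<phi> r \<odot>\<^bsub>N\<^esub> \<tau> (v x) \<oplus>\<^bsub>N\<^esub> lincomb S N (\<lambda>b. \<tau> (v b)) (\<lambda>b. \<phi> (g b))"
      using N.lincomb_add[OF N.R.finsupp_smult[OF _ s(2)] fs[OF add(3)], of "\<phi> r" "\<lambda>b. \<tau> (v b)"]
        N.lincomb_smult[OF _ s(2), of "\<phi> r" "\<lambda>b. \<tau> (v b)"] N.lincomb_single[of "\<lambda>b. \<tau> (v b)" x] add(2)
      by simp
    show ?case
      unfolding eq L L' using add v M.lincomb_closed[OF add(3) v] by (simp add: \<tau>_add \<tau>_smult)
  qed
qed

section \<open>Homogeneous parts, and coordinates on a graded free module\<close>

context graded_algebra
begin

definition part :: "'b \<Rightarrow> nat \<Rightarrow> 'b" where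
  "part x = (THE f. (\<forall>n. f n \<in> component A n) \<and> finite {n. f n \<noteq> \<zero>\<^bsub>A\<^esub>} \<and>
     x = (\<Oplus>\<^bsub>A\<^esub>n\<in>{n. f n \<noteq> \<zero>\<^bsub>A\<^esub>}. f n))"

lemma part:
  assumes x: "x \<in> carrier A"
  shows part_component: "part x n \<in> component A n"
    and part_finite: "finite {n. part x n \<noteq> \<zero>\<^bsub>A\<^esub>}"
    and part_sum: "x = (\<Oplus>\<^bsub>A\<^esub>n\<in>{n. part x n \<noteq> \<zero>\<^bsub>A\<^esub>}. part x n)"
  using theI'[OF decomposition[OF x]] unfolding part_def by blast+

text \<open>Any finite set outside which \<open>f\<close> vanishes may serve as \<open>N\<close>, so
  the exact support of a sum of parts never has to be computed.\<close>

lemma part_unique: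
  assumes f: "\<And>n. f n \<in> component A n" and N: "finite N" "\<And>n. n \<notin> N \<Longrightarrow> f n = \<zero>\<^bsub>A\<^esub>"
    and x: "x = (\<Oplus>\<^bsub>A\<^esub>n\<in>N. f n)"
  shows "part x = f"
proof -
  have c: "f n \<in> carrier A" for n using component_closed[OF f] .
  have sub: "{n. f n \<noteq> \<zero>\<^bsub>A\<^esub>} \<subseteq> N" using N by blast
  have fin: "finite {n. f n \<noteq> \<zero>\<^bsub>A\<^esub>}" using finite_subset[OF sub N(1)] .
  have "(\<Oplus>\<^bsub>A\<^esub>n\<in>{n. f n \<noteq> \<zero>\<^bsub>A\<^esub>}. f n) = (\<Oplus>\<^bsub>A\<^esub>n\<in>N. f n)"
    by (rule M.add.finprod_mono_neutral_cong_left) (use sub N c in auto)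
  then have eq: "x = (\<Oplus>\<^bsub>A\<^esub>n\<in>{n. f n \<noteq> \<zero>\<^bsub>A\<^esub>}. f n)" using x by simp
  have "x \<in> carrier A" unfolding x by (rule M.finsum_closed) (use c in auto)
  from decomposition[OF this] show ?thesis
    unfolding part_def by (rule the1_equality) (use f fin eq in blast)
qed

lemma part_superset:
  assumes x: "x \<in> carrier A" and N: "finite N" "{n. part x n \<noteq> \<zero>\<^bsub>A\<^esub>} \<subseteq> N"
  shows "x = (\<Oplus>\<^bsub>A\<^esub>n\<in>N. part x n)"
proof -
  have c: "part x n \<in> carrier A" for n using component_closed[OF part_component[OF x]] .
  have "(\<Oplus>\<^bsub>A\<^esub>n\<in>{n. part x n \<noteq> \<zero>\<^bsub>A\<^esub>}. part x n) = (\<Oplus>\<^bsub>A\<^esub>n\<in>N. part x n)"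
    by (rule M.add.finprod_mono_neutral_cong_left) (use N c in auto)
  then show ?thesis using part_sum[OF x] by simp
qed

lemma part_closed: "x \<in> carrier A \<Longrightarrow> part x n \<in> carrier A"
  using component_closed[OF part_component] .

lemma part_add:
  assumes x: "x \<in> carrier A" and y: "y \<in> carrier A"
  shows "part (x \<oplus>\<^bsub>A\<^esub> y) = (\<lambda>n. part x n \<oplus>\<^bsub>A\<^esub> part y n)"
proof (rule part_unique)
  let ?N = "{n. part x n \<noteq> \<zero>\<^bsub>A\<^esub>} \<union> {n. part y n \<noteq> \<zero>\<^bsub>A\<^esub>}"
  show fin: "finite ?N" using part_finite[OF x] part_finite[OF y] by simp
  have "x \<oplus>\<^bsub>A\<^esub> y = (\<Oplus>\<^bsub>A\<^esub>n\<in>?N. part x n) \<oplus>\<^bsub>A\<^esub> (\<Oplus>\<^bsub>A\<^esub>n\<in>?N. part y n)"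
    using part_superset[OF x fin] part_superset[OF y fin] by simp
  also have "\<dots> = (\<Oplus>\<^bsub>A\<^esub>n\<in>?N. part x n \<oplus>\<^bsub>A\<^esub> part y n)"
    by (rule M.finsum_addf[symmetric]) (use part_closed x y in auto)
  finally show "x \<oplus>\<^bsub>A\<^esub> y = (\<Oplus>\<^bsub>A\<^esub>n\<in>?N. part x n \<oplus>\<^bsub>A\<^esub> part y n)" .
qed (use part_component x y component_add component_zero M.l_zero component_closed in auto)

lemma part_smult:
  assumes r: "r \<in> carrier R" and x: "x \<in> carrier A"
  shows "part (r \<odot>\<^bsub>A\<^esub> x) = (\<lambda>n. r \<odot>\<^bsub>A\<^esub> part x n)"
proof (rule part_unique)
  let ?N = "{n. part x n \<noteq> \<zero>\<^bsub>A\<^esub>}"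
  show "finite ?N" using part_finite[OF x] by simp
  have "r \<odot>\<^bsub>A\<^esub> x = r \<odot>\<^bsub>A\<^esub> (\<Oplus>\<^bsub>A\<^esub>n\<in>?N. part x n)" using part_sum[OF x] by simp
  also have "\<dots> = (\<Oplus>\<^bsub>A\<^esub>n\<in>?N. r \<odot>\<^bsub>A\<^esub> part x n)"
    by (rule finsum_smult_ldistr) (use part_closed x r part_finite in auto)
  finally show "r \<odot>\<^bsub>A\<^esub> x = (\<Oplus>\<^bsub>A\<^esub>n\<in>?N. r \<odot>\<^bsub>A\<^esub> part x n)" .
qed (use part_component x r component_smult in auto)

lemma part_homogeneous:
  assumes x: "x \<in> component A m"
  shows "part x = (\<lambda>n. if n = m then x else \<zero>\<^bsub>A\<^esub>)"
proof (rule part_unique[where N = "{m}"])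
  show "x = (\<Oplus>\<^bsub>A\<^esub>n\<in>{m}. if n = m then x else \<zero>\<^bsub>A\<^esub>)"
    using component_closed[OF x] by simp
qed (use x component_zero in auto)

text \<open>The summands are the parts of the given x, not arbitrary homogeneous elements.
  Properties that pass from x to its parts, such as being a cycle modulo \<open>IP\<close>, thus
  remain available in the induction step.\<close>

lemma homogeneous_induct [consumes 1, case_names zero add]:
  assumes x: "x \<in> carrier A" and zero: "Q \<zero>\<^bsub>A\<^esub>"
    and add: "\<And>n y. \<lbrakk>y \<in> carrier A; Q y\<rbrakk> \<Longrightarrow> Q (part x n \<oplus>\<^bsub>A\<^esub> y)"
  shows "Q x"
proof -
  have "(\<Oplus>\<^bsub>A\<^esub>n\<in>N. part x n) \<in> carrier A \<and> Q (\<Oplus>\<^bsub>A\<^esub>n\<in>N. part x n)" if "finite N" for N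
    using that
  proof (induction N rule: finite_induct)
    case empty
    then show ?case using zero by simp
  next
    case (insert n N)
    have "(\<Oplus>\<^bsub>A\<^esub>n\<in>insert n N. part x n) = part x n \<oplus>\<^bsub>A\<^esub> (\<Oplus>\<^bsub>A\<^esub>n\<in>N. part x n)"
      using insert.hyps part_closed[OF x] by (intro M.finsum_insert) auto
    then show ?case using insert.IH add part_closed[OF x] by simp
  qed
  from this[OF part_finite[OF x]] show ?thesis using part_sum[OF x] by simp
qed

text \<open>Bases of the components are assembled into a basis of the whole module. Indexing by
  pairs (n, b) makes the union disjoint by construction, and the coordinate of x at (n, b) reads the
  n-th part of x.\<close>

lemma free_components_coordinates:
  assumes free: "\<And>n. free_module R (A\<lparr>carrier := component A n\<rparr>)"
  obtains K :: "(nat \<times> 'b) set" and \<kappa> where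
    "\<And>k. k \<in> K \<Longrightarrow> snd k \<in> carrier A"
    "\<And>x. x \<in> carrier A \<Longrightarrow> \<kappa> x \<in> finsupp R K"
    "\<And>x. x \<in> carrier A \<Longrightarrow> x = lincomb R A snd (\<kappa> x)"
    "\<And>x y. x \<in> carrier A \<Longrightarrow> y \<in> carrier A \<Longrightarrow> \<kappa> (x \<oplus>\<^bsub>A\<^esub> y) = (\<lambda>k. \<kappa> x k \<oplus>\<^bsub>R\<^esub> \<kappa> y k)"
    "\<And>r x. r \<in> carrier R \<Longrightarrow> x \<in> carrier A \<Longrightarrow> \<kappa> (r \<odot>\<^bsub>A\<^esub> x) = (\<lambda>k. r \<otimes>\<^bsub>R\<^esub> \<kappa> x k)"
proof -
  let ?A = "\<lambda>n. A\<lparr>carrier := component A n\<rparr>"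
  have mod: "module R (?A n)" for n using free by (simp add: free_module_def)
  from free obtain B where B: "\<And>n. module_basis R (?A n) (B n)"
    unfolding free_module_def by metis
  \<comment> \<open>All properties of one coordinate system are bundled in a single predicate, so
    that one choice over n produces the family \<open>\<kappa>'\<close>.\<close>
  define Q where "Q n \<kappa> \<longleftrightarrow> (\<forall>x\<in>component A n. \<kappa> x \<in> finsupp R (B n)) \<and>
      (\<forall>x\<in>component A n. x = lincomb R (?A n) (\<lambda>b. b) (\<kappa> x)) \<and>
      (\<forall>x\<in>component A n. \<forall>y\<in>component A n. \<kappa> (x \<oplus>\<^bsub>A\<^esub> y) = (\<lambda>b. \<kappa> x b \<oplus>\<^bsub>R\<^esub> \<kappa> y b)) \<and>
      (\<forall>r\<in>carrier R. \<forall>x\<in>component A n. \<kappa> (r \<odot>\<^bsub>A\<^esub> x) = (\<lambda>b. r \<otimes>\<^bsub>R\<^esub> \<kappa> x b))" for n \<kappa>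
  have "\<exists>\<kappa>. Q n \<kappa>" for n
  proof -
    obtain \<kappa> where \<kappa>:
      "\<And>x. x \<in> carrier (?A n) \<Longrightarrow> \<kappa> x \<in> finsupp R (B n)"
      "\<And>x. x \<in> carrier (?A n) \<Longrightarrow> x = lincomb R (?A n) (\<lambda>b. b) (\<kappa> x)"
      "\<And>x y. x \<in> carrier (?A n) \<Longrightarrow> y \<in> carrier (?A n)
        \<Longrightarrow> \<kappa> (x \<oplus>\<^bsub>?A n\<^esub> y) = (\<lambda>b. \<kappa> x b \<oplus>\<^bsub>R\<^esub> \<kappa> y b)"
      "\<And>r x. r \<in> carrier R \<Longrightarrow> x \<in> carrier (?A n)
        \<Longrightarrow> \<kappa> (r \<odot>\<^bsub>?A n\<^esub> x) = (\<lambda>b. r \<otimes>\<^bsub>R\<^esub> \<kappa> x b)"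
      by (rule module_basis_coordinates[OF mod[of n] B[of n]], rule that)
    show ?thesis
      unfolding Q_def
      by (intro exI[of _ \<kappa>] conjI ballI \<kappa>(1)[simplified] \<kappa>(2)[simplified] \<kappa>(3)[simplified] \<kappa>(4)[simplified])
  qed
  then obtain \<kappa>' where \<kappa>': "Q n (\<kappa>' n)" for n by metis
  have \<kappa>'_fin: "\<kappa>' n x \<in> finsupp R (B n)"
    and \<kappa>'_sum: "x = lincomb R (?A n) (\<lambda>b. b) (\<kappa>' n x)" if "x \<in> component A n" for n x
    using \<kappa>'[of n] that unfolding Q_def by blast+
  have \<kappa>'_add: "\<kappa>' n (x \<oplus>\<^bsub>A\<^esub> y) = (\<lambda>b. \<kappa>' n x b \<oplus>\<^bsub>R\<^esub> \<kappa>' n y b)"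
    if "x \<in> component A n" "y \<in> component A n" for n x y
    using \<kappa>'[of n] that unfolding Q_def by blast
  have \<kappa>'_smult: "\<kappa>' n (r \<odot>\<^bsub>A\<^esub> x) = (\<lambda>b. r \<otimes>\<^bsub>R\<^esub> \<kappa>' n x b)"
    if "r \<in> carrier R" "x \<in> component A n" for n r x
    using \<kappa>'[of n] that unfolding Q_def by blast
  have BA: "b \<in> B n \<Longrightarrow> b \<in> component A n" for b n
    using B[of n] by (auto simp: module_basis_def)
  define K where "K = Sigma UNIV B"
  have KA: "k \<in> K \<Longrightarrow> snd k \<in> carrier A" for k
    using component_closed[OF BA] by (auto simp: K_def)
  define \<kappa> where "\<kappa> x k = \<kappa>' (fst k) (part x (fst k)) (snd k)" for x k
  have \<kappa>'_zero: "\<kappa>' n \<zero>\<^bsub>A\<^esub> = (\<lambda>b. \<zero>\<^bsub>R\<^esub>)" for n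
  proof -
    have "\<kappa>' n (\<zero>\<^bsub>R\<^esub> \<odot>\<^bsub>A\<^esub> \<zero>\<^bsub>A\<^esub>) = (\<lambda>b. \<zero>\<^bsub>R\<^esub> \<otimes>\<^bsub>R\<^esub> \<kappa>' n \<zero>\<^bsub>A\<^esub> b)"
      by (rule \<kappa>'_smult) (auto simp: component_zero)
    then show ?thesis using R.finsupp_closed[OF \<kappa>'_fin[OF component_zero]] by simp
  qed
  have \<kappa>_add: "\<kappa> (x \<oplus>\<^bsub>A\<^esub> y) = (\<lambda>k. \<kappa> x k \<oplus>\<^bsub>R\<^esub> \<kappa> y k)" if "x \<in> carrier A" "y \<in> carrier A" for x y
    using that by (simp add: \<kappa>_def[abs_def] part_add \<kappa>'_add part_component)
  have \<kappa>_smult: "\<kappa> (r \<odot>\<^bsub>A\<^esub> x) = (\<lambda>k. r \<otimes>\<^bsub>R\<^esub> \<kappa> x k)" if "r \<in> carrier R" "x \<in> carrier A" for r x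
    using that by (simp add: \<kappa>_def[abs_def] part_smult \<kappa>'_smult part_component)
  have \<kappa>_zero: "\<kappa> \<zero>\<^bsub>A\<^esub> = (\<lambda>k. \<zero>\<^bsub>R\<^esub>)"
    using part_homogeneous[OF component_zero[of 0]] by (simp add: \<kappa>_def[abs_def] \<kappa>'_zero)
  have inj_finsupp: "(\<lambda>k. if fst k = n then c (snd k) else \<zero>\<^bsub>R\<^esub>) \<in> finsupp R K"
    if c: "c \<in> finsupp R (B n)" for n c
  proof -
    have "{k. (if fst k = n then c (snd k) else \<zero>\<^bsub>R\<^esub>) \<noteq> \<zero>\<^bsub>R\<^esub>} \<subseteq> {n} \<times> {b. c b \<noteq> \<zero>\<^bsub>R\<^esub>}" by auto
    then have "finite {k. (if fst k = n then c (snd k) else \<zero>\<^bsub>R\<^esub>) \<noteq> \<zero>\<^bsub>R\<^esub>}"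
      using finsupp_finite[OF c] finite_subset by blast
    then show ?thesis using c R.finsupp_closed[OF c] by (auto simp: finsupp_def K_def)
  qed
  \<comment> \<open>The two sums live in records with different carriers, on which finite sums
    depend; induction on the support compares them term by term.\<close>
  have inj_sum: "lincomb R A snd (\<lambda>k. if fst k = n then c (snd k) else \<zero>\<^bsub>R\<^esub>) = lincomb R (?A n) (\<lambda>b. b) c"
    if "c \<in> finsupp R (B n)" for n c
    using that
  proof (induction c rule: R.finsupp_induct)
    case zero
    interpret An: module R "?A n" by (rule mod)
    show ?case using An.lincomb_zero by simp
  next
    case (add r b g)
    interpret An: module R "?A n" by (rule mod)
    have s: "single R b \<in> finsupp R (B n)" "single R (n, b) \<in> finsupp R K"
      using add by (auto simp: K_def intro!: R.single_finsupp)
    have v: "x \<in> B n \<Longrightarrow> x \<in> carrier (?A n)" for x using BA by simp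
    have "(\<lambda>k. if fst k = n then r \<otimes>\<^bsub>R\<^esub> single R b (snd k) \<oplus>\<^bsub>R\<^esub> g (snd k) else \<zero>\<^bsub>R\<^esub>) =
       (\<lambda>k. r \<otimes>\<^bsub>R\<^esub> single R (n, b) k \<oplus>\<^bsub>R\<^esub> (if fst k = n then g (snd k) else \<zero>\<^bsub>R\<^esub>))"
      using add(1) by (auto simp: single_def fun_eq_iff)
    then have "lincomb R A snd (\<lambda>k. if fst k = n then r \<otimes>\<^bsub>R\<^esub> single R b (snd k) \<oplus>\<^bsub>R\<^esub> g (snd k) else \<zero>\<^bsub>R\<^esub>)
      = r \<odot>\<^bsub>A\<^esub> b \<oplus>\<^bsub>A\<^esub> lincomb R (?A n) (\<lambda>b. b) g"
      using lincomb_add[OF R.finsupp_smult[OF add(1) s(2)] inj_finsupp[OF add(3)] KA]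
        lincomb_smult[OF add(1) s(2) KA] lincomb_single[of snd "(n, b)"] component_closed[OF BA[OF add(2)]] add(4)
      by simp
    also have "\<dots> = lincomb R (?A n) (\<lambda>b. b) (\<lambda>y. r \<otimes>\<^bsub>R\<^esub> single R b y \<oplus>\<^bsub>R\<^esub> g y)"
      using An.lincomb_add[OF R.finsupp_smult[OF add(1) s(1)] add(3), of "\<lambda>b. b", OF v]
        An.lincomb_smult[OF add(1) s(1), of "\<lambda>b. b", OF v] An.lincomb_single[of "\<lambda>b. b" b] BA[OF add(2)]
      by simp
    finally show ?case .
  qed
  have hom: "\<kappa> y \<in> finsupp R K \<and> y = lincomb R A snd (\<kappa> y)" if y: "y \<in> component A n" for y n
  proof -
    have "\<kappa> y = (\<lambda>k. if fst k = n then \<kappa>' n y (snd k) else \<zero>\<^bsub>R\<^esub>)"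
      by (auto simp: \<kappa>_def fun_eq_iff part_homogeneous[OF y] \<kappa>'_zero)
    then show ?thesis using inj_finsupp[OF \<kappa>'_fin[OF y]] inj_sum[OF \<kappa>'_fin[OF y]] \<kappa>'_sum[OF y] by simp
  qed
  have \<kappa>: "\<kappa> x \<in> finsupp R K \<and> x = lincomb R A snd (\<kappa> x)" if x: "x \<in> carrier A" for x
    using x
  proof (induction rule: homogeneous_induct)
    case zero
    show ?case using R.finsupp_zero by (simp add: \<kappa>_zero)
  next
    case (add n y)
    note p = hom[OF part_component[OF x, of n]]
    have "lincomb R A snd (\<kappa> (part x n \<oplus>\<^bsub>A\<^esub> y)) = lincomb R A snd (\<kappa> (part x n)) \<oplus>\<^bsub>A\<^esub> lincomb R A snd (\<kappa> y)"
      unfolding \<kappa>_add[OF part_closed[OF x] add(1)]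
      by (rule lincomb_add) (use p add KA in auto)
    then have "lincomb R A snd (\<kappa> (part x n \<oplus>\<^bsub>A\<^esub> y)) = part x n \<oplus>\<^bsub>A\<^esub> y"
      using conjunct2[OF p, symmetric] conjunct2[OF add(2), symmetric] by simp
    then show ?case
      using R.finsupp_add[OF conjunct1[OF p] conjunct1[OF add(2)]] \<kappa>_add[OF part_closed[OF x] add(1)]
      by simp
  qed
  show thesis using that[OF KA _ _ \<kappa>_add \<kappa>_smult] \<kappa> by blast
qed

end


section \<open>The complex \<open>P \<otimes> R/I\<close>\<close>

lemma (in cring) push_forward_add:
  assumes f: "f \<in> finsupp R U" and g: "g \<in> finsupp R U"
  shows "push_forward R \<phi> (\<lambda>x. f x \<oplus> g x) = (\<lambda>y. push_forward R \<phi> f y \<oplus> push_forward R \<phi> g y)"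
proof
  fix y
  let ?A = "{x. f x \<noteq> \<zero>} \<union> {x. g x \<noteq> \<zero>}"
  have A: "finite ?A" using finsupp_finite[OF f] finsupp_finite[OF g] by simp
  note c = finsupp_closed[OF f] finsupp_closed[OF g]
  \<comment> \<open>Points of \<open>?A\<close> outside the support of \<open>h\<close> contribute
    zero, so \<open>f\<close>, \<open>g\<close> and their sum can all be summed over the same fibre
    even if terms cancel.\<close>
  have *: "push_forward R \<phi> h y = (\<Oplus>x\<in>{x \<in> ?A. \<phi> x = y}. h x)"
    if "{x. h x \<noteq> \<zero>} \<subseteq> ?A" "\<And>x. h x \<in> carrier R" for h
    unfolding push_forward_def
  proof (rule add.finprod_mono_neutral_cong_left)
    show "finite {x \<in> ?A. \<phi> x = y}" by (rule finite_subset[OF _ A]) auto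
  qed (use that in auto)
  have "(\<Oplus>x\<in>{x \<in> ?A. \<phi> x = y}. f x \<oplus> g x) =
      (\<Oplus>x\<in>{x \<in> ?A. \<phi> x = y}. f x) \<oplus> (\<Oplus>x\<in>{x \<in> ?A. \<phi> x = y}. g x)"
    by (rule finsum_addf) (use c in auto)
  moreover have "push_forward R \<phi> (\<lambda>x. f x \<oplus> g x) y = (\<Oplus>x\<in>{x \<in> ?A. \<phi> x = y}. f x \<oplus> g x)"
    by (rule *) (use c in auto)
  moreover have "push_forward R \<phi> f y = (\<Oplus>x\<in>{x \<in> ?A. \<phi> x = y}. f x)"
    "push_forward R \<phi> g y = (\<Oplus>x\<in>{x \<in> ?A. \<phi> x = y}. g x)"
    by (rule *; use c in auto)+
  ultimately show "push_forward R \<phi> (\<lambda>x. f x \<oplus> g x) y = push_forward R \<phi> f y \<oplus> push_forward R \<phi> g y"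
    by simp
qed

lemma (in cring) push_forward_single:
  assumes r: "r \<in> carrier R"
  shows "push_forward R \<phi> (\<lambda>x. r \<otimes> single R m x) = (\<lambda>y. r \<otimes> single R (\<phi> m) y)"
proof
  fix y
  have "push_forward R \<phi> (\<lambda>x. r \<otimes> single R m x) y = (\<Oplus>x\<in>{x \<in> {m}. \<phi> x = y}. r \<otimes> single R m x)"
    unfolding push_forward_def
    by (rule add.finprod_mono_neutral_cong_left) (use r in \<open>auto simp: single_def\<close>)
  also have "\<dots> = r \<otimes> single R (\<phi> m) y"
  proof (cases "\<phi> m = y")
    case True
    then have eq: "{x \<in> {m}. \<phi> x = y} = {m}" by auto
    show ?thesis unfolding eq using r True by (simp add: single_def)
  next
    case False
    then have eq: "{x \<in> {m}. \<phi> x = y} = {}" by auto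
    show ?thesis unfolding eq using r False by (simp add: single_def)
  qed
  finally show "push_forward R \<phi> (\<lambda>x. r \<otimes> single R m x) y = r \<otimes> single R (\<phi> m) y" .
qed

lemma (in cring) push_forward_zero: "push_forward R \<phi> (\<lambda>x. \<zero>) = (\<lambda>y. \<zero>)"
  by (simp add: push_forward_def)

context dg_algebra_resolution
begin

abbreviation "S \<equiv> R Quot I"
abbreviation "\<rho> \<equiv> \<lambda>r. I +>\<^bsub>R\<^esub> r"
abbreviation "F \<equiv> monoid_algebra R (P \<times>\<times> S)"
abbreviation "J \<equiv> base_change_ideal R S \<rho> P"
abbreviation "q f \<equiv> J +>\<^bsub>F\<^esub> f"
abbreviation "C \<equiv> Tor_complex R I P"
abbreviation "\<tau> p \<equiv> pure_tensor R S \<rho> P p \<one>\<^bsub>S\<^esub>"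
abbreviation "\<delta> \<equiv> differential P"

lemma cring_S: "cring S" by (rule quotient_is_cring[OF R.cring_axioms])

sublocale S: cring S by (rule cring_S)

lemma \<rho>_hom: "\<rho> \<in> ring_hom R S"
  using rcos_ring_hom by simp

lemmas \<rho>_ops = ring_hom_closed[OF \<rho>_hom] ring_hom_add[OF \<rho>_hom] ring_hom_mult[OF \<rho>_hom]
  ring_hom_one[OF \<rho>_hom]

lemma \<rho>_I: "a \<in> I \<Longrightarrow> \<rho> a = \<zero>\<^bsub>S\<^esub>"
  using quot_eq_I[OF Icarr] quot_ops(5) by simp


lemma differential_closed: "x \<in> carrier P \<Longrightarrow> \<delta> x \<in> carrier P"
proof -
  have hom: "\<delta> y \<in> carrier P" if "y \<in> component P n" for y n
    using that differential_0[of y] component_closed[OF differential_Suc[of y]] by (cases n) auto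
  assume x: "x \<in> carrier P"
  then show ?thesis
  proof (induction x rule: homogeneous_induct)
    case zero
    then show ?case using hom[OF component_zero] .
  next
    case (add n y)
    then show ?case
      using hom[OF part_component[OF x]] by (simp add: differential_add part_closed[OF x])
  qed
qed

text \<open>The products of scalars in I with elements of P are added one at a time, so that rule
  induction is available for additive maps known on the terms a p.\<close>

inductive_set IP where
  zero: "\<zero>\<^bsub>P\<^esub> \<in> IP"
| add: "\<lbrakk>a \<in> I; p \<in> carrier P; u \<in> IP\<rbrakk> \<Longrightarrow> a \<odot>\<^bsub>P\<^esub> p \<oplus>\<^bsub>P\<^esub> u \<in> IP"

lemma IP_closed: "u \<in> IP \<Longrightarrow> u \<in> carrier P"
  by (induction u rule: IP.induct) (auto simp: Icarr)

lemma IP_generator: "\<lbrakk>a \<in> I; p \<in> carrier P\<rbrakk> \<Longrightarrow> a \<odot>\<^bsub>P\<^esub> p \<in> IP"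
  using IP.add[OF _ _ IP.zero, of a p] by (simp add: Icarr)

lemma IP_plus: "\<lbrakk>u \<in> IP; v \<in> IP\<rbrakk> \<Longrightarrow> u \<oplus>\<^bsub>P\<^esub> v \<in> IP"
proof (induction u rule: IP.induct)
  case zero
  then show ?case using IP_closed by simp
next
  case (add a p u)
  then show ?case using IP.add[of a p "u \<oplus>\<^bsub>P\<^esub> v"] by (simp add: M.add.m_assoc Icarr IP_closed)
qed

text \<open>One argument for all R-linear endomorphisms of P: scalars, multiplication on either
  side, the differential, and the projection to a homogeneous part.\<close>

lemma IP_map:
  assumes f: "\<And>x. x \<in> carrier P \<Longrightarrow> f x \<in> carrier P"
    and f_add: "\<And>x y. \<lbrakk>x \<in> carrier P; y \<in> carrier P\<rbrakk> \<Longrightarrow> f (x \<oplus>\<^bsub>P\<^esub> y) = f x \<oplus>\<^bsub>P\<^esub> f y"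
    and f_smult: "\<And>r x. \<lbrakk>r \<in> carrier R; x \<in> carrier P\<rbrakk> \<Longrightarrow> f (r \<odot>\<^bsub>P\<^esub> x) = r \<odot>\<^bsub>P\<^esub> f x"
    and u: "u \<in> IP"
  shows "f u \<in> IP"
  using u
proof (induction u rule: IP.induct)
  case zero
  have "f \<zero>\<^bsub>P\<^esub> = \<zero>\<^bsub>P\<^esub>" using f_smult[of "\<zero>\<^bsub>R\<^esub>" "\<zero>\<^bsub>P\<^esub>"] f[of "\<zero>\<^bsub>P\<^esub>"] by simp
  then show ?case using IP.zero by simp
next
  case (add a p u)
  then show ?case using IP.add[OF add(1) f[OF add(2)] add(4)] by (simp add: f_add f_smult Icarr IP_closed)
qed

lemma IP_smult: "\<lbrakk>r \<in> carrier R; u \<in> IP\<rbrakk> \<Longrightarrow> r \<odot>\<^bsub>P\<^esub> u \<in> IP"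
  by (rule IP_map[of "\<lambda>x. r \<odot>\<^bsub>P\<^esub> x"])
    (auto simp: smult_r_distr smult_assoc1[symmetric] R.m_comm)

lemma IP_mult_left: "\<lbrakk>x \<in> carrier P; u \<in> IP\<rbrakk> \<Longrightarrow> x \<otimes>\<^bsub>P\<^esub> u \<in> IP"
  by (rule IP_map[of "\<lambda>y. x \<otimes>\<^bsub>P\<^esub> y"]) (auto simp: A.r_distr smult_mult_right)

lemma IP_mult_right: "\<lbrakk>x \<in> carrier P; u \<in> IP\<rbrakk> \<Longrightarrow> u \<otimes>\<^bsub>P\<^esub> x \<in> IP"
  by (rule IP_map[of "\<lambda>y. y \<otimes>\<^bsub>P\<^esub> x"]) (auto simp: A.l_distr smult_mult_left)

lemma IP_differential: "u \<in> IP \<Longrightarrow> \<delta> u \<in> IP"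
  by (rule IP_map[of "\<delta>"]) (auto simp: differential_closed differential_add differential_smult)

lemma IP_part: "u \<in> IP \<Longrightarrow> part u n \<in> IP"
  by (rule IP_map[of "\<lambda>x. part x n"]) (auto simp: part_closed part_add part_smult)

lemma IP_uminus: "u \<in> IP \<Longrightarrow> \<ominus>\<^bsub>P\<^esub> u \<in> IP"
  using IP_smult[of "\<ominus>\<^bsub>R\<^esub> \<one>\<^bsub>R\<^esub>" u] IP_closed[of u] by (simp add: smult_l_minus)

lemma ideal_IP: "ideal IP P"
proof (rule idealI[OF A.ring_axioms])
  show "subgroup IP (add_monoid P)"
    using IP.zero IP_uminus IP_plus IP_closed
    by (intro M.add.subgroupI) auto
qed (use IP_mult_left IP_mult_right in auto)

sublocale IP: ideal IP P by (rule ideal_IP)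

abbreviation "\<pi> x \<equiv> IP +>\<^bsub>P\<^esub> x"

lemma \<pi>_add_cong:
  assumes "\<pi> x = \<pi> x'" "\<pi> y = \<pi> y'"
    and "x \<in> carrier P" "x' \<in> carrier P" "y \<in> carrier P" "y' \<in> carrier P"
  shows "\<pi> (x \<oplus>\<^bsub>P\<^esub> y) = \<pi> (x' \<oplus>\<^bsub>P\<^esub> y')"
  using assms by (simp flip: IP.quot_ops(1))

lemma \<pi>_smult_cong:
  assumes "\<pi> x = \<pi> y" "r \<in> carrier R" "x \<in> carrier P" "y \<in> carrier P"
  shows "\<pi> (r \<odot>\<^bsub>P\<^esub> x) = \<pi> (r \<odot>\<^bsub>P\<^esub> y)"
  using assms IP_smult[of r "x \<ominus>\<^bsub>P\<^esub> y"] by (simp add: IP.quot_eq smult_minus)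

text \<open>This makes the choice of representatives in \<open>rep\<close> harmless modulo
  \<open>IP\<close>.\<close>

lemma \<pi>_scalar_cong:
  assumes "\<rho> r = \<rho> r'" "r \<in> carrier R" "r' \<in> carrier R" "x \<in> carrier P"
  shows "\<pi> (r \<odot>\<^bsub>P\<^esub> x) = \<pi> (r' \<odot>\<^bsub>P\<^esub> x)"
proof -
  have "(r \<ominus>\<^bsub>R\<^esub> r') \<odot>\<^bsub>P\<^esub> x \<in> IP" using assms quot_eq by (intro IP_generator) auto
  moreover have "(r \<ominus>\<^bsub>R\<^esub> r') \<odot>\<^bsub>P\<^esub> x = r \<odot>\<^bsub>P\<^esub> x \<ominus>\<^bsub>P\<^esub> r' \<odot>\<^bsub>P\<^esub> x"
    using assms by (simp add: a_minus_def smult_l_distr smult_l_minus)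
  ultimately show ?thesis using assms by (simp add: IP.quot_eq)
qed

lemma \<pi>_zero: "x \<in> carrier P \<Longrightarrow> \<pi> x = \<pi> \<zero>\<^bsub>P\<^esub> \<longleftrightarrow> x \<in> IP"
  by (simp add: IP.quot_eq a_minus_def)

section \<open>Identification of the tensor product of \<open>P\<close> and \<open>S\<close> with
  \<open>P\<close> modulo \<open>IP\<close>\<close>

definition rep where "rep s = (SOME r. r \<in> carrier R \<and> \<rho> r = s)"

lemma rep:
  assumes "s \<in> carrier S"
  shows rep_closed: "rep s \<in> carrier R" and \<rho>_rep: "\<rho> (rep s) = s"
proof -
  have "\<exists>r. r \<in> carrier R \<and> \<rho> r = s" using assms quot_carrier by auto
  from someI_ex[OF this] show "rep s \<in> carrier R" "\<rho> (rep s) = s" by (auto simp: rep_def)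
qed

sublocale F: cring_monoid R "P \<times>\<times> S"
  by (intro cring_monoid.intro R.cring_axioms DirProd_monoid A.monoid_axioms S.monoid_axioms)

lemma PS_simps [simp]:
  "carrier (P \<times>\<times> S) = carrier P \<times> carrier S"
  "(p, s) \<otimes>\<^bsub>P \<times>\<times> S\<^esub> (p', s') = (p \<otimes>\<^bsub>P\<^esub> p', s \<otimes>\<^bsub>S\<^esub> s')"
  "\<one>\<^bsub>P \<times>\<times> S\<^esub> = (\<one>\<^bsub>P\<^esub>, \<one>\<^bsub>S\<^esub>)"
  by (simp_all add: DirProd_def)

lemma single_PS: "\<lbrakk>p \<in> carrier P; s \<in> carrier S\<rbrakk> \<Longrightarrow> single R (p, s) \<in> carrier F"
  by (simp add: F.single_closed)

text \<open>The map \<open>\<Sum> r [p, s] \<mapsto> \<Sum> r s p\<close>, well defined modulo \<open>IP\<close>; \<open>base_change_ideal\<close> is the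
  preimage of \<open>IP\<close>.\<close>

definition lam where "lam = lincomb R P (\<lambda>z. rep (snd z) \<odot>\<^bsub>P\<^esub> fst z)"

lemma lam_arg: "z \<in> carrier (P \<times>\<times> S) \<Longrightarrow> rep (snd z) \<odot>\<^bsub>P\<^esub> fst z \<in> carrier P"
  by (auto simp: rep_closed)

lemma lam_closed: "f \<in> carrier F \<Longrightarrow> lam f \<in> carrier P"
  unfolding lam_def monoid_algebra_simps by (rule lincomb_closed[OF _ lam_arg])

lemma lam_add: "\<lbrakk>f \<in> carrier F; g \<in> carrier F\<rbrakk> \<Longrightarrow> lam (f \<oplus>\<^bsub>F\<^esub> g) = lam f \<oplus>\<^bsub>P\<^esub> lam g"
  unfolding lam_def monoid_algebra_simps by (rule lincomb_add[OF _ _ lam_arg])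

lemma lam_smult: "\<lbrakk>r \<in> carrier R; f \<in> carrier F\<rbrakk> \<Longrightarrow> lam (r \<odot>\<^bsub>F\<^esub> f) = r \<odot>\<^bsub>P\<^esub> lam f"
  unfolding lam_def monoid_algebra_simps by (rule lincomb_smult[OF _ _ lam_arg])

lemma lam_zero: "lam \<zero>\<^bsub>F\<^esub> = \<zero>\<^bsub>P\<^esub>"
  by (simp add: lam_def monoid_algebra_simps)

lemma lam_single: "\<lbrakk>p \<in> carrier P; s \<in> carrier S\<rbrakk> \<Longrightarrow> lam (single R (p, s)) = rep s \<odot>\<^bsub>P\<^esub> p"
  unfolding lam_def by (subst lincomb_single) (auto simp: rep_closed)

lemma lam_uminus: "f \<in> carrier F \<Longrightarrow> lam (\<ominus>\<^bsub>F\<^esub> f) = \<ominus>\<^bsub>P\<^esub> lam f"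
  using lam_smult[of "\<ominus>\<^bsub>R\<^esub> \<one>\<^bsub>R\<^esub>" f] lam_closed[of f]
  by (simp add: smult_l_minus F.FM.smult_l_minus)

lemma lam_minus: "\<lbrakk>f \<in> carrier F; g \<in> carrier F\<rbrakk> \<Longrightarrow> lam (f \<ominus>\<^bsub>F\<^esub> g) = lam f \<ominus>\<^bsub>P\<^esub> lam g"
  by (simp add: a_minus_def lam_add lam_uminus)

lemma lam_mult_single:
  assumes "p \<in> carrier P" "s \<in> carrier S" "p' \<in> carrier P" "s' \<in> carrier S"
  shows "\<pi> (lam (single R (p, s) \<otimes>\<^bsub>F\<^esub> single R (p', s'))) =
    \<pi> (lam (single R (p, s)) \<otimes>\<^bsub>P\<^esub> lam (single R (p', s')))"
proof -
  have "\<rho> (rep (s \<otimes>\<^bsub>S\<^esub> s')) = \<rho> (rep s \<otimes>\<^bsub>R\<^esub> rep s')"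
    using assms by (simp add: \<rho>_rep \<rho>_ops(3) rep_closed)
  then have "\<pi> (rep (s \<otimes>\<^bsub>S\<^esub> s') \<odot>\<^bsub>P\<^esub> (p \<otimes>\<^bsub>P\<^esub> p')) = \<pi> ((rep s \<otimes>\<^bsub>R\<^esub> rep s') \<odot>\<^bsub>P\<^esub> (p \<otimes>\<^bsub>P\<^esub> p'))"
    using assms by (intro \<pi>_scalar_cong) (auto simp: rep_closed)
  then show ?thesis
    using assms
    by (simp add: F.single_mult lam_single rep_closed smult_mult_left smult_mult_right
        smult_assoc1[symmetric] R.m_comm)
qed

text \<open>Only a congruence, because \<open>rep\<close> chooses representatives without regard to
  products. Modulo \<open>IP\<close> both sides are bilinear, which leaves the case of two basis
  elements.\<close>

lemma lam_mult:
  assumes f: "f \<in> carrier F" and g: "g \<in> carrier F"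
  shows "\<pi> (lam (f \<otimes>\<^bsub>F\<^esub> g)) = \<pi> (lam f \<otimes>\<^bsub>P\<^esub> lam g)"
proof -
  have 1: "\<pi> (lam (single R u \<otimes>\<^bsub>F\<^esub> g)) = \<pi> (lam (single R u) \<otimes>\<^bsub>P\<^esub> lam g)"
    if u: "u \<in> carrier P \<times> carrier S" for u
    using g
  proof (induction g rule: F.F_induct)
    case zero
    have "lam (single R u) \<in> carrier P" using u by (intro lam_closed F.single_closed) simp
    then show ?case using u by (simp add: F.F_mult_zero F.single_closed lam_zero)
  next
    case (add r v g)
    have su: "single R u \<in> carrier F" and sv: "single R v \<in> carrier F"
      using u add(2) by (auto intro!: F.single_closed)
    have uv: "\<pi> (lam (single R u \<otimes>\<^bsub>F\<^esub> single R v)) = \<pi> (lam (single R u) \<otimes>\<^bsub>P\<^esub> lam (single R v))"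
      using u add(2) lam_mult_single by auto
    note cl = su sv add(1,3) lam_closed F.F_mult_closed
    have "\<pi> (lam (single R u \<otimes>\<^bsub>F\<^esub> (r \<odot>\<^bsub>F\<^esub> single R v \<oplus>\<^bsub>F\<^esub> g))) =
        \<pi> (r \<odot>\<^bsub>P\<^esub> lam (single R u \<otimes>\<^bsub>F\<^esub> single R v) \<oplus>\<^bsub>P\<^esub> lam (single R u \<otimes>\<^bsub>F\<^esub> g))"
      using cl by (simp add: F.F_mult_r_distr F.F_smult_mult_right lam_add lam_smult)
    also have "\<dots> = \<pi> (r \<odot>\<^bsub>P\<^esub> (lam (single R u) \<otimes>\<^bsub>P\<^esub> lam (single R v)) \<oplus>\<^bsub>P\<^esub> lam (single R u) \<otimes>\<^bsub>P\<^esub> lam g)"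
      by (intro \<pi>_add_cong \<pi>_smult_cong uv add(4)) (use cl in auto)
    also have "\<dots> = \<pi> (lam (single R u) \<otimes>\<^bsub>P\<^esub> lam (r \<odot>\<^bsub>F\<^esub> single R v \<oplus>\<^bsub>F\<^esub> g))"
      using cl by (simp add: lam_add lam_smult A.r_distr smult_mult_right)
    finally show ?case .
  qed
  show ?thesis
    using f
  proof (induction f rule: F.F_induct)
    case zero
    then show ?case using g by (simp add: F.F_zero_mult lam_zero lam_closed)
  next
    case (add r u f)
    have u: "u \<in> carrier P \<times> carrier S" using add(2) by simp
    have su: "single R u \<in> carrier F" using add(2) by (rule F.single_closed)
    note cl = su g add(1,3) lam_closed F.F_mult_closed
    have "\<pi> (lam ((r \<odot>\<^bsub>F\<^esub> single R u \<oplus>\<^bsub>F\<^esub> f) \<otimes>\<^bsub>F\<^esub> g)) =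
        \<pi> (r \<odot>\<^bsub>P\<^esub> lam (single R u \<otimes>\<^bsub>F\<^esub> g) \<oplus>\<^bsub>P\<^esub> lam (f \<otimes>\<^bsub>F\<^esub> g))"
      using cl by (simp add: F.F_mult_l_distr F.F_smult_mult_left lam_add lam_smult)
    also have "\<dots> = \<pi> (r \<odot>\<^bsub>P\<^esub> (lam (single R u) \<otimes>\<^bsub>P\<^esub> lam g) \<oplus>\<^bsub>P\<^esub> lam f \<otimes>\<^bsub>P\<^esub> lam g)"
      by (intro \<pi>_add_cong \<pi>_smult_cong 1[OF u] add(4)) (use cl in auto)
    also have "\<dots> = \<pi> (lam (r \<odot>\<^bsub>F\<^esub> single R u \<oplus>\<^bsub>F\<^esub> f) \<otimes>\<^bsub>P\<^esub> lam g)"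
      using cl by (simp add: lam_add lam_smult A.l_distr smult_mult_left)
    finally show ?case .
  qed
qed

text \<open>Once this ideal is seen to contain the relators, it contains \<open>J\<close>. That is
  the harder half of the identification: passing to the tensor product kills nothing of
  \<open>P\<close> outside \<open>IP\<close>.\<close>

lemma lam_kernel_ideal: "ideal {f \<in> carrier F. lam f \<in> IP} F"
proof (rule idealI[OF F.FA.A.ring_axioms])
  show "subgroup {f \<in> carrier F. lam f \<in> IP} (add_monoid F)"
  proof (rule F.FM.M.add.subgroupI)
    show "{f \<in> carrier F. lam f \<in> IP} \<noteq> {}"
      using lam_zero IP.zero F.FM.M.zero_closed by auto
    fix f assume "f \<in> {f \<in> carrier F. lam f \<in> IP}"
    then show "\<ominus>\<^bsub>F\<^esub> f \<in> {f \<in> carrier F. lam f \<in> IP}"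
      using IP_uminus lam_uminus[of f] F.FM.M.a_inv_closed[of f] by simp
  qed (auto simp: lam_add IP_plus)
  fix f g assume f: "f \<in> {f \<in> carrier F. lam f \<in> IP}" and g: "g \<in> carrier F"
  then have "\<pi> (lam (f \<otimes>\<^bsub>F\<^esub> g)) = \<pi> (lam f \<otimes>\<^bsub>P\<^esub> lam g)" "\<pi> (lam (g \<otimes>\<^bsub>F\<^esub> f)) = \<pi> (lam g \<otimes>\<^bsub>P\<^esub> lam f)"
    using lam_mult by auto
  moreover have "lam f \<otimes>\<^bsub>P\<^esub> lam g \<in> IP" "lam g \<otimes>\<^bsub>P\<^esub> lam f \<in> IP"
    using f g IP_mult_left IP_mult_right lam_closed by auto
  ultimately have "\<pi> (lam (f \<otimes>\<^bsub>F\<^esub> g)) = \<pi> \<zero>\<^bsub>P\<^esub>" "\<pi> (lam (g \<otimes>\<^bsub>F\<^esub> f)) = \<pi> \<zero>\<^bsub>P\<^esub>"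
    using \<pi>_zero IP_closed by auto
  then show "f \<otimes>\<^bsub>F\<^esub> g \<in> {f \<in> carrier F. lam f \<in> IP}" "g \<otimes>\<^bsub>F\<^esub> f \<in> {f \<in> carrier F. lam f \<in> IP}"
    using f g lam_closed F.F_mult_closed by (auto simp: \<pi>_zero)
qed

definition relators where
  "relators =
      {single R (p \<oplus>\<^bsub>P\<^esub> q, s) \<ominus>\<^bsub>F\<^esub> (single R (p, s) \<oplus>\<^bsub>F\<^esub> single R (q, s)) | p q s.
          p \<in> carrier P \<and> q \<in> carrier P \<and> s \<in> carrier S} \<union>
       {single R (p, s \<oplus>\<^bsub>S\<^esub> t) \<ominus>\<^bsub>F\<^esub> (single R (p, s) \<oplus>\<^bsub>F\<^esub> single R (p, t)) | p s t.
          p \<in> carrier P \<and> s \<in> carrier S \<and> t \<in> carrier S} \<union>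
       {single R (r \<odot>\<^bsub>P\<^esub> p, s) \<ominus>\<^bsub>F\<^esub> r \<odot>\<^bsub>F\<^esub> single R (p, s) | r p s.
          r \<in> carrier R \<and> p \<in> carrier P \<and> s \<in> carrier S} \<union>
       {single R (p, \<rho> r \<otimes>\<^bsub>S\<^esub> s) \<ominus>\<^bsub>F\<^esub> r \<odot>\<^bsub>F\<^esub> single R (p, s) | r p s.
          r \<in> carrier R \<and> p \<in> carrier P \<and> s \<in> carrier S}"

lemma J_eq: "J = Idl\<^bsub>F\<^esub> relators"
  by (simp add: base_change_ideal_def relators_def Let_def)

lemma relators_lam: "relators \<subseteq> {f \<in> carrier F. lam f \<in> IP}"
proof -
  have *: "x \<ominus>\<^bsub>F\<^esub> y \<in> {f \<in> carrier F. lam f \<in> IP}"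
    if "x \<in> carrier F" "y \<in> carrier F" "\<pi> (lam x) = \<pi> (lam y)" for x y
    using that by (simp add: lam_minus lam_closed IP.quot_eq)
  have 2: "\<pi> (rep (s \<oplus>\<^bsub>S\<^esub> t) \<odot>\<^bsub>P\<^esub> p) = \<pi> (rep s \<odot>\<^bsub>P\<^esub> p \<oplus>\<^bsub>P\<^esub> rep t \<odot>\<^bsub>P\<^esub> p)"
    if "p \<in> carrier P" "s \<in> carrier S" "t \<in> carrier S" for p s t
    using \<pi>_scalar_cong[of "rep (s \<oplus>\<^bsub>S\<^esub> t)" "rep s \<oplus>\<^bsub>R\<^esub> rep t" p] that
    by (simp add: \<rho>_rep \<rho>_ops(2) rep_closed smult_l_distr)
  have 4: "\<pi> (rep (\<rho> r \<otimes>\<^bsub>S\<^esub> s) \<odot>\<^bsub>P\<^esub> p) = \<pi> (r \<odot>\<^bsub>P\<^esub> (rep s \<odot>\<^bsub>P\<^esub> p))"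
    if "r \<in> carrier R" "p \<in> carrier P" "s \<in> carrier S" for p s r
    using \<pi>_scalar_cong[of "rep (\<rho> r \<otimes>\<^bsub>S\<^esub> s)" "r \<otimes>\<^bsub>R\<^esub> rep s" p] that
    by (simp add: \<rho>_rep \<rho>_ops(1,3) rep_closed smult_assoc1)
  have 3: "rep s \<odot>\<^bsub>P\<^esub> (r \<odot>\<^bsub>P\<^esub> p) = r \<odot>\<^bsub>P\<^esub> (rep s \<odot>\<^bsub>P\<^esub> p)"
    if "r \<in> carrier R" "p \<in> carrier P" "s \<in> carrier S" for p s r
    using that by (simp add: smult_assoc1[symmetric] rep_closed R.m_comm)
  show ?thesis
    unfolding relators_def Un_subset_iff
    by (intro conjI subsetI; elim CollectE exE conjE; hypsubst; rule *)
      (simp_all add: lam_add lam_smult lam_single single_PS F.FM.smult_closed smult_r_distr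
        rep_closed 2 3 4 \<rho>_ops(1))
qed

lemma relators_closed: "relators \<subseteq> carrier F"
  using relators_lam by blast

lemma ideal_J: "ideal J F"
  unfolding J_eq by (rule F.FA.A.genideal_ideal[OF relators_closed])

sublocale J: ideal J F by (rule ideal_J)

lemma J_lam: "f \<in> J \<Longrightarrow> lam f \<in> IP"
  using F.FA.A.genideal_minimal[OF lam_kernel_ideal relators_lam] unfolding J_eq by blast

lemma relators_J: "relators \<subseteq> J"
  unfolding J_eq by (rule F.FA.A.genideal_self[OF relators_closed])

lemma q_single:
  assumes p: "p \<in> carrier P" and s: "s \<in> carrier S"
  shows q_single_add: "p' \<in> carrier P \<Longrightarrow>
      q (single R (p \<oplus>\<^bsub>P\<^esub> p', s)) = q (single R (p, s) \<oplus>\<^bsub>F\<^esub> single R (p', s))"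
    and q_single_smult: "r \<in> carrier R \<Longrightarrow>
      q (single R (r \<odot>\<^bsub>P\<^esub> p, s)) = q (r \<odot>\<^bsub>F\<^esub> single R (p, s))"
    and q_single_scalar: "r \<in> carrier R \<Longrightarrow>
      q (single R (p, \<rho> r \<otimes>\<^bsub>S\<^esub> s)) = q (r \<odot>\<^bsub>F\<^esub> single R (p, s))"
proof -
  have eq: "q x = q y" if "x \<ominus>\<^bsub>F\<^esub> y \<in> relators" "x \<in> carrier F" "y \<in> carrier F" for x y
    using that relators_J J.quot_eq by blast
  show "q (single R (p \<oplus>\<^bsub>P\<^esub> p', s)) = q (single R (p, s) \<oplus>\<^bsub>F\<^esub> single R (p', s))"
    if "p' \<in> carrier P"
  proof (rule eq)
    show "single R (p \<oplus>\<^bsub>P\<^esub> p', s) \<ominus>\<^bsub>F\<^esub> (single R (p, s) \<oplus>\<^bsub>F\<^esub> single R (p', s)) \<in> relators"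
      unfolding relators_def using p s that by blast
  qed (use p s that in \<open>auto intro!: single_PS F.FM.M.a_closed\<close>)
  assume r: "r \<in> carrier R"
  show "q (single R (r \<odot>\<^bsub>P\<^esub> p, s)) = q (r \<odot>\<^bsub>F\<^esub> single R (p, s))"
  proof (rule eq)
    show "single R (r \<odot>\<^bsub>P\<^esub> p, s) \<ominus>\<^bsub>F\<^esub> r \<odot>\<^bsub>F\<^esub> single R (p, s) \<in> relators"
      unfolding relators_def using p s r by blast
  qed (use p s r in \<open>auto intro!: single_PS F.FM.smult_closed\<close>)
  show "q (single R (p, \<rho> r \<otimes>\<^bsub>S\<^esub> s)) = q (r \<odot>\<^bsub>F\<^esub> single R (p, s))"
  proof (rule eq)
    show "single R (p, \<rho> r \<otimes>\<^bsub>S\<^esub> s) \<ominus>\<^bsub>F\<^esub> r \<odot>\<^bsub>F\<^esub> single R (p, s) \<in> relators"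
      unfolding relators_def using p s r by blast
  qed (use p s r \<rho>_ops(1) in \<open>auto intro!: single_PS F.FM.smult_closed\<close>)
qed

lemma q_smult_cong:
  assumes "q x = q y" "r \<in> carrier R" "x \<in> carrier F" "y \<in> carrier F"
  shows "q (r \<odot>\<^bsub>F\<^esub> x) = q (r \<odot>\<^bsub>F\<^esub> y)"
  using assms F.FA.ideal_smult[OF ideal_J, of r "x \<ominus>\<^bsub>F\<^esub> y"]
  by (simp add: J.quot_eq F.FA.smult_minus)

lemma \<tau>_eq: "\<tau> p = q (single R (p, \<one>\<^bsub>S\<^esub>))"
  by (simp add: pure_tensor_def)

lemma single_1: "p \<in> carrier P \<Longrightarrow> single R (p, \<one>\<^bsub>S\<^esub>) \<in> carrier F"
  by (simp add: single_PS)

lemma C_ops: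
  "carrier C = q ` carrier F"
  "\<zero>\<^bsub>C\<^esub> = J" "\<one>\<^bsub>C\<^esub> = \<tau> \<one>\<^bsub>P\<^esub>"
  "\<lbrakk>f \<in> carrier F; g \<in> carrier F\<rbrakk> \<Longrightarrow> q f \<oplus>\<^bsub>C\<^esub> q g = q (f \<oplus>\<^bsub>F\<^esub> g)"
  "\<lbrakk>f \<in> carrier F; g \<in> carrier F\<rbrakk> \<Longrightarrow> q f \<otimes>\<^bsub>C\<^esub> q g = q (f \<otimes>\<^bsub>F\<^esub> g)"
  using J.quot_ops
  by (simp_all add: Tor_complex_def base_change_def Let_def J.quot_carrier \<tau>_eq monoid_algebra_simps(2))

lemma q_zero: "q \<zero>\<^bsub>F\<^esub> = J"
  using J.quot_ops(4,5) by simp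

lemma \<tau>_add: "\<lbrakk>x \<in> carrier P; y \<in> carrier P\<rbrakk> \<Longrightarrow> \<tau> x \<oplus>\<^bsub>C\<^esub> \<tau> y = \<tau> (x \<oplus>\<^bsub>P\<^esub> y)"
  unfolding \<tau>_eq by (simp add: C_ops single_PS q_single_add)

lemma \<tau>_mult: "\<lbrakk>x \<in> carrier P; y \<in> carrier P\<rbrakk> \<Longrightarrow> \<tau> x \<otimes>\<^bsub>C\<^esub> \<tau> y = \<tau> (x \<otimes>\<^bsub>P\<^esub> y)"
  unfolding \<tau>_eq by (simp add: C_ops single_PS F.single_mult)

lemma \<tau>_zero: "\<tau> \<zero>\<^bsub>P\<^esub> = \<zero>\<^bsub>C\<^esub>"
proof -
  have "\<tau> \<zero>\<^bsub>P\<^esub> = q (\<zero>\<^bsub>R\<^esub> \<odot>\<^bsub>F\<^esub> single R (\<zero>\<^bsub>P\<^esub>, \<one>\<^bsub>S\<^esub>))"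
    unfolding \<tau>_eq using q_single_smult[of "\<zero>\<^bsub>P\<^esub>" "\<one>\<^bsub>S\<^esub>" "\<zero>\<^bsub>R\<^esub>"] by simp
  then show ?thesis by (simp add: single_PS C_ops q_zero)
qed

text \<open>The scalar is moved across the tensor sign, where it becomes the class of a in R/I,
  which is zero.\<close>

lemma \<tau>_generator: "\<lbrakk>a \<in> I; p \<in> carrier P\<rbrakk> \<Longrightarrow> \<tau> (a \<odot>\<^bsub>P\<^esub> p) = \<zero>\<^bsub>C\<^esub>"
proof -
  assume a: "a \<in> I" and p: "p \<in> carrier P"
  have "\<tau> (a \<odot>\<^bsub>P\<^esub> p) = q (single R (p, \<rho> a \<otimes>\<^bsub>S\<^esub> \<one>\<^bsub>S\<^esub>))"
    unfolding \<tau>_eq using a p by (simp add: q_single_smult q_single_scalar Icarr del: S.r_one)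
  also have "\<dots> = q (single R (p, \<rho> \<zero>\<^bsub>R\<^esub> \<otimes>\<^bsub>S\<^esub> \<one>\<^bsub>S\<^esub>))"
    using a \<rho>_I[of "\<zero>\<^bsub>R\<^esub>"] \<rho>_I[of a] by simp
  also have "\<dots> = q (\<zero>\<^bsub>R\<^esub> \<odot>\<^bsub>F\<^esub> single R (p, \<one>\<^bsub>S\<^esub>))"
    using p by (intro q_single_scalar) auto
  finally show ?thesis using p by (simp add: single_PS C_ops q_zero)
qed

lemma \<tau>_IP: "u \<in> IP \<Longrightarrow> \<tau> u = \<zero>\<^bsub>C\<^esub>"
proof (induction u rule: IP.induct)
  case zero
  show ?case by (rule \<tau>_zero)
next
  case (add a p u)
  then have "\<tau> (a \<odot>\<^bsub>P\<^esub> p \<oplus>\<^bsub>P\<^esub> u) = \<tau> \<zero>\<^bsub>P\<^esub> \<oplus>\<^bsub>C\<^esub> \<tau> \<zero>\<^bsub>P\<^esub>"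
    using \<tau>_add[of "a \<odot>\<^bsub>P\<^esub> p" u] \<tau>_generator \<tau>_zero by (simp add: Icarr IP_closed)
  then show ?case using \<tau>_add[of "\<zero>\<^bsub>P\<^esub>" "\<zero>\<^bsub>P\<^esub>"] \<tau>_zero by simp
qed

text \<open>A tensor of p and s equals that of r p and 1 for any representative r of s. Hence every
  element of the tensor product comes from \<open>P\<close>.\<close>

lemma q_lam: "f \<in> carrier F \<Longrightarrow> q f = \<tau> (lam f)"
proof (induction f rule: F.F_induct)
  case zero
  then show ?case using \<tau>_zero C_ops(2) by (simp add: q_zero lam_zero)
next
  case (add r z f)
  obtain p s where z: "z = (p, s)" "p \<in> carrier P" "s \<in> carrier S" using add(2) by auto
  have sc: "single R (p, s) \<in> carrier F" "single R (rep s \<odot>\<^bsub>P\<^esub> p, \<one>\<^bsub>S\<^esub>) \<in> carrier F"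
    "rep s \<odot>\<^bsub>P\<^esub> p \<in> carrier P"
    using z by (simp_all add: single_PS rep_closed)
  have "q (single R (p, \<rho> (rep s) \<otimes>\<^bsub>S\<^esub> \<one>\<^bsub>S\<^esub>)) = q (rep s \<odot>\<^bsub>F\<^esub> single R (p, \<one>\<^bsub>S\<^esub>))"
    using z by (intro q_single_scalar) (auto simp: rep_closed)
  also have "\<dots> = q (single R (rep s \<odot>\<^bsub>P\<^esub> p, \<one>\<^bsub>S\<^esub>))"
    using z by (simp add: q_single_smult rep_closed)
  finally have "q (single R (p, s)) = q (single R (rep s \<odot>\<^bsub>P\<^esub> p, \<one>\<^bsub>S\<^esub>))"
    using z by (simp add: \<rho>_rep)
  then have "q (r \<odot>\<^bsub>F\<^esub> single R (p, s)) = q (r \<odot>\<^bsub>F\<^esub> single R (rep s \<odot>\<^bsub>P\<^esub> p, \<one>\<^bsub>S\<^esub>))"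
    using sc add(1) by (intro q_smult_cong) auto
  also have "\<dots> = \<tau> (r \<odot>\<^bsub>P\<^esub> (rep s \<odot>\<^bsub>P\<^esub> p))"
    unfolding \<tau>_eq using sc add(1) by (simp add: q_single_smult)
  finally have *: "q (r \<odot>\<^bsub>F\<^esub> single R z) = \<tau> (r \<odot>\<^bsub>P\<^esub> (rep s \<odot>\<^bsub>P\<^esub> p))" using z by simp
  have "q (r \<odot>\<^bsub>F\<^esub> single R z \<oplus>\<^bsub>F\<^esub> f) = q (r \<odot>\<^bsub>F\<^esub> single R z) \<oplus>\<^bsub>C\<^esub> q f"
    using add(1-3) sc z by (simp add: C_ops F.FM.smult_closed)
  also have "\<dots> = \<tau> (r \<odot>\<^bsub>P\<^esub> (rep s \<odot>\<^bsub>P\<^esub> p) \<oplus>\<^bsub>P\<^esub> lam f)"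
    unfolding * add(4) using add sc by (intro \<tau>_add) (auto simp: lam_closed)
  also have "r \<odot>\<^bsub>P\<^esub> (rep s \<odot>\<^bsub>P\<^esub> p) \<oplus>\<^bsub>P\<^esub> lam f = lam (r \<odot>\<^bsub>F\<^esub> single R z \<oplus>\<^bsub>F\<^esub> f)"
    using add sc z by (simp add: lam_add lam_smult lam_single F.FM.smult_closed)
  finally show ?case .
qed

lemma \<pi>_lam_single_1: "p \<in> carrier P \<Longrightarrow> \<pi> (lam (single R (p, \<one>\<^bsub>S\<^esub>))) = \<pi> p"
  using \<pi>_scalar_cong[of "rep \<one>\<^bsub>S\<^esub>" "\<one>\<^bsub>R\<^esub>" p]
  by (simp add: lam_single rep_closed \<rho>_rep \<rho>_ops(4))

text \<open>Together with \<open>C_carrier\<close> this is the isomorphism of P/IP with the tensor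
  product. From here on cosets in the monoid algebra can be replaced by elements of \<open>P\<close>
  taken modulo \<open>IP\<close>.\<close>

lemma \<tau>_eq_iff:
  assumes x: "x \<in> carrier P" and y: "y \<in> carrier P"
  shows "\<tau> x = \<tau> y \<longleftrightarrow> x \<ominus>\<^bsub>P\<^esub> y \<in> IP"
proof
  assume "\<tau> x = \<tau> y"
  then have "single R (x, \<one>\<^bsub>S\<^esub>) \<ominus>\<^bsub>F\<^esub> single R (y, \<one>\<^bsub>S\<^esub>) \<in> J"
    unfolding \<tau>_eq using x y by (simp add: J.quot_eq single_PS)
  then have "lam (single R (x, \<one>\<^bsub>S\<^esub>)) \<ominus>\<^bsub>P\<^esub> lam (single R (y, \<one>\<^bsub>S\<^esub>)) \<in> IP"
    unfolding lam_minus[OF single_1[OF x] single_1[OF y], symmetric] by (rule J_lam)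
  then have "\<pi> (lam (single R (x, \<one>\<^bsub>S\<^esub>))) = \<pi> (lam (single R (y, \<one>\<^bsub>S\<^esub>)))"
    using x y by (simp add: IP.quot_eq lam_closed single_1)
  then show "x \<ominus>\<^bsub>P\<^esub> y \<in> IP" using x y by (simp add: \<pi>_lam_single_1 IP.quot_eq)
next
  assume "x \<ominus>\<^bsub>P\<^esub> y \<in> IP"
  then have "\<tau> ((x \<ominus>\<^bsub>P\<^esub> y) \<oplus>\<^bsub>P\<^esub> y) = \<tau> \<zero>\<^bsub>P\<^esub> \<oplus>\<^bsub>C\<^esub> \<tau> y"
    using \<tau>_IP[of "x \<ominus>\<^bsub>P\<^esub> y"] \<tau>_zero \<tau>_add[of "x \<ominus>\<^bsub>P\<^esub> y" y] x y by simp
  moreover have "(x \<ominus>\<^bsub>P\<^esub> y) \<oplus>\<^bsub>P\<^esub> y = x" using x y by (simp add: a_minus_def M.add.m_assoc M.l_neg)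
  ultimately show "\<tau> x = \<tau> y" using \<tau>_add[of "\<zero>\<^bsub>P\<^esub>" y] y by simp
qed

lemma \<tau>_zero_iff: "x \<in> carrier P \<Longrightarrow> \<tau> x = \<zero>\<^bsub>C\<^esub> \<longleftrightarrow> x \<in> IP"
  using \<tau>_eq_iff[of x "\<zero>\<^bsub>P\<^esub>"] \<tau>_zero by (simp add: a_minus_def)

section \<open>The operations of the complex, read off from \<open>P\<close>\<close>

lemma C_carrier: "carrier C = \<tau> ` carrier P"
proof
  show "carrier C \<subseteq> \<tau> ` carrier P" using C_ops(1) q_lam lam_closed by auto
  show "\<tau> ` carrier P \<subseteq> carrier C" using C_ops(1) single_1 \<tau>_eq by auto
qed

lemma \<tau>_smult:
  assumes r: "r \<in> carrier R" and x: "x \<in> carrier P"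
  shows "\<rho> r \<odot>\<^bsub>C\<^esub> \<tau> x = \<tau> (r \<odot>\<^bsub>P\<^esub> x)"
proof -
  have r': "\<rho> r \<in> carrier S" using \<rho>_ops(1)[OF r] .
  have "\<rho> r \<odot>\<^bsub>C\<^esub> \<tau> x = q (single R (\<one>\<^bsub>P\<^esub>, \<rho> r)) \<otimes>\<^bsub>C\<^esub> \<tau> x"
    by (simp add: Tor_complex_def base_change_def Let_def pure_tensor_def)
  also have "\<dots> = q (single R (x, \<rho> r \<otimes>\<^bsub>S\<^esub> \<one>\<^bsub>S\<^esub>))"
    unfolding \<tau>_eq using x r' by (simp add: C_ops single_PS F.single_mult)
  also have "\<dots> = q (r \<odot>\<^bsub>F\<^esub> single R (x, \<one>\<^bsub>S\<^esub>))"
    by (rule q_single_scalar) (use x r in auto)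
  also have "\<dots> = \<tau> (r \<odot>\<^bsub>P\<^esub> x)" unfolding \<tau>_eq using x r by (simp add: q_single_smult)
  finally show ?thesis .
qed

lemma C_component: "component C n = \<tau> ` component P n"
proof -
  have eq: "component C n = q ` {f \<in> carrier F. \<forall>p s. f (p, s) \<noteq> \<zero>\<^bsub>R\<^esub> \<longrightarrow> p \<in> component P n}"
    by (simp add: Tor_complex_def base_change_def Let_def)
  have sub: "q f \<in> \<tau> ` component P n"
    if f: "f \<in> carrier F" "\<forall>p s. f (p, s) \<noteq> \<zero>\<^bsub>R\<^esub> \<longrightarrow> p \<in> component P n" for f
  proof -
    have f': "f \<in> finsupp R (carrier P \<times> carrier S)" using f(1) by (simp add: monoid_algebra_simps)
    have "lam f \<in> component P n"
      unfolding lam_def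
    proof (rule lincomb_in_submodule[OF component_submodule f'])
      fix z assume z: "f z \<noteq> \<zero>\<^bsub>R\<^esub>"
      then have "snd z \<in> carrier S" "fst z \<in> component P n"
        using finsupp_support[OF f'] f(2) by (auto, metis prod.collapse)
      then show "rep (snd z) \<odot>\<^bsub>P\<^esub> fst z \<in> component P n" by (simp add: component_smult rep_closed)
    qed
    then show ?thesis using q_lam[OF f(1)] by blast
  qed
  have sup: "\<tau> p \<in> component C n" if p: "p \<in> component P n" for p
    unfolding eq \<tau>_eq using p single_1[OF component_closed[OF p]] by (auto simp: single_def)
  show ?thesis
  proof
    show "component C n \<subseteq> \<tau> ` component P n" unfolding eq using sub by (intro image_subsetI) simp
    show "\<tau> ` component P n \<subseteq> component C n" using sup by (rule image_subsetI)
  qed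
qed

text \<open>The push-forward on formal sums corresponds under \<open>lam\<close> to the differential
  of \<open>P\<close>. As the latter preserves \<open>IP\<close>, every member of a coset leads to
  the same result, and the union in the definition collapses.\<close>

lemma C_differential:
  assumes x: "x \<in> carrier P"
  shows "differential C (\<tau> x) = \<tau> (\<delta> x)"
proof -
  let ?d = "push_forward R (\<lambda>(p, s). (\<delta> p, s))"
  have d: "?d f \<in> carrier F \<and> lam (?d f) = \<delta> (lam f)" if "f \<in> carrier F" for f
    using that
  proof (induction f rule: F.F_induct)
    case zero
    have "?d \<zero>\<^bsub>F\<^esub> = \<zero>\<^bsub>F\<^esub>" unfolding monoid_algebra_simps by (rule R.push_forward_zero)
    then show ?case using differential_0[OF component_zero] F.FM.M.zero_closed by (simp add: lam_zero)
  next
    case (add r z f)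
    obtain p s where z: "z = (p, s)" "p \<in> carrier P" "s \<in> carrier S" using add(2) by auto
    have c: "single R (p, s) \<in> carrier F" "single R (\<delta> p, s) \<in> carrier F"
      using z by (simp_all add: single_PS differential_closed)
    have "?d (r \<odot>\<^bsub>F\<^esub> single R z \<oplus>\<^bsub>F\<^esub> f) = ?d (r \<odot>\<^bsub>F\<^esub> single R z) \<oplus>\<^bsub>F\<^esub> ?d f"
      using R.push_forward_add[of "r \<odot>\<^bsub>F\<^esub> single R z" "carrier (P \<times>\<times> S)" f] add(1,3) c z
        F.FM.smult_closed[OF add(1) c(1)]
      unfolding monoid_algebra_simps by simp
    moreover have "?d (r \<odot>\<^bsub>F\<^esub> single R z) = r \<odot>\<^bsub>F\<^esub> single R (\<delta> p, s)"
      unfolding monoid_algebra_simps z(1) 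
      using R.push_forward_single[OF add(1), of "\<lambda>(p, s). (\<delta> p, s)" "(p, s)"] by simp
    ultimately show ?case
      using add c z
      by (simp add: F.FM.smult_closed lam_add lam_smult lam_single lam_closed differential_add
          differential_smult differential_closed rep_closed)
  qed
  let ?f = "single R (x, \<one>\<^bsub>S\<^esub>)"
  note f = single_1[OF x]
  have cong: "\<tau> (\<delta> y) = \<tau> (\<delta> y')" if "y \<in> carrier P" "y' \<in> carrier P" "y \<ominus>\<^bsub>P\<^esub> y' \<in> IP" for y y'
  proof -
    have "\<delta> (\<ominus>\<^bsub>P\<^esub> y') = \<ominus>\<^bsub>P\<^esub> \<delta> y'"
      using differential_smult[of "\<ominus>\<^bsub>R\<^esub> \<one>\<^bsub>R\<^esub>" y'] that(2) by (simp add: smult_l_minus differential_closed)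
    then have "\<delta> (y \<ominus>\<^bsub>P\<^esub> y') = \<delta> y \<ominus>\<^bsub>P\<^esub> \<delta> y'" using that by (simp add: a_minus_def differential_add)
    then show ?thesis using IP_differential[OF that(3)] that by (simp add: \<tau>_eq_iff differential_closed)
  qed
  have "differential C (\<tau> x) = (\<Union>g\<in>q ?f. q (?d g))"
    by (simp add: Tor_complex_def base_change_def Let_def \<tau>_eq)
  also have "\<dots> = q (?d ?f)"
  proof (rule J.UN_coset[OF f])
    fix g assume g: "g \<in> carrier F" "g \<ominus>\<^bsub>F\<^esub> ?f \<in> J"
    have "lam g \<ominus>\<^bsub>P\<^esub> lam ?f \<in> IP" using J_lam[OF g(2)] lam_minus[OF g(1) f] by simp
    then show "q (?d g) = q (?d ?f)"
      using d[OF g(1)] d[OF f] cong[of "lam g" "lam ?f"] g f by (simp add: q_lam lam_closed)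
  qed
  also have "\<dots> = \<tau> (\<delta> (lam ?f))" using d[OF f] q_lam by simp
  also have "\<dots> = \<tau> (\<delta> x)"
    using cong[of "lam ?f" x] \<pi>_lam_single_1[OF x] x f by (simp add: IP.quot_eq lam_closed)
  finally show ?thesis .
qed

lemma pregraded_C: "pregraded_algebra S C"
proof (rule pregraded_algebra_image[OF assoc_algebra_axioms cring_S \<rho>_hom quot_carrier, where h = \<tau>
      and Z = "carrier P" and N = "component P"])
  show "submodule (carrier P) R P" by (rule carrier_is_submodule)
  show "submodule (component P n) R P" for n by (rule component_submodule)
  show "component P n \<subseteq> carrier P" for n using component_closed by blast
qed (auto simp: one_component mult_component C_carrier \<tau>_add \<tau>_zero \<tau>_mult C_ops(3) \<tau>_smult C_component)

sublocale C: pregraded_algebra S C by (rule pregraded_C)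

end


section \<open>The Tor algebra\<close>

context dg_algebra_resolution
begin

abbreviation "H \<equiv> Tor_algebra R I P"
abbreviation "T \<equiv> Tor_class R I P"
abbreviation "B \<equiv> boundaries C"
abbreviation "Cyc \<equiv> C\<lparr>carrier := cycles C\<rparr>"

text \<open>The preimage in \<open>P\<close> of the cycles of the complex. Tor is the image of this
  subalgebra under \<open>T\<close>, which allows working with elements of \<open>P\<close>
  throughout.\<close>

definition Z where "Z = {x \<in> carrier P. \<delta> x \<in> IP}"

lemma Z_closed: "x \<in> Z \<Longrightarrow> x \<in> carrier P" and Z_differential: "x \<in> Z \<Longrightarrow> \<delta> x \<in> IP"
  by (auto simp: Z_def)

lemma differential_zero: "\<delta> \<zero>\<^bsub>P\<^esub> = \<zero>\<^bsub>P\<^esub>"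
  by (rule differential_0[OF component_zero])

lemma differential_uminus: "x \<in> carrier P \<Longrightarrow> \<delta> (\<ominus>\<^bsub>P\<^esub> x) = \<ominus>\<^bsub>P\<^esub> \<delta> x"
  using differential_smult[of "\<ominus>\<^bsub>R\<^esub> \<one>\<^bsub>R\<^esub>" x] by (simp add: smult_l_minus differential_closed)

lemma differential_minus:
  "\<lbrakk>x \<in> carrier P; y \<in> carrier P\<rbrakk> \<Longrightarrow> \<delta> (x \<ominus>\<^bsub>P\<^esub> y) = \<delta> x \<ominus>\<^bsub>P\<^esub> \<delta> y"
  by (simp add: a_minus_def differential_add differential_uminus)

lemma part_differential: "x \<in> carrier P \<Longrightarrow> part (\<delta> x) n = \<delta> (part x (Suc n))"
proof -
  have hom: "part (\<delta> y) n = \<delta> (part y (Suc n))" if y: "y \<in> component P m" for y m n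
  proof (cases m)
    case 0
    then show ?thesis
      using y part_homogeneous[OF component_zero[of 0]]
      by (simp add: differential_0 part_homogeneous[OF y] differential_zero)
  next
    case (Suc k)
    then have "\<delta> y \<in> component P k" using y differential_Suc by simp
    from part_homogeneous[OF this] show ?thesis
      using Suc by (simp add: part_homogeneous[OF y] differential_zero)
  qed
  assume x: "x \<in> carrier P"
  then show ?thesis
  proof (induction x rule: homogeneous_induct)
    case zero
    show ?case by (rule hom[OF component_zero])
  next
    case (add m y)
    then show ?case using hom[OF part_component[OF x], of m n]
      by (simp add: differential_add part_add part_closed[OF x] part_closed differential_closed)
  qed
qed

text \<open>The differential of the n-th part is the part of \<open>\<delta> x\<close> in degree n -
  1, and parts of elements of \<open>IP\<close> lie in \<open>IP\<close>. The truncated subtraction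
  is used for positive n; in degree 0 the differential vanishes.\<close>

lemma part_Z: "x \<in> Z \<Longrightarrow> part x n \<in> Z"
  using IP_part[OF Z_differential, of x "n - 1"] part_differential[of x "n - 1"]
    differential_0[OF part_component, of x] IP.zero
  by (cases n) (auto simp: Z_def part_closed)

lemma Z_submodule: "submodule Z R P"
  by (rule submoduleI)
    (auto simp: Z_def differential_zero IP.zero differential_uminus IP_uminus differential_add IP_plus
      differential_smult IP_smult)

lemma Z_one: "\<one>\<^bsub>P\<^esub> \<in> Z"
  using differential_0[OF one_component] by (simp add: Z_def IP.zero)

text \<open>The Leibniz rule asks for a homogeneous left factor, so x is split into parts, which are
  again in \<open>Z\<close>.\<close>

lemma Z_mult:
  assumes x: "x \<in> Z" and y: "y \<in> Z"
  shows "x \<otimes>\<^bsub>P\<^esub> y \<in> Z"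
proof -
  note yc = Z_closed[OF y] and xc = Z_closed[OF x]
  have hom: "\<delta> (z \<otimes>\<^bsub>P\<^esub> y) \<in> IP" if z: "z \<in> component P n" "z \<in> Z" for z n
  proof -
    have "\<delta> z \<otimes>\<^bsub>P\<^esub> y \<in> IP" "z \<otimes>\<^bsub>P\<^esub> \<delta> y \<in> IP"
      using z yc y Z_differential Z_closed by (auto intro: IP_mult_left IP_mult_right)
    then show ?thesis using Leibniz[OF z(1) yc] by (simp add: IP_plus IP_uminus)
  qed
  have "\<delta> (x \<otimes>\<^bsub>P\<^esub> y) \<in> IP"
    using xc
  proof (induction x rule: homogeneous_induct)
    case zero
    then show ?case using yc by (simp add: differential_zero IP.zero)
  next
    case (add n z)
    then show ?case using hom[OF part_component[OF xc] part_Z[OF x], of n] yc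
      by (simp add: A.l_distr differential_add part_closed[OF xc] IP_plus)
  qed
  then show ?thesis using xc yc by (simp add: Z_def)
qed

lemma cycles_C: "cycles C = \<tau> ` Z"
proof -
  have "differential C (\<tau> x) = \<zero>\<^bsub>C\<^esub> \<longleftrightarrow> \<delta> x \<in> IP" if "x \<in> carrier P" for x
    using that by (simp add: C_differential \<tau>_zero_iff differential_closed)
  then show ?thesis unfolding cycles_def C_carrier Z_def by blast
qed

lemma boundaries_C: "B = (\<lambda>x. \<tau> (\<delta> x)) ` carrier P"
  unfolding boundaries_def C_carrier by (auto simp: C_differential image_iff)

lemma boundary_Z: "x \<in> carrier P \<Longrightarrow> \<delta> x \<in> Z"
  by (simp add: Z_def differential_closed differential_differential IP.zero)

lemma assoc_algebra_Cyc: "assoc_algebra S Cyc"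
  by (rule assoc_algebra_image[OF assoc_algebra_axioms cring_S \<rho>_hom quot_carrier Z_submodule Z_one
      Z_mult, where h = \<tau>])
    (auto simp: cycles_C \<tau>_add \<tau>_zero \<tau>_mult C_ops(3) \<tau>_smult Z_closed)

sublocale Cyc: assoc_algebra S Cyc by (rule assoc_algebra_Cyc)

lemma \<tau>_uminus: "x \<in> carrier P \<Longrightarrow> \<ominus>\<^bsub>C\<^esub> \<tau> x = \<tau> (\<ominus>\<^bsub>P\<^esub> x)"
  by (rule C.M.minus_equality) (auto simp: \<tau>_add C_carrier M.l_neg \<tau>_zero)

text \<open>Negatives are defined by reference to the carrier of a record, so the formula in
  \<open>C\<close> does not automatically hold in its subring \<open>Cyc\<close>.\<close>

lemma \<tau>_uminus_Cyc: "x \<in> Z \<Longrightarrow> \<ominus>\<^bsub>Cyc\<^esub> \<tau> x = \<tau> (\<ominus>\<^bsub>P\<^esub> x)"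
  using submoduleE(3)[OF Z_submodule, of x]
  by (intro Cyc.M.minus_equality) (auto simp: \<tau>_add cycles_C M.l_neg \<tau>_zero Z_closed)

lemma B_add: "\<lbrakk>u \<in> B; v \<in> B\<rbrakk> \<Longrightarrow> u \<oplus>\<^bsub>C\<^esub> v \<in> B"
  unfolding boundaries_C by (auto simp: \<tau>_add differential_closed differential_add[symmetric])

lemma B_uminus: "u \<in> B \<Longrightarrow> \<ominus>\<^bsub>C\<^esub> u \<in> B"
  unfolding boundaries_C by (auto simp: \<tau>_uminus differential_closed differential_uminus[symmetric])

lemma B_zero: "\<zero>\<^bsub>C\<^esub> \<in> B"
  unfolding boundaries_C by (rule image_eqI[of _ _ "\<zero>\<^bsub>P\<^esub>"]) (auto simp: differential_zero \<tau>_zero)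

lemma B_I: "x \<in> carrier P \<Longrightarrow> \<tau> (\<delta> x) \<in> B"
  by (simp add: boundaries_C)

text \<open>For homogeneous z the product of z and \<open>\<delta> w\<close> is, up to sign and
  modulo \<open>IP\<close>, the differential of z w, because \<open>\<delta> z\<close> lies in
  \<open>IP\<close>.\<close>

lemma B_mult_left:
  assumes z: "z \<in> Z" and w: "w \<in> carrier P"
  shows "\<tau> z \<otimes>\<^bsub>C\<^esub> \<tau> (\<delta> w) \<in> B"
proof -
  note zc = Z_closed[OF z]
  have hom: "\<tau> y \<otimes>\<^bsub>C\<^esub> \<tau> (\<delta> w) \<in> B" if y: "y \<in> component P n" "y \<in> Z" for y n
  proof -
    have yc: "y \<in> carrier P" "\<delta> y \<in> carrier P" "\<delta> w \<in> carrier P"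
      using y w Z_closed by (auto simp: differential_closed)
    have 0: "\<tau> (\<delta> y \<otimes>\<^bsub>P\<^esub> w) = \<zero>\<^bsub>C\<^esub>"
      using y w by (intro \<tau>_IP IP_mult_right Z_differential)
    have c: "\<tau> (y \<otimes>\<^bsub>P\<^esub> \<delta> w) \<in> carrier C" "\<tau> y \<in> carrier C" "\<tau> (\<delta> w) \<in> carrier C"
      using yc C_carrier by auto
    have "\<tau> (\<delta> (y \<otimes>\<^bsub>P\<^esub> w)) =
      (if even n then \<tau> (y \<otimes>\<^bsub>P\<^esub> \<delta> w) else \<ominus>\<^bsub>C\<^esub> \<tau> (y \<otimes>\<^bsub>P\<^esub> \<delta> w))"
      using Leibniz[OF y(1) w] yc w 0 c
      by (simp add: \<tau>_add[symmetric] \<tau>_uminus[symmetric])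
    then have "\<tau> y \<otimes>\<^bsub>C\<^esub> \<tau> (\<delta> w) =
      (if even n then \<tau> (\<delta> (y \<otimes>\<^bsub>P\<^esub> w)) else \<ominus>\<^bsub>C\<^esub> \<tau> (\<delta> (y \<otimes>\<^bsub>P\<^esub> w)))"
      using yc c by (simp add: \<tau>_mult)
    then show ?thesis using B_I[of "y \<otimes>\<^bsub>P\<^esub> w"] B_uminus yc w by simp
  qed
  have dw: "\<tau> (\<delta> w) \<in> carrier C" using w C_carrier differential_closed by auto
  show ?thesis
    using zc
  proof (induction z rule: homogeneous_induct)
    case zero
    then show ?case using dw B_zero by (simp add: \<tau>_zero)
  next
    case (add n y)
    have c: "\<tau> (part z n) \<in> carrier C" "\<tau> y \<in> carrier C" using add part_closed[OF zc] C_carrier by auto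
    have "\<tau> (part z n \<oplus>\<^bsub>P\<^esub> y) \<otimes>\<^bsub>C\<^esub> \<tau> (\<delta> w) =
      \<tau> (part z n) \<otimes>\<^bsub>C\<^esub> \<tau> (\<delta> w) \<oplus>\<^bsub>C\<^esub> \<tau> y \<otimes>\<^bsub>C\<^esub> \<tau> (\<delta> w)"
      unfolding \<tau>_add[OF part_closed[OF zc] add(1), symmetric] by (rule C.A.l_distr[OF c dw])
    then show ?case using B_add[OF hom[OF part_component[OF zc] part_Z[OF z]] add(2)] by simp
  qed
qed

text \<open>Now w is the left factor and is the one to be split into parts. The second Leibniz term
  is a multiple of \<open>\<delta> z\<close>, hence lies in \<open>IP\<close>.\<close>

lemma B_mult_right:
  assumes z: "z \<in> Z" and w: "w \<in> carrier P"
  shows "\<tau> (\<delta> w) \<otimes>\<^bsub>C\<^esub> \<tau> z \<in> B"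
proof -
  note zc = Z_closed[OF z]
  have hom: "\<tau> (\<delta> y) \<otimes>\<^bsub>C\<^esub> \<tau> z \<in> B" if y: "y \<in> component P n" for y n
  proof -
    have yc: "y \<in> carrier P" "\<delta> y \<in> carrier P" "\<delta> z \<in> carrier P"
      using component_closed[OF y] zc by (auto simp: differential_closed)
    have "(if even n then y \<otimes>\<^bsub>P\<^esub> \<delta> z else \<ominus>\<^bsub>P\<^esub> (y \<otimes>\<^bsub>P\<^esub> \<delta> z)) \<in> IP"
      using IP_mult_left[OF yc(1) Z_differential[OF z]] IP_uminus by simp
    from \<tau>_IP[OF this] have "\<tau> (\<delta> (y \<otimes>\<^bsub>P\<^esub> z)) = \<tau> (\<delta> y \<otimes>\<^bsub>P\<^esub> z) \<oplus>\<^bsub>C\<^esub> \<zero>\<^bsub>C\<^esub>"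
      using Leibniz[OF y zc] yc zc
        \<tau>_add[of "\<delta> y \<otimes>\<^bsub>P\<^esub> z" "if even n then y \<otimes>\<^bsub>P\<^esub> \<delta> z else \<ominus>\<^bsub>P\<^esub> (y \<otimes>\<^bsub>P\<^esub> \<delta> z)"]
      by simp
    moreover have "\<tau> (\<delta> y \<otimes>\<^bsub>P\<^esub> z) \<in> carrier C" using yc zc C_carrier by simp
    ultimately show ?thesis using B_I[of "y \<otimes>\<^bsub>P\<^esub> z"] yc zc by (simp add: \<tau>_mult)
  qed
  have cz: "\<tau> z \<in> carrier C" using zc C_carrier by auto
  show ?thesis
    using w
  proof (induction w rule: homogeneous_induct)
    case zero
    then show ?case using cz B_zero by (simp add: differential_zero \<tau>_zero)
  next
    case (add n y)
    have d: "\<delta> (part w n) \<in> carrier P" "\<delta> y \<in> carrier P"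
      using add part_closed[OF w] by (auto simp: differential_closed)
    then have c: "\<tau> (\<delta> (part w n)) \<in> carrier C" "\<tau> (\<delta> y) \<in> carrier C" using C_carrier by auto
    have "\<tau> (\<delta> (part w n \<oplus>\<^bsub>P\<^esub> y)) \<otimes>\<^bsub>C\<^esub> \<tau> z =
      \<tau> (\<delta> (part w n)) \<otimes>\<^bsub>C\<^esub> \<tau> z \<oplus>\<^bsub>C\<^esub> \<tau> (\<delta> y) \<otimes>\<^bsub>C\<^esub> \<tau> z"
      unfolding differential_add[OF part_closed[OF w] add(1)] \<tau>_add[OF d, symmetric]
      by (rule C.A.l_distr[OF c cz])
    then show ?case using B_add[OF hom[OF part_component[OF w]] add(2)] by simp
  qed
qed

lemma ideal_B: "ideal B Cyc"
proof (rule idealI[OF Cyc.A.ring_axioms])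
  have BZ: "B \<subseteq> \<tau> ` Z" using boundaries_C boundary_Z by auto
  show "subgroup B (add_monoid Cyc)"
  proof (rule Cyc.M.add.subgroupI)
    show "B \<subseteq> carrier Cyc" using BZ by (simp add: cycles_C)
    show "B \<noteq> {}" using B_zero by auto
    show "\<ominus>\<^bsub>Cyc\<^esub> b \<in> B" if "b \<in> B" for b
      using that B_uminus[OF that] \<tau>_uminus \<tau>_uminus_Cyc boundary_Z differential_closed
      unfolding boundaries_C by force
  qed (simp add: B_add)
  fix b z assume b: "b \<in> B" and "z \<in> carrier Cyc"
  then obtain w z' where "w \<in> carrier P" "b = \<tau> (\<delta> w)" "z' \<in> Z" "z = \<tau> z'"
    unfolding boundaries_C by (auto simp: cycles_C)
  then show "z \<otimes>\<^bsub>Cyc\<^esub> b \<in> B" "b \<otimes>\<^bsub>Cyc\<^esub> z \<in> B"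
    using B_mult_left B_mult_right by simp_all
qed

sublocale B: ideal B Cyc by (rule ideal_B)

section \<open>Homology classes of elements of \<open>Z\<close>\<close>

lemma T_eq: "T x = B +>\<^bsub>Cyc\<^esub> \<tau> x"
  by (simp add: Tor_class_def a_r_coset_def')

lemma \<tau>_Z: "x \<in> Z \<Longrightarrow> \<tau> x \<in> carrier Cyc"
  by (simp add: cycles_C)

lemma H_ops:
  "carrier H = T ` Z" "\<zero>\<^bsub>H\<^esub> = T \<zero>\<^bsub>P\<^esub>" "\<one>\<^bsub>H\<^esub> = T \<one>\<^bsub>P\<^esub>"
proof -
  have "carrier H = carrier (Cyc Quot B)" "\<zero>\<^bsub>H\<^esub> = \<zero>\<^bsub>Cyc Quot B\<^esub>" "\<one>\<^bsub>H\<^esub> = \<one>\<^bsub>Cyc Quot B\<^esub>"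
    by (simp_all add: Tor_algebra_def homology_algebra_def Let_def)
  then show "carrier H = T ` Z" "\<zero>\<^bsub>H\<^esub> = T \<zero>\<^bsub>P\<^esub>" "\<one>\<^bsub>H\<^esub> = T \<one>\<^bsub>P\<^esub>"
    unfolding B.quot_carrier B.quot_ops(3,4) T_eq by (simp_all add: cycles_C image_image \<tau>_zero C_ops(3))
qed

lemma T_add: "\<lbrakk>x \<in> Z; y \<in> Z\<rbrakk> \<Longrightarrow> T x \<oplus>\<^bsub>H\<^esub> T y = T (x \<oplus>\<^bsub>P\<^esub> y)"
  and T_mult: "\<lbrakk>x \<in> Z; y \<in> Z\<rbrakk> \<Longrightarrow> T x \<otimes>\<^bsub>H\<^esub> T y = T (x \<otimes>\<^bsub>P\<^esub> y)"
  using B.quot_ops(1,2)[OF \<tau>_Z \<tau>_Z, of x y]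
  by (simp_all add: Tor_algebra_def homology_algebra_def Let_def T_eq \<tau>_add \<tau>_mult Z_closed)

lemma T_smult:
  assumes r: "r \<in> carrier R" and x: "x \<in> Z"
  shows "\<rho> r \<odot>\<^bsub>H\<^esub> T x = T (r \<odot>\<^bsub>P\<^esub> x)"
proof -
  have s: "\<rho> r \<in> carrier S" using \<rho>_ops(1)[OF r] .
  have "\<rho> r \<odot>\<^bsub>H\<^esub> T x = (\<Union>z\<in>B +>\<^bsub>Cyc\<^esub> \<tau> x. B +>\<^bsub>Cyc\<^esub> (\<rho> r \<odot>\<^bsub>Cyc\<^esub> z))"
    by (simp add: Tor_algebra_def homology_algebra_def Let_def T_eq a_r_coset_def')
  also have "\<dots> = B +>\<^bsub>Cyc\<^esub> (\<rho> r \<odot>\<^bsub>Cyc\<^esub> \<tau> x)"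
  proof (rule B.UN_coset[OF \<tau>_Z[OF x]])
    fix z assume z: "z \<in> carrier Cyc" "z \<ominus>\<^bsub>Cyc\<^esub> \<tau> x \<in> B"
    then have "(\<rho> r \<odot>\<^bsub>Cyc\<^esub> z) \<ominus>\<^bsub>Cyc\<^esub> (\<rho> r \<odot>\<^bsub>Cyc\<^esub> \<tau> x) \<in> B"
      using Cyc.ideal_smult[OF ideal_B s z(2)] Cyc.smult_minus[OF s z(1) \<tau>_Z[OF x]] by simp
    then show "B +>\<^bsub>Cyc\<^esub> (\<rho> r \<odot>\<^bsub>Cyc\<^esub> z) = B +>\<^bsub>Cyc\<^esub> (\<rho> r \<odot>\<^bsub>Cyc\<^esub> \<tau> x)"
      using B.quot_eq[OF Cyc.smult_closed[OF s z(1)] Cyc.smult_closed[OF s \<tau>_Z[OF x]]] by simp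
  qed
  finally show ?thesis using r x by (simp add: T_eq \<tau>_smult Z_closed)
qed

lemma T_eq_iff:
  assumes x: "x \<in> Z" and y: "y \<in> Z"
  shows "T x = T y \<longleftrightarrow> (\<exists>w\<in>carrier P. \<tau> (x \<ominus>\<^bsub>P\<^esub> y) = \<tau> (\<delta> w))"
proof -
  have "\<tau> x \<ominus>\<^bsub>Cyc\<^esub> \<tau> y = \<tau> (x \<ominus>\<^bsub>P\<^esub> y)"
    using x y Z_closed by (simp add: a_minus_def \<tau>_uminus_Cyc \<tau>_add)
  then show ?thesis
    unfolding T_eq using B.quot_eq[OF \<tau>_Z[OF x] \<tau>_Z[OF y]] by (auto simp: boundaries_C)
qed

lemma T_cong: "\<tau> x = \<tau> y \<Longrightarrow> T x = T y"
  by (simp add: T_eq)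

text \<open>Whether an element represents a cycle depends only on its image in the complex. A
  representative may thus be exchanged for a homogeneous one.\<close>

lemma \<tau>_cong_Z: "\<lbrakk>x \<in> Z; y \<in> carrier P; \<tau> x = \<tau> y\<rbrakk> \<Longrightarrow> y \<in> Z"
  using C_differential[of x] C_differential[of y] \<tau>_zero_iff[of "\<delta> x"] \<tau>_zero_iff[of "\<delta> y"]
  by (simp add: Z_def differential_closed)

lemma H_component: "component H n = T ` (Z \<inter> component P n)"
proof -
  have "component H n = (\<lambda>z. B +>\<^bsub>Cyc\<^esub> z) ` (cycles C \<inter> component C n)"
    by (simp add: Tor_algebra_def homology_algebra_def Let_def a_r_coset_def')
  moreover have "cycles C \<inter> component C n = \<tau> ` (Z \<inter> component P n)"
  proof
    show "cycles C \<inter> component C n \<subseteq> \<tau> ` (Z \<inter> component P n)"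
      unfolding cycles_C C_component using \<tau>_cong_Z component_closed by auto
    show "\<tau> ` (Z \<inter> component P n) \<subseteq> cycles C \<inter> component C n"
      unfolding cycles_C C_component by auto
  qed
  ultimately show ?thesis by (simp add: image_image T_eq)
qed

lemma pregraded_H: "pregraded_algebra S H"
proof (rule pregraded_algebra_image[OF assoc_algebra_axioms cring_S \<rho>_hom quot_carrier Z_submodule
      Z_one Z_mult, where h = T and N = "\<lambda>n. Z \<inter> component P n"])
  show "submodule (Z \<inter> component P n) R P" for n
    by (rule submoduleI)
      (use submoduleE[OF Z_submodule] submoduleE[OF component_submodule[of n]] component_zero
        in \<open>auto simp: Z_def differential_zero IP.zero\<close>)
qed (auto simp: one_component mult_component Z_one Z_mult H_ops T_add T_mult T_smult H_component)

sublocale H: pregraded_algebra S H by (rule pregraded_H)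

text \<open>A class is the sum of the classes of the parts of a representative, which are cycles by
  \<open>part_Z\<close>. Spanning is the form in which \<open>twist_step\<close> uses the grading of
  Tor.\<close>

lemma H_span: "carrier H \<subseteq> generate (add_monoid H) (\<Union>n. component H n)"
proof
  fix u assume "u \<in> carrier H"
  then obtain x where x: "x \<in> Z" "u = T x" using H_ops(1) by auto
  note xc = Z_closed[OF x(1)]
  have "x \<in> Z \<and> T x \<in> generate (add_monoid H) (\<Union>n. component H n)"
    using xc
  proof (induction x rule: homogeneous_induct)
    case zero
    have "\<zero>\<^bsub>P\<^esub> \<in> Z" by (simp add: Z_def differential_zero IP.zero)
    then show ?case using generate.one[of "add_monoid H"] by (simp add: H_ops(2))
  next
    case (add n y)
    have p: "part x n \<in> Z" "T (part x n) \<in> component H n"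
      using part_Z[OF x(1)] part_component[OF xc] H_component by auto
    then have "T (part x n) \<in> generate (add_monoid H) (\<Union>n. component H n)"
      by (intro generate.incl) auto
    from generate.eng[OF this conjunct2[OF add(2)]] show ?case
      using p add submoduleE(5)[OF Z_submodule] by (simp add: T_add)
  qed
  then show "u \<in> generate (add_monoid H) (\<Union>n. component H n)" using x by simp
qed

section \<open>The augmentation on homology\<close>

lemma augmentation_add: "\<lbrakk>x \<in> carrier P; y \<in> carrier P\<rbrakk> \<Longrightarrow> \<epsilon> (x \<oplus>\<^bsub>P\<^esub> y) = \<epsilon> x \<oplus>\<^bsub>S\<^esub> \<epsilon> y"
  and augmentation_mult: "\<lbrakk>x \<in> carrier P; y \<in> carrier P\<rbrakk> \<Longrightarrow> \<epsilon> (x \<otimes>\<^bsub>P\<^esub> y) = \<epsilon> x \<otimes>\<^bsub>S\<^esub> \<epsilon> y"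
  and augmentation_one: "\<epsilon> \<one>\<^bsub>P\<^esub> = \<one>\<^bsub>S\<^esub>"
  and augmentation_closed: "x \<in> carrier P \<Longrightarrow> \<epsilon> x \<in> carrier S"
  using ring_hom_memE[OF augmentation_hom] by auto

lemma augmentation_zero: "\<epsilon> \<zero>\<^bsub>P\<^esub> = \<zero>\<^bsub>S\<^esub>"
  by (rule ring_hom_zero[OF augmentation_hom A.ring_axioms S.ring_axioms])

lemma augmentation_IP: "u \<in> IP \<Longrightarrow> \<epsilon> u = \<zero>\<^bsub>S\<^esub>"
  by (induction u rule: IP.induct)
    (simp_all add: augmentation_zero augmentation_add augmentation_smult \<rho>_I Icarr IP_closed
      augmentation_closed)

text \<open>Exactness at degree 0 handles boundaries of elements of degree 1; boundaries from higher
  degrees have positive degree, where the augmentation vanishes.\<close>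

lemma augmentation_boundary: "w \<in> carrier P \<Longrightarrow> \<epsilon> (\<delta> w) = \<zero>\<^bsub>S\<^esub>"
proof -
  have hom: "\<epsilon> (\<delta> y) = \<zero>\<^bsub>S\<^esub>" if y: "y \<in> component P n" for y n
  proof (cases n)
    case 0
    then show ?thesis using y differential_0 augmentation_zero by simp
  next
    case (Suc k)
    show ?thesis
    proof (cases k)
      case 0
      then have "\<delta> y \<in> \<delta> ` component P 1" using y Suc by simp
      then show ?thesis using exact_0 by blast
    next
      case (Suc l)
      then have "\<delta> y \<in> component P (Suc l)" using y \<open>n = Suc k\<close> differential_Suc by simp
      then show ?thesis by (rule augmentation_Suc)
    qed
  qed
  assume w: "w \<in> carrier P"
  then show ?thesis
  proof (induction w rule: homogeneous_induct)
    case zero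
    show ?case by (rule hom[OF component_zero])
  next
    case (add n y)
    then show ?case using hom[OF part_component[OF w], of n]
      by (simp add: differential_add part_closed[OF w] augmentation_add differential_closed)
  qed
qed

text \<open>Two representatives of a class differ by an element of \<open>IP\<close> and a boundary,
  and the augmentation kills both.\<close>

lemma augmentation_cong:
  assumes "x \<in> Z" "y \<in> Z" "T x = T y"
  shows "\<epsilon> x = \<epsilon> y"
proof -
  note c = Z_closed[OF assms(1)] Z_closed[OF assms(2)]
  obtain w where w: "w \<in> carrier P" "\<tau> (x \<ominus>\<^bsub>P\<^esub> y) = \<tau> (\<delta> w)" using T_eq_iff assms by blast
  have dw: "\<delta> w \<in> carrier P" using w by (simp add: differential_closed)
  have u: "(x \<ominus>\<^bsub>P\<^esub> y) \<ominus>\<^bsub>P\<^esub> \<delta> w \<in> IP" using w dw c by (simp add: \<tau>_eq_iff)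
  have "x = ((x \<ominus>\<^bsub>P\<^esub> y) \<ominus>\<^bsub>P\<^esub> \<delta> w) \<oplus>\<^bsub>P\<^esub> (\<delta> w \<oplus>\<^bsub>P\<^esub> y)"
    using c dw by (simp add: a_minus_def M.add.m_assoc M.r_neg1 M.l_neg)
  then have "\<epsilon> x = \<epsilon> ((x \<ominus>\<^bsub>P\<^esub> y) \<ominus>\<^bsub>P\<^esub> \<delta> w) \<oplus>\<^bsub>S\<^esub> (\<epsilon> (\<delta> w) \<oplus>\<^bsub>S\<^esub> \<epsilon> y)"
    using c dw IP_closed[OF u] augmentation_add by (metis M.a_closed)
  then show ?thesis
    using augmentation_IP[OF u] augmentation_boundary[OF w(1)] augmentation_closed[OF c(2)] by simp
qed

text \<open>The composite Tor -> S -> E through the unit of \<open>E\<close>, to which the twists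
  are applied. It respects degrees because the augmentation is zero in positive degree.\<close>

lemma augmentation_graded_hom:
  assumes E: "pregraded_algebra S E"
  obtains G where "G \<in> graded_algebra_hom S H E" "\<And>x. x \<in> Z \<Longrightarrow> G (T x) = \<epsilon> x \<odot>\<^bsub>E\<^esub> \<one>\<^bsub>E\<^esub>"
proof -
  interpret E: pregraded_algebra S E by (rule E)
  obtain G where G: "\<And>x. x \<in> Z \<Longrightarrow> G (T x) = \<epsilon> x \<odot>\<^bsub>E\<^esub> \<one>\<^bsub>E\<^esub>"
    using factor_through_image[OF H_ops(1), of "\<lambda>x. \<epsilon> x \<odot>\<^bsub>E\<^esub> \<one>\<^bsub>E\<^esub>"] augmentation_cong by metis
  have cl: "\<epsilon> x \<in> carrier S" if "x \<in> Z" for x using augmentation_closed[OF Z_closed[OF that]] .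
  have "G \<in> graded_algebra_hom S H E"
    unfolding graded_algebra_hom_def
  proof (intro CollectI conjI ballI allI ring_hom_memI)
    fix u v assume "u \<in> carrier H" "v \<in> carrier H"
    then obtain x y where xy: "x \<in> Z" "y \<in> Z" "u = T x" "v = T y" using H_ops(1) by auto
    show "G (u \<otimes>\<^bsub>H\<^esub> v) = G u \<otimes>\<^bsub>E\<^esub> G v"
      using xy cl by (simp add: T_mult Z_mult G augmentation_mult Z_closed E.smult_mult_left E.smult_assoc1)
    show "G (u \<oplus>\<^bsub>H\<^esub> v) = G u \<oplus>\<^bsub>E\<^esub> G v"
      using xy cl submoduleE(5)[OF Z_submodule]
      by (simp add: T_add G augmentation_add Z_closed E.smult_l_distr)
  next
    fix u assume "u \<in> carrier H"
    then show "G u \<in> carrier E" using H_ops(1) G cl by auto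
  next
    fix s u assume "s \<in> carrier S" "u \<in> carrier H"
    then obtain r x where rx: "r \<in> carrier R" "s = \<rho> r" "x \<in> Z" "u = T x"
      using H_ops(1) quot_carrier by auto
    then show "G (s \<odot>\<^bsub>H\<^esub> u) = s \<odot>\<^bsub>E\<^esub> G u"
      using cl submoduleE(4)[OF Z_submodule] \<rho>_ops(1)[OF rx(1)]
      by (simp add: T_smult G augmentation_smult Z_closed E.smult_assoc1)
  next
    show "G \<one>\<^bsub>H\<^esub> = \<one>\<^bsub>E\<^esub>" by (simp add: H_ops(3) G Z_one augmentation_one)
  next
    fix n
    show "G ` component H n \<subseteq> component E n"
    proof
      fix v assume "v \<in> G ` component H n"
      then obtain x where x: "x \<in> Z" "x \<in> component P n" "v = \<epsilon> x \<odot>\<^bsub>E\<^esub> \<one>\<^bsub>E\<^esub>"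
        unfolding H_component using G by auto
      show "v \<in> component E n"
      proof (cases n)
        case 0
        then show ?thesis using x cl E.component_smult E.one_component by simp
      next
        case (Suc k)
        then have "\<epsilon> x = \<zero>\<^bsub>S\<^esub>" using x augmentation_Suc by simp
        then show ?thesis using x E.component_zero by simp
      qed
    qed
  qed
  then show thesis using that G by blast
qed

end


section \<open>Bockstein derivations\<close>

context dg_algebra_resolution
begin

lemma C_differential_add:
  assumes "u \<in> carrier C" "v \<in> carrier C"
  shows "differential C (u \<oplus>\<^bsub>C\<^esub> v) = differential C u \<oplus>\<^bsub>C\<^esub> differential C v"
proof -
  obtain x y where "x \<in> carrier P" "y \<in> carrier P" "u = \<tau> x" "v = \<tau> y" using assms C_carrier by auto
  then show ?thesis by (simp add: \<tau>_add C_differential differential_add differential_closed)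
qed

lemma C_differential_smult:
  assumes "s \<in> carrier S" "u \<in> carrier C"
  shows "differential C (s \<odot>\<^bsub>C\<^esub> u) = s \<odot>\<^bsub>C\<^esub> differential C u"
proof -
  obtain r x where "r \<in> carrier R" "x \<in> carrier P" "s = \<rho> r" "u = \<tau> x"
    using assms C_carrier quot_carrier by auto
  then show ?thesis by (simp add: \<tau>_smult C_differential differential_smult differential_closed)
qed

text \<open>Since \<open>P\<close> is free, \<open>IP\<close> is \<open>I \<otimes> P\<close>, so a linear map \<open>\<theta> : I \<rightarrow> R/I\<close> induces
  \<open>IP \<rightarrow> P/IP\<close>, \<open>a p \<mapsto> \<theta>(a) p\<close>.\<close>

lemma contraction:
  assumes \<theta>: "\<And>a. a \<in> I \<Longrightarrow> \<theta> a \<in> carrier S"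
    and \<theta>_add: "\<And>a b. \<lbrakk>a \<in> I; b \<in> I\<rbrakk> \<Longrightarrow> \<theta> (a \<oplus>\<^bsub>R\<^esub> b) = \<theta> a \<oplus>\<^bsub>S\<^esub> \<theta> b"
    and \<theta>_smult: "\<And>r a. \<lbrakk>r \<in> carrier R; a \<in> I\<rbrakk> \<Longrightarrow> \<theta> (r \<otimes>\<^bsub>R\<^esub> a) = \<rho> r \<otimes>\<^bsub>S\<^esub> \<theta> a"
  obtains \<Theta> where "\<And>u. u \<in> IP \<Longrightarrow> \<Theta> u \<in> carrier C"
    "\<And>u v. \<lbrakk>u \<in> IP; v \<in> IP\<rbrakk> \<Longrightarrow> \<Theta> (u \<oplus>\<^bsub>P\<^esub> v) = \<Theta> u \<oplus>\<^bsub>C\<^esub> \<Theta> v"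
    "\<And>a p. \<lbrakk>a \<in> I; p \<in> carrier P\<rbrakk> \<Longrightarrow> \<Theta> (a \<odot>\<^bsub>P\<^esub> p) = \<theta> a \<odot>\<^bsub>C\<^esub> \<tau> p"
proof -
  obtain K :: "(nat \<times> 'p) set" and \<kappa> where
    K: "\<And>k. k \<in> K \<Longrightarrow> snd k \<in> carrier P" and
    \<kappa>_fin: "\<And>x. x \<in> carrier P \<Longrightarrow> \<kappa> x \<in> finsupp R K" and
    \<kappa>_sum: "\<And>x. x \<in> carrier P \<Longrightarrow> x = lincomb R P snd (\<kappa> x)" and
    \<kappa>_add: "\<And>x y. x \<in> carrier P \<Longrightarrow> y \<in> carrier P \<Longrightarrow> \<kappa> (x \<oplus>\<^bsub>P\<^esub> y) = (\<lambda>k. \<kappa> x k \<oplus>\<^bsub>R\<^esub> \<kappa> y k)" and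
    \<kappa>_smult: "\<And>r x. r \<in> carrier R \<Longrightarrow> x \<in> carrier P \<Longrightarrow> \<kappa> (r \<odot>\<^bsub>P\<^esub> x) = (\<lambda>k. r \<otimes>\<^bsub>R\<^esub> \<kappa> x k)"
    by (rule free_components_coordinates[OF component_free], rule that)
  have \<kappa>_closed: "\<kappa> x k \<in> carrier R" if "x \<in> carrier P" for x k
    using R.finsupp_closed[OF \<kappa>_fin[OF that]] .
  have \<kappa>_zero: "\<kappa> \<zero>\<^bsub>P\<^esub> = (\<lambda>k. \<zero>\<^bsub>R\<^esub>)"
    using \<kappa>_smult[of "\<zero>\<^bsub>R\<^esub>" "\<zero>\<^bsub>P\<^esub>"] \<kappa>_closed[of "\<zero>\<^bsub>P\<^esub>"] by simp
  have zI: "\<zero>\<^bsub>R\<^esub> \<in> I" by simp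
  have \<theta>_zero: "\<theta> \<zero>\<^bsub>R\<^esub> = \<zero>\<^bsub>S\<^esub>"
    using \<theta>_smult[of "\<zero>\<^bsub>R\<^esub>" "\<zero>\<^bsub>R\<^esub>"] \<theta>[OF zI] \<rho>_I[OF zI] zI by simp
  \<comment> \<open>Freeness at work: an element of \<open>IP\<close> has all its coordinates in I,
    where \<theta> is defined.\<close>
  have \<kappa>_I: "\<kappa> u k \<in> I" if "u \<in> IP" for u k
    using that
  proof (induction u rule: IP.induct)
    case zero
    then show ?case by (simp add: \<kappa>_zero)
  next
    case (add a p u)
    then show ?case by (simp add: \<kappa>_add \<kappa>_smult Icarr IP_closed I_r_closed \<kappa>_closed)
  qed
  have \<theta>\<kappa>_fin: "(\<lambda>k. \<theta> (\<kappa> u k)) \<in> finsupp S K" if u: "u \<in> IP" for u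
  proof -
    note f = \<kappa>_fin[OF IP_closed[OF u]]
    have "{k. \<theta> (\<kappa> u k) \<noteq> \<zero>\<^bsub>S\<^esub>} \<subseteq> {k. \<kappa> u k \<noteq> \<zero>\<^bsub>R\<^esub>}"
      by (rule Collect_mono, rule impI, erule contrapos_nn) (simp add: \<theta>_zero)
    then have "finite {k. \<theta> (\<kappa> u k) \<noteq> \<zero>\<^bsub>S\<^esub>}" using finsupp_finite[OF f] finite_subset by blast
    then show ?thesis using f \<theta>_zero \<theta>[OF \<kappa>_I[OF u]] by (simp add: finsupp_def)
  qed
  have \<tau>K: "k \<in> K \<Longrightarrow> \<tau> (snd k) \<in> carrier C" for k using K C_carrier by auto
  \<comment> \<open>\<theta> is applied to coordinates, so no expression of \<open>u\<close> as a
    sum of terms a p is chosen and there is no ambiguity to resolve. The price is that the formula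
    on terms a p has to be proved.\<close>
  define \<Theta> where "\<Theta> u = lincomb S C (\<lambda>k. \<tau> (snd k)) (\<lambda>k. \<theta> (\<kappa> u k))" for u
  show thesis
  proof (rule that)
    show "\<Theta> u \<in> carrier C" if "u \<in> IP" for u
      unfolding \<Theta>_def by (rule C.lincomb_closed[OF \<theta>\<kappa>_fin[OF that] \<tau>K])
    show "\<Theta> (u \<oplus>\<^bsub>P\<^esub> v) = \<Theta> u \<oplus>\<^bsub>C\<^esub> \<Theta> v" if "u \<in> IP" "v \<in> IP" for u v
    proof -
      have eq: "(\<lambda>k. \<theta> (\<kappa> (u \<oplus>\<^bsub>P\<^esub> v) k)) = (\<lambda>k. \<theta> (\<kappa> u k) \<oplus>\<^bsub>S\<^esub> \<theta> (\<kappa> v k))"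
        using that by (simp add: \<kappa>_add IP_closed \<theta>_add \<kappa>_I)
      show ?thesis unfolding \<Theta>_def eq
        by (rule C.lincomb_add[OF \<theta>\<kappa>_fin[OF that(1)] \<theta>\<kappa>_fin[OF that(2)] \<tau>K])
    qed
    fix a p assume a: "a \<in> I" and p: "p \<in> carrier P"
    have eq: "(\<lambda>k. \<theta> (\<kappa> (a \<odot>\<^bsub>P\<^esub> p) k)) = (\<lambda>k. \<theta> a \<otimes>\<^bsub>S\<^esub> \<rho> (\<kappa> p k))"
    proof
      fix k
      \<comment> \<open>Commuting the factors turns the coordinate of p into the scalar and leaves a
        as the argument of \<theta>, so that linearity of \<theta> over R applies.\<close>
      have "\<theta> (\<kappa> (a \<odot>\<^bsub>P\<^esub> p) k) = \<theta> (\<kappa> p k \<otimes>\<^bsub>R\<^esub> a)"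
        using a p \<kappa>_closed[OF p] by (simp add: \<kappa>_smult Icarr R.m_comm)
      then show "\<theta> (\<kappa> (a \<odot>\<^bsub>P\<^esub> p) k) = \<theta> a \<otimes>\<^bsub>S\<^esub> \<rho> (\<kappa> p k)"
        using a \<kappa>_closed[OF p] \<theta>[OF a] \<rho>_ops(1) by (simp add: \<theta>_smult S.m_comm)
    qed
    have \<tau>C: "x \<in> carrier P \<Longrightarrow> \<tau> x \<in> carrier C" for x using C_carrier by auto
    note hom = lincomb_hom[OF module_axioms C.module_axioms \<rho>_hom, of \<tau> K snd "\<kappa> p",
        OF \<tau>C \<tau>_add[symmetric] \<tau>_smult[symmetric] K \<kappa>_fin[OF p]]
    have "\<Theta> (a \<odot>\<^bsub>P\<^esub> p) = \<theta> a \<odot>\<^bsub>C\<^esub> lincomb S C (\<lambda>k. \<tau> (snd k)) (\<lambda>k. \<rho> (\<kappa> p k))"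
      unfolding \<Theta>_def eq by (rule C.lincomb_smult[OF \<theta>[OF a] hom(1) \<tau>K])
    also have "lincomb S C (\<lambda>k. \<tau> (snd k)) (\<lambda>k. \<rho> (\<kappa> p k)) = \<tau> (lincomb R P snd (\<kappa> p))"
      by (rule hom(2)[symmetric])
    also have "lincomb R P snd (\<kappa> p) = p" by (rule \<kappa>_sum[OF p, symmetric])
    finally show "\<Theta> (a \<odot>\<^bsub>P\<^esub> p) = \<theta> a \<odot>\<^bsub>C\<^esub> \<tau> p" .
  qed
qed

text \<open>\<Theta> has degree 0 and is linear over \<open>P\<close> on both sides, so the only
  sign in the derivation rule is the one in the Leibniz rule of \<open>P\<close>. That \<Theta>
  commutes with the differentials makes the map well defined on homology.\<close>

lemma bockstein:
  assumes \<theta>: "\<And>a. a \<in> I \<Longrightarrow> \<theta> a \<in> carrier S"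
    and \<theta>_add: "\<And>a b. \<lbrakk>a \<in> I; b \<in> I\<rbrakk> \<Longrightarrow> \<theta> (a \<oplus>\<^bsub>R\<^esub> b) = \<theta> a \<oplus>\<^bsub>S\<^esub> \<theta> b"
    and \<theta>_smult: "\<And>r a. \<lbrakk>r \<in> carrier R; a \<in> I\<rbrakk> \<Longrightarrow> \<theta> (r \<otimes>\<^bsub>R\<^esub> a) = \<rho> r \<otimes>\<^bsub>S\<^esub> \<theta> a"
  obtains D where "odd_derivation S H D"
    "\<And>a x. \<lbrakk>a \<in> I; x \<in> component P 1; \<delta> x = a \<odot>\<^bsub>P\<^esub> \<one>\<^bsub>P\<^esub>\<rbrakk> \<Longrightarrow> D (T x) = \<theta> a \<odot>\<^bsub>H\<^esub> \<one>\<^bsub>H\<^esub>"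
proof -
  obtain \<Theta> where \<Theta>: "\<And>u. u \<in> IP \<Longrightarrow> \<Theta> u \<in> carrier C"
    and \<Theta>_add: "\<And>u v. \<lbrakk>u \<in> IP; v \<in> IP\<rbrakk> \<Longrightarrow> \<Theta> (u \<oplus>\<^bsub>P\<^esub> v) = \<Theta> u \<oplus>\<^bsub>C\<^esub> \<Theta> v"
    and \<Theta>_gen: "\<And>a p. \<lbrakk>a \<in> I; p \<in> carrier P\<rbrakk> \<Longrightarrow> \<Theta> (a \<odot>\<^bsub>P\<^esub> p) = \<theta> a \<odot>\<^bsub>C\<^esub> \<tau> p"
    by (rule contraction[OF \<theta> \<theta>_add \<theta>_smult], assumption+, rule that)
  have \<tau>C: "x \<in> carrier P \<Longrightarrow> \<tau> x \<in> carrier C" for x using C_carrier by auto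
  have \<Theta>_step: "\<Theta> (a \<odot>\<^bsub>P\<^esub> p \<oplus>\<^bsub>P\<^esub> u) = \<theta> a \<odot>\<^bsub>C\<^esub> \<tau> p \<oplus>\<^bsub>C\<^esub> \<Theta> u"
    if "a \<in> I" "p \<in> carrier P" "u \<in> IP" for a p u
    using that by (simp add: \<Theta>_add \<Theta>_gen IP_generator)
  have \<Theta>_zero: "\<Theta> \<zero>\<^bsub>P\<^esub> = \<zero>\<^bsub>C\<^esub>"
    using \<Theta>_add[OF IP.zero IP.zero] \<Theta>[OF IP.zero] C.M.add.r_cancel_one'[of "\<Theta> \<zero>\<^bsub>P\<^esub>" "\<Theta> \<zero>\<^bsub>P\<^esub>"]
    by simp
  have \<Theta>_uminus: "\<Theta> (\<ominus>\<^bsub>P\<^esub> u) = \<ominus>\<^bsub>C\<^esub> \<Theta> u" if "u \<in> IP" for u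
    using \<Theta>_add[OF IP_uminus[OF that] that] \<Theta>_zero \<Theta> that IP_uminus
    by (intro C.M.minus_equality[symmetric]) (auto simp: M.l_neg IP_closed)
  have \<Theta>_differential: "\<Theta> (\<delta> u) = differential C (\<Theta> u)" if "u \<in> IP" for u
    using that
  proof (induction u rule: IP.induct)
    case zero
    show ?case using C_differential[of "\<zero>\<^bsub>P\<^esub>"] by (simp add: differential_zero \<Theta>_zero \<tau>_zero)
  next
    case (add a p u)
    then show ?case
      using \<Theta>_step[OF add(1) differential_closed[OF add(2)] IP_differential[OF add(3)]]
      by (simp add: \<Theta>_step differential_add differential_smult Icarr IP_closed C_differential_add
          C_differential_smult C_differential \<theta> \<tau>C \<Theta> C.smult_closed)
  qed
  have \<Theta>_mult_right: "\<Theta> (u \<otimes>\<^bsub>P\<^esub> y) = \<Theta> u \<otimes>\<^bsub>C\<^esub> \<tau> y" if "u \<in> IP" "y \<in> carrier P" for u y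
    using that(1)
  proof (induction u rule: IP.induct)
    case zero
    then show ?case using that(2) by (simp add: \<Theta>_zero \<tau>C)
  next
    case (add a p u)
    have "(a \<odot>\<^bsub>P\<^esub> p \<oplus>\<^bsub>P\<^esub> u) \<otimes>\<^bsub>P\<^esub> y = a \<odot>\<^bsub>P\<^esub> (p \<otimes>\<^bsub>P\<^esub> y) \<oplus>\<^bsub>P\<^esub> u \<otimes>\<^bsub>P\<^esub> y"
      using add that(2) by (simp add: A.l_distr smult_mult_left Icarr IP_closed)
    then show ?case
      using add that(2) IP_mult_right
      by (simp add: \<Theta>_step C.A.l_distr C.smult_mult_left \<theta> \<tau>C \<Theta> \<tau>_mult C.smult_closed)
  qed
  have \<Theta>_mult_left: "\<Theta> (y \<otimes>\<^bsub>P\<^esub> u) = \<tau> y \<otimes>\<^bsub>C\<^esub> \<Theta> u" if "u \<in> IP" "y \<in> carrier P" for u y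
    using that(1)
  proof (induction u rule: IP.induct)
    case zero
    then show ?case using that(2) by (simp add: \<Theta>_zero \<tau>C)
  next
    case (add a p u)
    have "y \<otimes>\<^bsub>P\<^esub> (a \<odot>\<^bsub>P\<^esub> p \<oplus>\<^bsub>P\<^esub> u) = a \<odot>\<^bsub>P\<^esub> (y \<otimes>\<^bsub>P\<^esub> p) \<oplus>\<^bsub>P\<^esub> y \<otimes>\<^bsub>P\<^esub> u"
      using add that(2) by (simp add: A.r_distr smult_mult_right Icarr IP_closed)
    then show ?case
      using add that(2) IP_mult_left
      by (simp add: \<Theta>_step C.A.r_distr C.smult_mult_right \<theta> \<tau>C \<Theta> \<tau>_mult C.smult_closed)
  qed
  \<comment> \<open>Rule induction on \<open>IP\<close> passes through inhomogeneous terms;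
    homogeneity of \<Theta> is therefore stated for the parts of an arbitrary element.\<close>
  have \<Theta>_part: "\<Theta> (part u n) \<in> component C n" if "u \<in> IP" for u n
    using that
  proof (induction u rule: IP.induct)
    case zero
    show ?case using part_homogeneous[OF component_zero[of 0]] C.component_zero by (simp add: \<Theta>_zero)
  next
    case (add a p u)
    have "\<tau> (part p n) \<in> component C n" using part_component[OF add(2)] C_component by auto
    then show ?case
      using add by (simp add: part_add part_smult Icarr IP_closed \<Theta>_step part_closed IP_part
          C.component_add C.component_smult \<theta>)
  qed
  \<comment> \<open>Values of \<Theta> lie in the complex, while \<open>T\<close> is applied to
    elements of \<open>P\<close>; this picks a representative.\<close>
  define \<theta>P where "\<theta>P u = (SOME p. p \<in> carrier P \<and> \<tau> p = \<Theta> u)" for u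
  have \<theta>P: "\<theta>P u \<in> carrier P" "\<tau> (\<theta>P u) = \<Theta> u" if "u \<in> IP" for u
  proof -
    have "\<exists>p. p \<in> carrier P \<and> \<tau> p = \<Theta> u" using \<Theta>[OF that] C_carrier by auto
    from someI_ex[OF this] show "\<theta>P u \<in> carrier P" "\<tau> (\<theta>P u) = \<Theta> u" by (auto simp: \<theta>P_def)
  qed
  define L where "L x = T (\<theta>P (\<delta> x))" for x
  \<comment> \<open>The differential of \<Theta>(\<open>\<delta> x\<close>) is \<Theta> of
    \<open>\<delta> (\<delta> x)\<close>, which is zero.\<close>
  have LZ: "\<theta>P (\<delta> x) \<in> Z" if x: "x \<in> Z" for x
  proof -
    note dx = Z_differential[OF x]
    have "\<tau> (\<delta> (\<theta>P (\<delta> x))) = \<Theta> (\<delta> (\<delta> x))"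
      using C_differential[OF \<theta>P(1)[OF dx]] \<Theta>_differential[OF dx] \<theta>P(2)[OF dx] by simp
    then show ?thesis
      using \<theta>P(1)[OF dx] Z_closed[OF x]
      by (simp add: Z_def \<Theta>_zero differential_differential \<tau>_zero_iff differential_closed)
  qed
  have L_eq: "L x = T p" if "x \<in> Z" "\<Theta> (\<delta> x) = \<tau> p" for x p
    unfolding L_def using \<theta>P(2)[OF Z_differential[OF that(1)]] that(2) by (intro T_cong) simp
  have L_cong: "L x = L y" if x: "x \<in> Z" and y: "y \<in> Z" and xy: "T x = T y" for x y
  proof -
    obtain w where w: "w \<in> carrier P" "\<tau> (x \<ominus>\<^bsub>P\<^esub> y) = \<tau> (\<delta> w)" using T_eq_iff x y xy by blast
    note c = Z_closed[OF x] Z_closed[OF y] differential_closed[OF w(1)]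
    \<comment> \<open>x and y agree up to a boundary modulo \<open>IP\<close>, and \<open>u\<close>
      is the error. Its differential is \<open>\<delta> x - \<delta> y\<close>, so
      \<Theta>(\<open>\<delta> u\<close>), the differential of \<Theta>(u), exhibits the difference
      of the two values as a boundary.\<close>
    define u where "u = (x \<ominus>\<^bsub>P\<^esub> y) \<ominus>\<^bsub>P\<^esub> \<delta> w"
    have u: "u \<in> IP" unfolding u_def using w c by (simp add: \<tau>_eq_iff)
    have du: "\<delta> u = \<delta> x \<ominus>\<^bsub>P\<^esub> \<delta> y"
      unfolding u_def using c w(1)
      by (simp add: differential_minus differential_differential differential_closed)
        (simp add: a_minus_def differential_closed)
    note dI = Z_differential[OF x] Z_differential[OF y]
    have "\<Theta> (\<delta> u) = \<Theta> (\<delta> x) \<oplus>\<^bsub>C\<^esub> \<ominus>\<^bsub>C\<^esub> \<Theta> (\<delta> y)"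
      unfolding du a_minus_def using dI by (simp add: \<Theta>_add IP_uminus \<Theta>_uminus)
    then have "\<tau> (\<theta>P (\<delta> x) \<ominus>\<^bsub>P\<^esub> \<theta>P (\<delta> y)) = \<tau> (\<delta> (\<theta>P u))"
      using \<Theta>_differential[OF u] \<theta>P[OF u] \<theta>P[OF dI(1)] \<theta>P[OF dI(2)] C_differential[of "\<theta>P u"]
      by (simp add: a_minus_def \<tau>_add[symmetric] \<tau>_uminus[symmetric])
    then show ?thesis unfolding L_def using T_eq_iff[OF LZ[OF x] LZ[OF y]] \<theta>P(1)[OF u] by blast
  qed
  obtain D where D: "\<And>x. x \<in> Z \<Longrightarrow> D (T x) = L x"
    using factor_through_image[OF H_ops(1), of L] L_cong by metis
  note Zs = submoduleE(4,5)[OF Z_submodule]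
  have "odd_derivation S H D"
  proof (intro odd_derivation.intro pregraded_H odd_derivation_axioms.intro)
    fix u assume "u \<in> carrier H"
    then show "D u \<in> carrier H" using H_ops(1) D LZ by (auto simp: L_def)
  next
    fix u v assume "u \<in> carrier H" "v \<in> carrier H"
    then obtain x y where xy: "x \<in> Z" "y \<in> Z" "u = T x" "v = T y" using H_ops(1) by auto
    note dI = Z_differential[OF xy(1)] Z_differential[OF xy(2)]
    have "\<Theta> (\<delta> (x \<oplus>\<^bsub>P\<^esub> y)) = \<tau> (\<theta>P (\<delta> x) \<oplus>\<^bsub>P\<^esub> \<theta>P (\<delta> y))"
      using xy dI \<theta>P[OF dI(1)] \<theta>P[OF dI(2)]
      by (simp add: differential_add Z_closed \<Theta>_add \<tau>_add[symmetric])
    then have "L (x \<oplus>\<^bsub>P\<^esub> y) = L x \<oplus>\<^bsub>H\<^esub> L y"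
      using L_eq[OF Zs(2)[OF xy(1,2)]] T_add[OF LZ[OF xy(1)] LZ[OF xy(2)]] by (simp add: L_def)
    then show "D (u \<oplus>\<^bsub>H\<^esub> v) = D u \<oplus>\<^bsub>H\<^esub> D v" using xy Zs(2) by (simp add: T_add D)
  next
    fix s u assume "s \<in> carrier S" "u \<in> carrier H"
    then obtain r x where rx: "r \<in> carrier R" "s = \<rho> r" "x \<in> Z" "u = T x"
      using H_ops(1) quot_carrier by auto
    note dI = Z_differential[OF rx(3)]
    \<comment> \<open>A scalar acts as left multiplication by r 1, which reduces linearity to
      \<open>\<Theta>_mult_left\<close>.\<close>
    have "\<Theta> (r \<odot>\<^bsub>P\<^esub> v) = \<rho> r \<odot>\<^bsub>C\<^esub> \<Theta> v" if "v \<in> IP" for v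
      using \<Theta>_mult_left[OF that, of "r \<odot>\<^bsub>P\<^esub> \<one>\<^bsub>P\<^esub>"] rx(1) IP_closed[OF that] \<Theta>[OF that]
        \<rho>_ops(1)[OF rx(1)]
      by (simp add: smult_mult_left \<tau>_smult[symmetric] C_ops(3)[symmetric] C.smult_mult_left)
    then have "\<Theta> (\<delta> (r \<odot>\<^bsub>P\<^esub> x)) = \<tau> (r \<odot>\<^bsub>P\<^esub> \<theta>P (\<delta> x))"
      using rx dI \<theta>P[OF dI] by (simp add: differential_smult Z_closed \<tau>_smult[symmetric])
    then have "L (r \<odot>\<^bsub>P\<^esub> x) = \<rho> r \<odot>\<^bsub>H\<^esub> L x"
      using L_eq[OF Zs(1)[OF rx(1,3)]] T_smult[OF rx(1) LZ[OF rx(3)]] by (simp add: L_def)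
    then show "D (s \<odot>\<^bsub>H\<^esub> u) = s \<odot>\<^bsub>H\<^esub> D u" using rx Zs(1) by (simp add: T_smult D)
  next
    fix u assume "u \<in> component H 0"
    then obtain x where x: "x \<in> Z" "x \<in> component P 0" "u = T x" using H_component by auto
    then have "L x = T \<zero>\<^bsub>P\<^esub>" by (intro L_eq) (auto simp: differential_0 \<Theta>_zero \<tau>_zero)
    then show "D u = \<zero>\<^bsub>H\<^esub>" using x by (simp add: D H_ops(2))
  next
    fix u n assume "u \<in> component H (Suc n)"
    then obtain x where x: "x \<in> Z" "x \<in> component P (Suc n)" "u = T x" using H_component by auto
    \<comment> \<open>The representative chosen by \<open>\<theta>P\<close> may be inhomogeneous.
      The degree is read off from \<Theta>, and a homogeneous representative \<open>p\<close> of the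
      same value replaces it.\<close>
    have "part (\<delta> x) n = \<delta> x" using part_homogeneous[OF differential_Suc[OF x(2)]] by simp
    then have "\<Theta> (\<delta> x) \<in> component C n" using \<Theta>_part[OF Z_differential[OF x(1)], of n] by simp
    then obtain p where p: "p \<in> component P n" "\<Theta> (\<delta> x) = \<tau> p" using C_component by auto
    have "\<tau> (\<theta>P (\<delta> x)) = \<tau> p" using \<theta>P(2)[OF Z_differential[OF x(1)]] p(2) by simp
    then have "p \<in> Z" using \<tau>_cong_Z[OF LZ[OF x(1)] component_closed[OF p(1)]] by blast
    then show "D u \<in> component H n" using x p D L_eq[OF x(1) p(2)] H_component by auto
  next
    fix u v m assume "u \<in> component H m" "v \<in> carrier H"
    then obtain x y where xy: "x \<in> Z" "y \<in> Z" "u = T x" "v = T y" and x: "x \<in> component P m"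
      using H_ops(1) H_component by auto
    note dI = Z_differential[OF xy(1)] Z_differential[OF xy(2)]
    note c = Z_closed[OF xy(1)] Z_closed[OF xy(2)] \<theta>P(1)[OF dI(1)] \<theta>P(1)[OF dI(2)]
    have 1: "\<Theta> (\<delta> x \<otimes>\<^bsub>P\<^esub> y) = \<tau> (\<theta>P (\<delta> x) \<otimes>\<^bsub>P\<^esub> y)"
      using c \<theta>P(2)[OF dI(1)] by (simp add: \<Theta>_mult_right[OF dI(1)] \<tau>_mult[symmetric])
    have 2: "\<Theta> (x \<otimes>\<^bsub>P\<^esub> \<delta> y) = \<tau> (x \<otimes>\<^bsub>P\<^esub> \<theta>P (\<delta> y))"
      using c \<theta>P(2)[OF dI(2)] by (simp add: \<Theta>_mult_left[OF dI(2)] \<tau>_mult[symmetric])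
    have IPs: "\<delta> x \<otimes>\<^bsub>P\<^esub> y \<in> IP" "x \<otimes>\<^bsub>P\<^esub> \<delta> y \<in> IP"
      using dI c by (auto intro: IP_mult_left IP_mult_right)
    have "\<Theta> (\<delta> (x \<otimes>\<^bsub>P\<^esub> y)) = \<tau> (\<theta>P (\<delta> x) \<otimes>\<^bsub>P\<^esub> y \<oplus>\<^bsub>P\<^esub>
        (if even m then x \<otimes>\<^bsub>P\<^esub> \<theta>P (\<delta> y) else \<ominus>\<^bsub>P\<^esub> (x \<otimes>\<^bsub>P\<^esub> \<theta>P (\<delta> y))))"
      using Leibniz[OF x c(2)] IPs c
      by (simp add: \<Theta>_add IP_uminus \<Theta>_uminus 1 2 \<tau>_add[symmetric] \<tau>_uminus[symmetric])
    from L_eq[OF Z_mult[OF xy(1,2)] this]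
    have "L (x \<otimes>\<^bsub>P\<^esub> y) = T (\<theta>P (\<delta> x) \<otimes>\<^bsub>P\<^esub> y \<oplus>\<^bsub>P\<^esub>
        (if even m then x \<otimes>\<^bsub>P\<^esub> \<theta>P (\<delta> y) else \<ominus>\<^bsub>P\<^esub> (x \<otimes>\<^bsub>P\<^esub> \<theta>P (\<delta> y))))" .
    moreover have Zp: "\<theta>P (\<delta> x) \<otimes>\<^bsub>P\<^esub> y \<in> Z" "x \<otimes>\<^bsub>P\<^esub> \<theta>P (\<delta> y) \<in> Z" "\<ominus>\<^bsub>P\<^esub> (x \<otimes>\<^bsub>P\<^esub> \<theta>P (\<delta> y)) \<in> Z"
      using Z_mult xy LZ submoduleE(3)[OF Z_submodule] by auto
    moreover have "T (\<ominus>\<^bsub>P\<^esub> z) = \<ominus>\<^bsub>H\<^esub> T z" if z: "z \<in> Z" for z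
    proof -
      have z': "\<ominus>\<^bsub>P\<^esub> z \<in> Z" using submoduleE(3)[OF Z_submodule z] .
      show ?thesis
        using T_add[OF z' z] z z' H_ops(1,2) Z_closed[OF z]
        by (intro H.M.minus_equality[symmetric]) (auto simp: M.l_neg)
    qed
    ultimately have "L (x \<otimes>\<^bsub>P\<^esub> y) = L x \<otimes>\<^bsub>H\<^esub> T y \<oplus>\<^bsub>H\<^esub>
       (if even m then T x \<otimes>\<^bsub>H\<^esub> L y else \<ominus>\<^bsub>H\<^esub> (T x \<otimes>\<^bsub>H\<^esub> L y))"
      using xy LZ T_add[OF Zp(1,2), symmetric] T_add[OF Zp(1,3), symmetric]
      by (simp add: L_def T_mult)
    then show "D (u \<otimes>\<^bsub>H\<^esub> v) = D u \<otimes>\<^bsub>H\<^esub> v \<oplus>\<^bsub>H\<^esub>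
       (if even m then u \<otimes>\<^bsub>H\<^esub> D v else \<ominus>\<^bsub>H\<^esub> (u \<otimes>\<^bsub>H\<^esub> D v))"
      using xy Z_mult by (simp add: T_mult D)
  qed
  moreover have "D (T x) = \<theta> a \<odot>\<^bsub>H\<^esub> \<one>\<^bsub>H\<^esub>"
    if a: "a \<in> I" and x: "x \<in> component P 1" "\<delta> x = a \<odot>\<^bsub>P\<^esub> \<one>\<^bsub>P\<^esub>" for a x
  proof -
    have xZ: "x \<in> Z" using x component_closed a by (auto simp: Z_def intro: IP_generator)
    obtain t where t: "t \<in> carrier R" "\<theta> a = \<rho> t" using \<theta>[OF a] quot_carrier by auto
    have "\<Theta> (\<delta> x) = \<tau> (t \<odot>\<^bsub>P\<^esub> \<one>\<^bsub>P\<^esub>)" using t x(2) a by (simp add: \<Theta>_gen \<tau>_smult)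
    from L_eq[OF xZ this] show ?thesis
      using t xZ T_smult[OF t(1) Z_one] by (simp add: D H_ops(3))
  qed
  ultimately show thesis by (rule that)
qed

end


section \<open>The natural map\<close>

text \<open>The module axioms for I/I^2 are carried as an assumption; the freeness hypothesis of the
  theorem contains them.\<close>

locale conormal_resolution = dg_algebra_resolution +
  assumes module_conormal: "module (R Quot I) (conormal_module R I)"
begin

abbreviation "M \<equiv> conormal_module R I"
abbreviation "II \<equiv> I \<cdot>\<^bsub>R\<^esub> I"
abbreviation "\<mu> a \<equiv> II +>\<^bsub>R\<^esub> a"

sublocale X: exterior S M
  by (rule exterior.intro) (rule module_conormal)

section \<open>The conormal module and lifts of its elements to degree 1\<close>

lemma ideal_II: "ideal II R"
  by (rule R.ideal_prod_is_ideal[OF is_ideal is_ideal])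

sublocale II: ideal II R by (rule ideal_II)

lemma M_carrier: "carrier M = \<mu> ` I"
  by (simp add: conormal_module_def)

lemma \<mu>_add: "\<lbrakk>a \<in> I; b \<in> I\<rbrakk> \<Longrightarrow> \<mu> a \<oplus>\<^bsub>M\<^esub> \<mu> b = \<mu> (a \<oplus>\<^bsub>R\<^esub> b)"
  by (simp add: conormal_module_def II.a_rcos_sum Icarr)

lemma II_I: "i \<in> II \<Longrightarrow> i \<in> I"
  using R.ideal_prod_inter[OF is_ideal is_ideal] by blast

text \<open>The definition is a union over both cosets. The inner one collapses because I^2 is an
  ideal, the outer one because the product of an element of I with a is in I^2.\<close>

lemma \<mu>_smult:
  assumes r: "r \<in> carrier R" and a: "a \<in> I"
  shows "\<rho> r \<odot>\<^bsub>M\<^esub> \<mu> a = \<mu> (r \<otimes>\<^bsub>R\<^esub> a)"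
proof -
  note ac = Icarr[OF a]
  have "\<rho> r \<odot>\<^bsub>M\<^esub> \<mu> a = (\<Union>x\<in>\<rho> r. \<Union>y\<in>\<mu> a. \<mu> (x \<otimes>\<^bsub>R\<^esub> y))"
    by (simp add: conormal_module_def rcoset_mult_def)
  also have "\<dots> = (\<Union>x\<in>\<rho> r. \<mu> (x \<otimes>\<^bsub>R\<^esub> a))"
  proof (intro SUP_cong refl)
    fix x assume "x \<in> \<rho> r"
    then have x: "x \<in> carrier R" using R.a_r_coset_subset_G[OF a_subset r] by blast
    show "(\<Union>y\<in>\<mu> a. \<mu> (x \<otimes>\<^bsub>R\<^esub> y)) = \<mu> (x \<otimes>\<^bsub>R\<^esub> a)"
    proof (rule II.UN_coset[OF ac])
      fix y assume y: "y \<in> carrier R" "y \<ominus>\<^bsub>R\<^esub> a \<in> II"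
      have "x \<otimes>\<^bsub>R\<^esub> y \<ominus>\<^bsub>R\<^esub> x \<otimes>\<^bsub>R\<^esub> a = x \<otimes>\<^bsub>R\<^esub> (y \<ominus>\<^bsub>R\<^esub> a)"
        using x y ac by (simp add: a_minus_def R.r_distr R.r_minus)
      then show "\<mu> (x \<otimes>\<^bsub>R\<^esub> y) = \<mu> (x \<otimes>\<^bsub>R\<^esub> a)"
        using x y ac II.I_l_closed[OF y(2) x] by (simp add: II.quot_eq)
    qed
  qed
  also have "\<dots> = \<mu> (r \<otimes>\<^bsub>R\<^esub> a)"
  proof (rule UN_coset[OF r])
    fix x assume x: "x \<in> carrier R" "x \<ominus>\<^bsub>R\<^esub> r \<in> I"
    have "x \<otimes>\<^bsub>R\<^esub> a \<ominus>\<^bsub>R\<^esub> r \<otimes>\<^bsub>R\<^esub> a = (x \<ominus>\<^bsub>R\<^esub> r) \<otimes>\<^bsub>R\<^esub> a"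
      using x r ac by (simp add: a_minus_def R.l_distr R.l_minus)
    then show "\<mu> (x \<otimes>\<^bsub>R\<^esub> a) = \<mu> (r \<otimes>\<^bsub>R\<^esub> a)"
      using x r ac ideal_prod.prod[OF x(2) a] by (simp add: II.quot_eq)
  qed
  finally show ?thesis .
qed

text \<open>An element a of I is represented in degree 0 by a 1, which the augmentation kills;
  exactness at degree 0 then provides the lift.\<close>

lemma lift_exists:
  assumes a: "a \<in> I"
  obtains x where "x \<in> component P 1" "\<delta> x = a \<odot>\<^bsub>P\<^esub> \<one>\<^bsub>P\<^esub>"
proof -
  have "a \<odot>\<^bsub>P\<^esub> \<one>\<^bsub>P\<^esub> \<in> {x \<in> component P 0. \<epsilon> x = \<zero>\<^bsub>S\<^esub>}"
    using a component_smult[OF Icarr[OF a] one_component]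
    by (simp add: augmentation_smult Icarr \<rho>_I augmentation_closed)
  then have "a \<odot>\<^bsub>P\<^esub> \<one>\<^bsub>P\<^esub> \<in> \<delta> ` component P 1" using exact_0 by blast
  then show thesis using that by auto
qed

lemma lift_Z: "\<lbrakk>a \<in> I; x \<in> component P 1; \<delta> x = a \<odot>\<^bsub>P\<^esub> \<one>\<^bsub>P\<^esub>\<rbrakk> \<Longrightarrow> x \<in> Z"
  using component_closed by (auto simp: Z_def intro: IP_generator)

text \<open>A product i j of elements of I lifts to i x, where x is a lift of j, and i x lies in
  \<open>IP\<close>. This is why I^2 disappears in Tor.\<close>

lemma lift_II: "s \<in> II \<Longrightarrow> \<exists>y \<in> component P 1. y \<in> IP \<and> \<delta> y = s \<odot>\<^bsub>P\<^esub> \<one>\<^bsub>P\<^esub>"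
proof (induction s rule: ideal_prod.induct)
  case (prod i j)
  obtain x where x: "x \<in> component P 1" "\<delta> x = j \<odot>\<^bsub>P\<^esub> \<one>\<^bsub>P\<^esub>" using lift_exists[OF prod(2)] .
  show ?case
    using x prod component_closed[OF x(1)]
    by (intro bexI[of _ "i \<odot>\<^bsub>P\<^esub> x"])
      (auto simp: IP_generator differential_smult Icarr smult_assoc1 component_smult)
next
  case (sum s t)
  then obtain y z where "y \<in> component P 1" "y \<in> IP" "\<delta> y = s \<odot>\<^bsub>P\<^esub> \<one>\<^bsub>P\<^esub>"
    "z \<in> component P 1" "z \<in> IP" "\<delta> z = t \<odot>\<^bsub>P\<^esub> \<one>\<^bsub>P\<^esub>" by blast
  then show ?case
    using II_I[OF sum(1)] II_I[OF sum(2)]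
    by (intro bexI[of _ "y \<oplus>\<^bsub>P\<^esub> z"])
      (auto simp: IP_plus differential_add IP_closed component_add smult_l_distr Icarr)
qed

text \<open>After subtracting a lift \<open>z\<close> of a - b inside \<open>IP\<close>, the
  difference of the two lifts is a cycle of \<open>P\<close> in degree 1, hence a boundary by
  exactness.\<close>

lemma T_lift_cong:
  assumes a: "a \<in> I" "b \<in> I" "\<mu> a = \<mu> b"
    and x: "x \<in> component P 1" "\<delta> x = a \<odot>\<^bsub>P\<^esub> \<one>\<^bsub>P\<^esub>"
    and y: "y \<in> component P 1" "\<delta> y = b \<odot>\<^bsub>P\<^esub> \<one>\<^bsub>P\<^esub>"
  shows "T x = T y"
proof -
  have ac: "a \<in> carrier R" "b \<in> carrier R" using a Icarr by auto
  have "a \<ominus>\<^bsub>R\<^esub> b \<in> II" using a ac by (simp add: II.quot_eq)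
  then obtain z where z: "z \<in> component P 1" "z \<in> IP" "\<delta> z = (a \<ominus>\<^bsub>R\<^esub> b) \<odot>\<^bsub>P\<^esub> \<one>\<^bsub>P\<^esub>"
    using lift_II by blast
  note c = component_closed[OF x(1)] component_closed[OF y(1)] component_closed[OF z(1)]
  have comp: "(x \<ominus>\<^bsub>P\<^esub> y) \<ominus>\<^bsub>P\<^esub> z \<in> component P (Suc 0)"
    using x y z by (simp add: a_minus_def component_add component_uminus)
  have dz: "\<delta> z = \<delta> x \<ominus>\<^bsub>P\<^esub> \<delta> y"
    unfolding z(3) x(2) y(2) using ac by (simp add: a_minus_def smult_l_distr smult_l_minus)
  have "\<delta> ((x \<ominus>\<^bsub>P\<^esub> y) \<ominus>\<^bsub>P\<^esub> z) = \<zero>\<^bsub>P\<^esub>"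
    using c by (simp add: differential_minus dz differential_closed)
  then obtain w where w: "w \<in> component P (Suc (Suc 0))" "(x \<ominus>\<^bsub>P\<^esub> y) \<ominus>\<^bsub>P\<^esub> z = \<delta> w"
    using exact_Suc[of 0] comp by blast
  have wc: "w \<in> carrier P" "\<delta> w \<in> carrier P"
    using component_closed[OF w(1)] differential_closed by auto
  have cancel: "v \<ominus>\<^bsub>P\<^esub> (v \<ominus>\<^bsub>P\<^esub> z) = z" if "v \<in> carrier P" "z \<in> carrier P" for v z
    using that by (simp add: a_minus_def M.minus_add M.r_neg2)
  have "(x \<ominus>\<^bsub>P\<^esub> y) \<ominus>\<^bsub>P\<^esub> \<delta> w = z"
    unfolding w(2)[symmetric] by (rule cancel) (use c in auto)
  then have "\<tau> (x \<ominus>\<^bsub>P\<^esub> y) = \<tau> (\<delta> w)" using z(2) c wc by (simp add: \<tau>_eq_iff)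
  then show ?thesis using T_eq_iff lift_Z a x y wc by blast
qed

text \<open>Discharges the definite description. The class of a lift depends on a modulo I^2 only,
  which gives a linear map on I/I^2 and, by the universal property, an algebra map. Uniqueness holds
  because the exterior algebra is generated in degree 1.\<close>

lemma natural_map:
  shows natural_map_hom: "natural_map R I P \<in> graded_algebra_hom S X.E H"
    and natural_map_incl: "\<And>a x. \<lbrakk>a \<in> I; x \<in> component P 1; \<delta> x = a \<odot>\<^bsub>P\<^esub> \<one>\<^bsub>P\<^esub>\<rbrakk>
      \<Longrightarrow> natural_map R I P (X.\<iota> (\<mu> a)) = T x"
proof -
  define lift where "lift a = (SOME x. x \<in> component P 1 \<and> \<delta> x = a \<odot>\<^bsub>P\<^esub> \<one>\<^bsub>P\<^esub>)" for a
  have lift: "lift a \<in> component P 1" "\<delta> (lift a) = a \<odot>\<^bsub>P\<^esub> \<one>\<^bsub>P\<^esub>" if a: "a \<in> I" for a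
  proof -
    obtain x where "x \<in> component P 1" "\<delta> x = a \<odot>\<^bsub>P\<^esub> \<one>\<^bsub>P\<^esub>" using lift_exists[OF a] .
    then have "\<exists>x. x \<in> component P 1 \<and> \<delta> x = a \<odot>\<^bsub>P\<^esub> \<one>\<^bsub>P\<^esub>" by blast
    from someI_ex[OF this] show "lift a \<in> component P 1" "\<delta> (lift a) = a \<odot>\<^bsub>P\<^esub> \<one>\<^bsub>P\<^esub>"
      by (auto simp: lift_def)
  qed
  have Tlift: "T (lift a) = T x" if "a \<in> I" "x \<in> component P 1" "\<delta> x = a \<odot>\<^bsub>P\<^esub> \<one>\<^bsub>P\<^esub>" for a x
    by (rule T_lift_cong[of a a]) (use that lift in auto)
  obtain g where "g \<in> extensional (carrier M)" and g: "\<And>a. a \<in> I \<Longrightarrow> g (\<mu> a) = T (lift a)"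
  proof (rule factor_through_image[OF M_carrier, of "\<lambda>a. T (lift a)"])
    show "T (lift a) = T (lift b)" if "a \<in> I" "b \<in> I" "\<mu> a = \<mu> b" for a b
      by (rule T_lift_cong[OF that]) (use that lift in auto)
  qed (rule that)
  have g': "g (\<mu> a) = T x" if "a \<in> I" "x \<in> component P 1" "\<delta> x = a \<odot>\<^bsub>P\<^esub> \<one>\<^bsub>P\<^esub>" for a x
    using g Tlift that by simp
  note lc = component_closed[OF lift(1)]
  obtain \<nu> where \<nu>: "\<nu> \<in> graded_algebra_hom S X.E H" "\<nu> \<in> extensional (carrier X.E)"
    "\<And>m. m \<in> carrier M \<Longrightarrow> \<nu> (X.\<iota> m) = g m"
  proof (rule X.exterior_universal[OF pregraded_H, of g])
    fix m assume "m \<in> carrier M"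
    then obtain a where a: "a \<in> I" "m = \<mu> a" using M_carrier by auto
    show "g m \<in> component H 1" using a lift[OF a(1)] lift_Z g H_component by auto
    have z: "lift a \<in> Z" using lift[OF a(1)] lift_Z a by blast
    \<comment> \<open>The square is zero already in \<open>P\<close>, by the strict form of
      graded-commutativity; the sign rule alone would give only that twice the square is
      zero.\<close>
    have "lift a \<otimes>\<^bsub>P\<^esub> lift a = \<zero>\<^bsub>P\<^esub>" using odd_square[of 1] lift[OF a(1)] by simp
    then show "g m \<otimes>\<^bsub>H\<^esub> g m = \<zero>\<^bsub>H\<^esub>" using a z by (simp add: g T_mult H_ops(2))
  next
    fix m m' assume "m \<in> carrier M" "m' \<in> carrier M"
    then obtain a b where ab: "a \<in> I" "b \<in> I" "m = \<mu> a" "m' = \<mu> b" using M_carrier by auto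
    \<comment> \<open>The sum of the chosen lifts is one lift of a + b, and by \<open>g'\<close>
      every lift yields the same class. Scalars are treated in the same way below.\<close>
    have "g (\<mu> (a \<oplus>\<^bsub>R\<^esub> b)) = T (lift a \<oplus>\<^bsub>P\<^esub> lift b)"
      using ab lift lc
      by (intro g') (auto simp: component_add differential_add smult_l_distr Icarr)
    then show "g (m \<oplus>\<^bsub>M\<^esub> m') = g m \<oplus>\<^bsub>H\<^esub> g m'"
      using ab lift lift_Z by (simp add: \<mu>_add g T_add)
  next
    fix s m assume "s \<in> carrier S" "m \<in> carrier M"
    then obtain r a where ra: "r \<in> carrier R" "a \<in> I" "s = \<rho> r" "m = \<mu> a"
      using M_carrier quot_carrier by auto
    have "g (\<mu> (r \<otimes>\<^bsub>R\<^esub> a)) = T (r \<odot>\<^bsub>P\<^esub> lift a)"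
      using ra lift lc
      by (intro g') (auto simp: component_smult differential_smult smult_assoc1 Icarr I_l_closed)
    then show "g (s \<odot>\<^bsub>M\<^esub> m) = s \<odot>\<^bsub>H\<^esub> g m"
      using ra lift lift_Z by (simp add: \<mu>_smult g T_smult)
  qed (rule that)
  define Q where "Q \<nu> \<longleftrightarrow> \<nu> \<in> graded_algebra_hom S X.E H \<and> \<nu> \<in> extensional (carrier X.E) \<and>
    (\<forall>a\<in>I. \<forall>x\<in>component P 1. \<delta> x = a \<odot>\<^bsub>P\<^esub> \<one>\<^bsub>P\<^esub> \<longrightarrow> \<nu> (X.\<iota> (\<mu> a)) = T x)" for \<nu>
  have "Q \<nu>" unfolding Q_def using \<nu> g' M_carrier by auto
  moreover have "\<nu>' = \<nu>" if "Q \<nu>'" for \<nu>'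
  proof
    fix u
    show "\<nu>' u = \<nu> u"
    proof (cases "u \<in> carrier X.E")
      case True
      show ?thesis
      proof (rule X.exterior_hom_eqI[OF H.assoc_algebra_axioms _ \<nu>(1) _ True])
        show "\<nu>' \<in> graded_algebra_hom S X.E H" using that by (simp add: Q_def)
        fix m assume "m \<in> carrier M"
        then obtain a where a: "a \<in> I" "m = \<mu> a" using M_carrier by auto
        then show "\<nu>' (X.\<iota> m) = \<nu> (X.\<iota> m)"
          using that lift[OF a(1)] \<nu>(3) g M_carrier unfolding Q_def by auto
      qed
    next
      case False
      then show ?thesis using that \<nu>(2) by (simp add: Q_def extensional_def)
    qed
  qed
  ultimately have "Q (THE \<nu>. Q \<nu>)" by (rule theI)
  moreover have "natural_map R I P = (THE \<nu>. Q \<nu>)"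
    unfolding natural_map_def Let_def Q_def ..
  ultimately have "Q (natural_map R I P)" by simp
  then show "natural_map R I P \<in> graded_algebra_hom S X.E H"
    "\<And>a x. \<lbrakk>a \<in> I; x \<in> component P 1; \<delta> x = a \<odot>\<^bsub>P\<^esub> \<one>\<^bsub>P\<^esub>\<rbrakk>
      \<Longrightarrow> natural_map R I P (X.\<iota> (\<mu> a)) = T x"
    unfolding Q_def by auto
qed

text \<open>The basis supplies the coordinate functionals, and the Noetherian property cuts it down
  to a finite set outside which they vanish, so that there are finitely many factors to
  compose.\<close>

lemma natural_map_splits:
  assumes noeth: "noetherian_ring R" and basis: "module_basis S M Bs"
  shows "\<exists>\<psi> \<in> graded_algebra_hom S H X.E. \<forall>u\<in>carrier X.E. \<psi> (natural_map R I P u) = u"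
proof -
  obtain \<kappa> where
    \<kappa>_fin: "\<And>m. m \<in> carrier M \<Longrightarrow> \<kappa> m \<in> finsupp S Bs" and
    \<kappa>_sum: "\<And>m. m \<in> carrier M \<Longrightarrow> m = lincomb S M (\<lambda>b. b) (\<kappa> m)" and
    \<kappa>_add: "\<And>m m'. m \<in> carrier M \<Longrightarrow> m' \<in> carrier M \<Longrightarrow> \<kappa> (m \<oplus>\<^bsub>M\<^esub> m') = (\<lambda>b. \<kappa> m b \<oplus>\<^bsub>S\<^esub> \<kappa> m' b)" and
    \<kappa>_smult: "\<And>s m. s \<in> carrier S \<Longrightarrow> m \<in> carrier M \<Longrightarrow> \<kappa> (s \<odot>\<^bsub>M\<^esub> m) = (\<lambda>b. s \<otimes>\<^bsub>S\<^esub> \<kappa> m b)"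
    by (rule module_basis_coordinates[OF module_conormal basis], rule that)
  have BsM: "b \<in> Bs \<Longrightarrow> b \<in> carrier M" for b using basis by (auto simp: module_basis_def)
  have \<mu>M: "a \<in> I \<Longrightarrow> \<mu> a \<in> carrier M" for a using M_carrier by auto
  define \<theta> where "\<theta> b a = \<kappa> (\<mu> a) b" for b a
  have \<theta>: "\<theta> b a \<in> carrier S" if "a \<in> I" for a b
    unfolding \<theta>_def using S.finsupp_closed[OF \<kappa>_fin[OF \<mu>M[OF that]]] .
  have \<theta>_add: "\<theta> b (a \<oplus>\<^bsub>R\<^esub> a') = \<theta> b a \<oplus>\<^bsub>S\<^esub> \<theta> b a'" if "a \<in> I" "a' \<in> I" for a a' b
    unfolding \<theta>_def using that by (simp add: \<mu>_add[symmetric] \<kappa>_add \<mu>M)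
  have \<theta>_smult: "\<theta> b (r \<otimes>\<^bsub>R\<^esub> a) = \<rho> r \<otimes>\<^bsub>S\<^esub> \<theta> b a" if "r \<in> carrier R" "a \<in> I" for r a b
    unfolding \<theta>_def using that \<rho>_ops(1) by (simp add: \<mu>_smult[symmetric] \<kappa>_smult \<mu>M)
  obtain A where A: "A \<subseteq> carrier R" "finite A" "I = Idl\<^bsub>R\<^esub> A"
    using noetherian_ring.finetely_gen[OF noeth is_ideal] by blast
  have AI: "A \<subseteq> I" using R.genideal_self[OF A(1)] A(3) by simp
  \<comment> \<open>The basis elements that occur in the expansion of some generator of I: a finite
    union of finite supports.\<close>
  define B0 where "B0 = (\<Union>a\<in>A. {b. \<theta> b a \<noteq> \<zero>\<^bsub>S\<^esub>})"
  have B0: "finite B0" "B0 \<subseteq> Bs"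
    unfolding B0_def \<theta>_def using A(2) AI finsupp_finite[OF \<kappa>_fin[OF \<mu>M]] finsupp_support[OF \<kappa>_fin[OF \<mu>M]]
    by (blast, blast)
  have \<theta>_B0: "\<theta> b a = \<zero>\<^bsub>S\<^esub>" if b: "b \<notin> B0" and a: "a \<in> I" for a b
  proof -
    have \<theta>0: "\<theta> b \<zero>\<^bsub>R\<^esub> = \<zero>\<^bsub>S\<^esub>"
      using \<theta>_smult[of "\<zero>\<^bsub>R\<^esub>" "\<zero>\<^bsub>R\<^esub>" b] \<theta>[of "\<zero>\<^bsub>R\<^esub>" b] \<rho>_I[of "\<zero>\<^bsub>R\<^esub>"] by simp
    \<comment> \<open>The zeros of a functional form an ideal, because \<theta> is linear over R.
      For b outside \<open>B0\<close> it contains the generators of I, hence all of I.\<close>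
    have "ideal {a \<in> I. \<theta> b a = \<zero>\<^bsub>S\<^esub>} R"
    proof (rule idealI[OF R.ring_axioms])
      show "subgroup {a \<in> I. \<theta> b a = \<zero>\<^bsub>S\<^esub>} (add_monoid R)"
      proof (rule R.add.subgroupI)
        have "\<zero>\<^bsub>R\<^esub> \<in> {a \<in> I. \<theta> b a = \<zero>\<^bsub>S\<^esub>}" using \<theta>0 by simp
        then show "{a \<in> I. \<theta> b a = \<zero>\<^bsub>S\<^esub>} \<noteq> {}" by blast
        show "\<ominus>\<^bsub>R\<^esub> a \<in> {a \<in> I. \<theta> b a = \<zero>\<^bsub>S\<^esub>}" if "a \<in> {a \<in> I. \<theta> b a = \<zero>\<^bsub>S\<^esub>}" for a
          using that \<theta>_smult[of "\<ominus>\<^bsub>R\<^esub> \<one>\<^bsub>R\<^esub>" a b] \<rho>_ops(1)[of "\<ominus>\<^bsub>R\<^esub> \<one>\<^bsub>R\<^esub>"]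
          by (simp add: Icarr R.l_minus)
      qed (use \<theta>0 in \<open>auto simp: Icarr \<theta>_add\<close>)
      fix a x assume a: "a \<in> {a \<in> I. \<theta> b a = \<zero>\<^bsub>S\<^esub>}" and x: "x \<in> carrier R"
      then show "x \<otimes>\<^bsub>R\<^esub> a \<in> {a \<in> I. \<theta> b a = \<zero>\<^bsub>S\<^esub>}"
        using \<theta>_smult[of x a b] \<rho>_ops(1)[OF x] by (simp add: I_l_closed)
      then show "a \<otimes>\<^bsub>R\<^esub> x \<in> {a \<in> I. \<theta> b a = \<zero>\<^bsub>S\<^esub>}"
        using a x by (simp add: R.m_comm Icarr)
    qed
    moreover have "A \<subseteq> {a \<in> I. \<theta> b a = \<zero>\<^bsub>S\<^esub>}" using AI b by (auto simp: B0_def)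
    ultimately have "I \<subseteq> {a \<in> I. \<theta> b a = \<zero>\<^bsub>S\<^esub>}" using R.genideal_minimal A(3) by metis
    then show ?thesis using a by blast
  qed
  have "\<exists>D. odd_derivation S H D \<and> (\<forall>a\<in>I. \<forall>x\<in>component P 1.
      \<delta> x = a \<odot>\<^bsub>P\<^esub> \<one>\<^bsub>P\<^esub> \<longrightarrow> D (T x) = \<theta> b a \<odot>\<^bsub>H\<^esub> \<one>\<^bsub>H\<^esub>)" for b
  proof -
    obtain D where "odd_derivation S H D" "\<And>a x. \<lbrakk>a \<in> I; x \<in> component P 1; \<delta> x = a \<odot>\<^bsub>P\<^esub> \<one>\<^bsub>P\<^esub>\<rbrakk>
        \<Longrightarrow> D (T x) = \<theta> b a \<odot>\<^bsub>H\<^esub> \<one>\<^bsub>H\<^esub>"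
      using bockstein[of "\<theta> b", OF \<theta> \<theta>_add \<theta>_smult] by metis
    then show ?thesis by blast
  qed
  then obtain D where D: "\<And>b. odd_derivation S H (D b)"
    and D_T: "\<And>b a x. \<lbrakk>a \<in> I; x \<in> component P 1; \<delta> x = a \<odot>\<^bsub>P\<^esub> \<one>\<^bsub>P\<^esub>\<rbrakk>
      \<Longrightarrow> D b (T x) = \<theta> b a \<odot>\<^bsub>H\<^esub> \<one>\<^bsub>H\<^esub>"
    by metis
  obtain G where G: "G \<in> graded_algebra_hom S H X.E" "\<And>x. x \<in> Z \<Longrightarrow> G (T x) = \<epsilon> x \<odot>\<^bsub>X.E\<^esub> \<one>\<^bsub>X.E\<^esub>"
    by (rule augmentation_graded_hom[OF X.pregraded_E], rule that)
  \<comment> \<open>The enumeration is arbitrary: each factor preserves multiplicativity, and in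
    degree 1 the result is a sum over the set \<open>B0\<close>.\<close>
  obtain bs where bs: "set bs = B0" "distinct bs" using finite_distinct_list[OF B0(1)] by blast
  have bM: "b \<in> set bs \<Longrightarrow> b \<in> carrier M" for b using bs B0 BsM by auto
  define \<psi> where "\<psi> = twist X.E X.\<iota> D G bs"
  have \<psi>: "\<psi> \<in> graded_algebra_hom S H X.E"
    unfolding \<psi>_def
    by (rule twist_hom[OF pregraded_H X.pregraded_E H_span D _ _ _ G(1)])
      (use bM X.incl_component X.incl_square X.incl_commute_component in auto)
  have incl_expand: "X.\<iota> (\<mu> a) = (\<Oplus>\<^bsub>X.E\<^esub>b\<in>B0. \<theta> b a \<odot>\<^bsub>X.E\<^esub> X.\<iota> b)" if a: "a \<in> I" for a
  proof -
    note f = \<kappa>_fin[OF \<mu>M[OF a]]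
    have id: "(\<lambda>s. s) \<in> ring_hom S S" by (rule ring_hom_memI) auto
    have "X.\<iota> (lincomb S M (\<lambda>b. b) (\<kappa> (\<mu> a))) = lincomb S X.E X.\<iota> (\<kappa> (\<mu> a))"
      using lincomb_hom(2)[OF module_conormal X.E.module_axioms id X.incl_closed X.incl_add
          X.incl_smult BsM f] .
    also have "\<dots> = (\<Oplus>\<^bsub>X.E\<^esub>b\<in>B0. \<kappa> (\<mu> a) b \<odot>\<^bsub>X.E\<^esub> X.\<iota> b)"
      by (rule X.E.lincomb_superset[OF f])
        (use BsM X.incl_closed B0 \<theta>_B0[OF _ a] in \<open>auto simp: \<theta>_def\<close>)
    finally show ?thesis unfolding \<kappa>_sum[OF \<mu>M[OF a], symmetric] \<theta>_def .
  qed
  have \<psi>_T: "\<psi> (T x) = X.\<iota> (\<mu> a)"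
    if a: "a \<in> I" and x: "x \<in> component P 1" "\<delta> x = a \<odot>\<^bsub>P\<^esub> \<one>\<^bsub>P\<^esub>" for a x
  proof -
    have xZ: "x \<in> Z" using lift_Z a x by blast
    have Tx: "T x \<in> component H 1" using xZ x(1) H_component by auto
    \<comment> \<open>x has degree 1, so the constant term of the twist vanishes on its class; the
      sum of terms with one derivation remains.\<close>
    have "\<epsilon> x = \<zero>\<^bsub>S\<^esub>" using augmentation_Suc[of x 0] x(1) by simp
    then have G0: "G (T x) = \<zero>\<^bsub>X.E\<^esub>" using G(2)[OF xZ] by simp
    have summand: "X.\<iota> b \<otimes>\<^bsub>X.E\<^esub> G (D b (T x)) = \<theta> b a \<odot>\<^bsub>X.E\<^esub> X.\<iota> b" if "b \<in> set bs" for b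
    proof -
      have "G (D b (T x)) = \<theta> b a \<odot>\<^bsub>X.E\<^esub> \<one>\<^bsub>X.E\<^esub>"
        using graded_algebra_homD(2)[OF G(1) \<theta>[OF a, of b] H.A.one_closed]
          ring_hom_one[OF graded_algebra_homD(1)[OF G(1)]] by (simp add: D_T[OF a x])
      then show ?thesis
        using X.incl_closed[OF bM[OF that]] \<theta>[OF a, of b] by (simp add: X.E.smult_mult_right)
    qed
    have c: "\<theta> b a \<odot>\<^bsub>X.E\<^esub> X.\<iota> b \<in> carrier X.E" if "b \<in> set bs" for b
      using X.incl_closed[OF bM[OF that]] \<theta>[OF a, of b] by simp
    have "\<psi> (T x) = G (T x) \<oplus>\<^bsub>X.E\<^esub> (\<Oplus>\<^bsub>X.E\<^esub>b\<in>set bs. X.\<iota> b \<otimes>\<^bsub>X.E\<^esub> G (D b (T x)))"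
      unfolding \<psi>_def
      by (rule twist_degree_1[OF X.E.assoc_algebra_axioms pregraded_H D _
            graded_algebra_homD(1)[OF G(1)] Tx bs(2)]) (rule X.incl_closed[OF bM])
    also have "(\<Oplus>\<^bsub>X.E\<^esub>b\<in>set bs. X.\<iota> b \<otimes>\<^bsub>X.E\<^esub> G (D b (T x))) =
        (\<Oplus>\<^bsub>X.E\<^esub>b\<in>set bs. \<theta> b a \<odot>\<^bsub>X.E\<^esub> X.\<iota> b)"
      by (rule X.E.M.finsum_cong') (use summand c in auto)
    also have "\<dots> = X.\<iota> (\<mu> a)" using incl_expand[OF a] bs(1) by simp
    finally show ?thesis using G0 X.incl_closed[OF \<mu>M[OF a]] by simp
  qed
  \<comment> \<open>Both sides are homomorphisms out of the exterior algebra, so it suffices to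
    compare them on the class of an element a of I, whose image under the natural map is the class
    of any lift of a.\<close>
  have "\<psi> (natural_map R I P u) = u" if u: "u \<in> carrier X.E" for u
  proof (rule X.exterior_hom_eqI[OF X.E.assoc_algebra_axioms
        graded_algebra_hom_comp[OF natural_map_hom \<psi>] _ _ u, of "\<lambda>u. u"])
    show "(\<lambda>u. u) \<in> graded_algebra_hom S X.E X.E"
      by (auto simp: graded_algebra_hom_def intro: ring_hom_memI)
    fix m assume "m \<in> carrier M"
    then obtain a where a: "a \<in> I" "m = \<mu> a" using M_carrier by auto
    obtain x where x: "x \<in> component P 1" "\<delta> x = a \<odot>\<^bsub>P\<^esub> \<one>\<^bsub>P\<^esub>" using lift_exists[OF a(1)] .
    show "\<psi> (natural_map R I P (X.\<iota> m)) = X.\<iota> m"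
      using natural_map_incl[OF a(1) x] \<psi>_T[OF a(1) x] a(2) by simp
  qed
  then show ?thesis using \<psi> by blast
qed

end

theorem corollary4p2:
  fixes R :: "'a ring" and I :: "'a set" and P :: "('a, 'p) dg_algebra"
    and \<epsilon> :: "'p \<Rightarrow> 'a set"
  defines "S \<equiv> R Quot I"
  defines "E \<equiv> exterior_algebra S (conormal_module R I)"
  assumes "noetherian_ring R" and "local_ring R" and "ideal I R"
    and "free_module S (conormal_module R I)"
    and "dg_algebra_resolution R I P \<epsilon>"
  shows "\<exists>\<psi> \<in> graded_algebra_hom S (Tor_algebra R I P) E.
           \<forall>x\<in>carrier E. \<psi> (natural_map R I P x) = x"
proof -
  obtain Bs where "module S (conormal_module R I)" and Bs: "module_basis S (conormal_module R I) Bs"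
    using assms(6) unfolding free_module_def by blast
  then interpret conormal_resolution R I P \<epsilon>
    using assms(7) unfolding S_def by (intro conormal_resolution.intro conormal_resolution_axioms.intro)
  show ?thesis
    using natural_map_splits[OF assms(3) Bs[unfolded S_def]] unfolding S_def E_def .
qed

end
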